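(* Let $a\in(0,1)$. There exists a measurable function $D$ on $(M,\mu)$, finite $\mu$-almost everywhere, such that for Lebesgue-almost every $z\in\mathbb{R}$, $$\lim_{N\to\infty}\lambda\left\{(\alpha,x)\in\mathbb{T}^2 : \frac{S(\alpha,x,N)}{N^a}\le z\right\}=\mu\left\{(L,\gamma)\in M : D(L,\gamma)\le z\right\}.$$
   Context: $\mathbb{T}^1=\mathbb{R}/\mathbb{Z}$, $\mathbb{T}^2=(\mathbb{R}/\mathbb{Z})^2$, and $\lambda$ denotes the Haar probability measure on $\mathbb{T}^1$ and on $\mathbb{T}^2$. $\varphi$ is the function on $\mathbb{T}^1$ given, with $\mathbb{T}^1$ identified with $(0,1]$, by $\varphi(x)=\frac{1}{x^a}-\frac{1}{1-a}$ (it has zero mean). For $\alpha,x\in\mathbb{T}^1$ and $N\ge1$, $S(\alpha,x,N)=\sum_{n=0}^{N-1}\varphi(x+n\alpha)$. $\tilde M=SL(2,\mathbb{R})/SL(2,\mathbb{Z})$ is identified with the space of unimodular lattices in $\mathbb{R}^2$, $\tilde\mu$ is the $SL(2,\mathbb{R})$-invariant probability measure on $\tilde M$, $M=\tilde M\times\mathbb{T}^2$ and $\mu=\tilde\mu\times\lambda$. *)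

theory Defs
  imports "HOL-Probability.Probability"
begin

section \<open>Tori\<close>

text \<open>The circle \<open>\<real>/\<int>\<close> is represented by the fundamental domain \<open>(0,1]\<close>;
  \<open>circle_rep\<close> sends a real number to the representative of its class.\<close>

definition circle_rep :: "real \<Rightarrow> real" where
  "circle_rep x = x - of_int \<lceil>x\<rceil> + 1"

definition haar1 :: "real measure" where
  "haar1 = restrict_space lborel {0<..1}"

definition haar2 :: "(real \<times> real) measure" where
  "haar2 = haar1 \<Otimes>\<^sub>M haar1"

lemma circle_rep_mem: "circle_rep x \<in> {0<..1}"
  unfolding circle_rep_def by (auto; linarith)

lemma circle_rep_eq_iff: "circle_rep x = circle_rep y \<longleftrightarrow> x - y \<in> \<int>"
proof
  assume "circle_rep x = circle_rep y"
  then have "x - y = of_int (\<lceil>x\<rceil> - \<lceil>y\<rceil>)" by (simp add: circle_rep_def)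
  then show "x - y \<in> \<int>" by (metis Ints_of_int)
next
  assume "x - y \<in> \<int>"
  then obtain k where "x = y + of_int k" by (metis Ints_cases add.commute diff_add_cancel)
  then show "circle_rep x = circle_rep y" by (simp add: circle_rep_def)
qed

lemma prob_space_haar1: "prob_space haar1"
  by (rule prob_spaceI) (simp add: haar1_def space_restrict_space emeasure_restrict_space)

lemma prob_space_haar2: "prob_space haar2"
  unfolding haar2_def by (intro prob_space_pair prob_space_haar1)


section \<open>The Birkhoff sums\<close>

definition phi :: "real \<Rightarrow> real \<Rightarrow> real" where
  "phi a x = 1 / (circle_rep x powr a) - 1 / (1 - a)"

definition birkhoff_sum :: "real \<Rightarrow> real \<Rightarrow> real \<Rightarrow> nat \<Rightarrow> real" where
  "birkhoff_sum a \<alpha> x N = (\<Sum>n<N. phi a (x + real n * \<alpha>))"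


section \<open>The space of unimodular lattices\<close>

definition SL2 :: "(real^2^2) set" where
  "SL2 = {g. det g = 1}"

definition SL2Z :: "(real^2^2) set" where
  "SL2Z = {g \<in> SL2. \<forall>i j. g $ i $ j \<in> \<int>}"

definition lattice_of :: "real^2^2 \<Rightarrow> (real^2) set" where
  "lattice_of g = (*v) g ` {v. \<forall>i. v $ i \<in> \<int>}"

definition unimodular_lattices :: "(real^2) set set" where
  "unimodular_lattices = lattice_of ` SL2"

text \<open>The fibres of \<open>lattice_of\<close> on \<open>SL2\<close> are the left cosets of \<open>SL2Z\<close>, so that
  \<open>unimodular_lattices\<close> is a copy of the quotient.\<close>

lemma SL2Z_inverse:
  assumes "u \<in> SL2Z"
  obtains w where "w \<in> SL2Z" "u ** w = mat 1" "w ** u = mat 1"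
proof
  let ?w = "vector [vector [u$2$2, - u$1$2], vector [- u$2$1, u$1$1]] :: real^2^2"
  have d: "u$1$1 * u$2$2 - u$1$2 * u$2$1 = 1" and int: "\<And>i j. u $ i $ j \<in> \<int>"
    using assms by (auto simp: SL2Z_def SL2_def det_2)
  show "?w \<in> SL2Z"
    using d int by (auto simp: SL2Z_def SL2_def det_2 forall_2 algebra_simps)
  show "u ** ?w = mat 1"
    using d by (simp add: vec_eq_iff forall_2 matrix_matrix_mult_def sum_2 mat_def algebra_simps)
  show "?w ** u = mat 1"
    using d by (simp add: vec_eq_iff forall_2 matrix_matrix_mult_def sum_2 mat_def algebra_simps)
qed

lemma SL2Z_mult_integral:
  assumes "u \<in> SL2Z" "\<forall>i. v $ i \<in> \<int>"
  shows "\<forall>i. (u *v v) $ i \<in> \<int>"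
  using assms by (auto simp: SL2Z_def matrix_vector_mult_def)

lemma lattice_of_eq_iff:
  assumes "g \<in> SL2" "h \<in> SL2"
  shows "lattice_of g = lattice_of h \<longleftrightarrow> (\<exists>u\<in>SL2Z. h = g ** u)"
proof
  assume eq: "lattice_of g = lattice_of h"
  have "invertible g"
    using assms by (simp add: SL2_def invertible_det_nz)
  then obtain k where k: "g ** k = mat 1" "k ** g = mat 1"
    by (auto simp: invertible_def)
  let ?u = "k ** h"
  have h: "h = g ** ?u"
    by (simp add: k matrix_mul_assoc)
  have "det g * det ?u = det h"
    by (metis h det_mul)
  then have "det ?u = 1"
    using assms by (simp add: SL2_def)
  moreover have "?u $ i $ j \<in> \<int>" for i j
  proof -
    have "h *v axis j 1 \<in> lattice_of h"
      by (auto simp: lattice_of_def axis_def)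
    then obtain v where v: "h *v axis j 1 = g *v v" "\<forall>i. v $ i \<in> \<int>"
      unfolding eq[symmetric] unfolding lattice_of_def by blast
    have "?u *v axis j 1 = k *v (g *v v)"
      by (metis v(1) matrix_vector_mul_assoc)
    also have "\<dots> = v"
      by (simp add: matrix_vector_mul_assoc k)
    finally have "column j ?u = v"
      by (simp add: matrix_vector_mult_basis)
    then have "?u $ i $ j = v $ i"
      by (auto simp: column_def vec_eq_iff)
    then show ?thesis
      using v by simp
  qed
  ultimately show "\<exists>u\<in>SL2Z. h = g ** u"
    using h by (intro bexI[of _ ?u]) (auto simp: SL2Z_def SL2_def)
next
  assume "\<exists>u\<in>SL2Z. h = g ** u"
  then obtain u where u: "u \<in> SL2Z" "h = g ** u" by blast
  obtain w where w: "w \<in> SL2Z" "u ** w = mat 1"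
    using SL2Z_inverse[OF u(1)] by metis
  have sub: "lattice_of (p ** q) \<subseteq> lattice_of p" if "q \<in> SL2Z" for p q
    using SL2Z_mult_integral[OF that]
    by (auto simp: lattice_of_def image_iff simp flip: matrix_vector_mul_assoc)
  have "g = h ** w"
    using u w by (metis matrix_mul_assoc matrix_mul_rid)
  then show "lattice_of g = lattice_of h"
    using sub[OF u(1), of g] sub[OF w(1), of h] u(2) by auto
qed

text \<open>The Borel sets of the quotient topology: a set of lattices is open iff its preimage
  in \<open>SL2\<close> is open.\<close>

definition lattice_borel :: "(real^2) set measure" where
  "lattice_borel = sigma unimodular_lattices
     {U. U \<subseteq> unimodular_lattices \<and>
         openin (top_of_set SL2) {g \<in> SL2. lattice_of g \<in> U}}"

definition SL2_invariant_prob :: "(real^2) set measure \<Rightarrow> bool" where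
  "SL2_invariant_prob m \<longleftrightarrow>
     prob_space m \<and> sets m = sets lattice_borel \<and>
     (\<forall>h\<in>SL2. \<forall>A\<in>sets m. emeasure m ((\<lambda>L. (*v) h ` L) ` A) = emeasure m A)"

end

theory Submission
  imports Defs "HOL-Analysis.Kronecker_Approximation_Theorem"
begin

text \<open>The factor \<open>\<T>\<^sup>2\<close> of \<open>M\<close> carries a uniform random variable, so a
  function \<open>D\<close> with any prescribed law exists; hence it suffices that the normalized sums converge
  in law.

  Only the visits of the orbit to a neighbourhood of the singularity of size \<open>R / N\<close> matter. Indeed,
  outside a set of \<open>\<alpha>\<close> of small measure one has \<open>\<bar>q \<alpha> - p\<bar> \<ge> c q\<inverse> (q / N)\<^sup>\<eta>\<close> for all \<open>q \<le> N\<close>, and then cutting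
  the orbit into periods of good rational approximations shows that the number of visits to \<open>(0, t / N]\<close>
  is \<open>t + O(t\<^sup>\<beta>)\<close> with \<open>\<beta> < a\<close>, uniformly in \<open>N\<close>. Summation by parts bounds the contribution of the
  remaining points by \<open>O(R\<^sup>\<beta>\<^sup>-\<^sup>a)\<close>.

  The visits are the points of the affine grid \<open>{(n / N, N (x + n \<alpha> - m))}\<close> in a fixed strip, so everything
  reduces to the convergence in law of sums of a compactly supported continuous function over that grid.
  On the Farey arc of level \<open>N\<close> with denominators \<open>q, q'\<close> the grid has an explicit basis depending
  continuously on \<open>q / N\<close>, \<open>q' / N\<close> and the position in the arc, and its offset runs along the closed
  geodesic \<open>x \<mapsto> (q' x, - q x)\<close>, which equidistributes in the torus. What is left is a Riemann
  sum over coprime pairs. Characteristic functions therefore converge, and tightness identifies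
  their limit as that of a probability law.\<close>

section \<open>Discrepancy of an orbit with a Diophantine rotation angle\<close>

text \<open>For a < 1/2 the points far from the singularity cannot be handled by a second moment:
  averaged over both variables, the square of the sum is N times the squared norm of
  \<open>phi\<close>, which exceeds N^(2a). The excess comes from a small set of angles close to
  rationals, so these are discarded and the others are treated pointwise. The price of a Diophantine
  condition whose failure is rare uniformly in N is a power of t in the discrepancy; \<eta> is tuned
  so that the final exponent 3a/4 stays below a. The Farey basis in turn degenerates when q/N or
  q'/N tends to 0, so arcs with a small denominator are discarded as well; their total length is
  small. Constants are fixed in the order c, R, \<epsilon>, N: c controls the exceptional angles and
  thereby the discrepancy constant K, R makes the far points negligible against K, and \<epsilon> is
  the width of the continuous cut-offs, whose cost is proportional to \<epsilon> (1 + R) up to a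
  term R/N.\<close>

lemma card_int_Ioc_le:
  fixes u v :: real
  assumes "u \<le> v"
  shows "finite {k::int. u < of_int k \<and> of_int k \<le> v}"
    and "real (card {k::int. u < of_int k \<and> of_int k \<le> v}) \<le> v - u + 1"
proof -
  have eq: "{k::int. u < of_int k \<and> of_int k \<le> v} = {\<lfloor>u\<rfloor><..\<lfloor>v\<rfloor>}"
    by (auto simp: floor_less_iff le_floor_iff)
  show "finite {k::int. u < of_int k \<and> of_int k \<le> v}"
    by (simp add: eq)
  have "\<lfloor>u\<rfloor> \<le> \<lfloor>v\<rfloor>" using assms by (rule floor_mono)
  then have "real (card {\<lfloor>u\<rfloor><..\<lfloor>v\<rfloor>}) = of_int \<lfloor>v\<rfloor> - of_int \<lfloor>u\<rfloor>"
    by simp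
  then show "real (card {k::int. u < of_int k \<and> of_int k \<le> v}) \<le> v - u + 1"
    unfolding eq by linarith
qed

lemma circle_rep_eqI:
  assumes "0 < y" "y \<le> 1" "x - y \<in> \<int>"
  shows "circle_rep x = y"
proof -
  obtain k where k: "x = y + of_int k"
    using assms(3) by (metis Ints_cases add.commute diff_add_cancel)
  have "\<lceil>y\<rceil> = 1" using assms by (simp add: ceiling_eq_iff)
  then show ?thesis by (simp add: circle_rep_def k)
qed

lemma circle_rep_add_int [simp]: "circle_rep (x + of_int k) = circle_rep x"
  by (simp add: circle_rep_eq_iff)

lemma circle_rep_pos: "0 < circle_rep x" and circle_rep_le_1: "circle_rep x \<le> 1"
  using circle_rep_mem[of x] by auto

text \<open>Over one period the points behave like x + j p / q: the drift j |\<alpha> - p/q| is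
  below 1/q, and the residues j p modulo q are distinct. After scaling by q a visit is encoded by
  the integer j p - q m, and distinct visits give distinct integers in a window of length q (v - u)
  + 2.\<close>

lemma block_upper_bound:
  fixes \<alpha> x u v :: real and p :: int and q :: nat
  assumes q: "0 < q" and cop: "coprime p (int q)" and app: "\<bar>real q * \<alpha> - of_int p\<bar> \<le> 1 / real q"
    and uv: "u \<le> v"
  shows "real (card {j. j < q \<and> (\<exists>m::int. u < x + real j * \<alpha> - of_int m \<and> x + real j * \<alpha> - of_int m \<le> v)})
    \<le> real q * (v - u) + 3"
proof -
  let ?J = "{j. j < q \<and> (\<exists>m::int. u < x + real j * \<alpha> - of_int m \<and> x + real j * \<alpha> - of_int m \<le> v)}"
  \<comment> \<open>The margin 1 on each side absorbs the drift, which is below 1 after scaling by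
    \<open>q\<close>.\<close>
  let ?K = "{k::int. real q * u - real q * x - 1 < of_int k \<and> of_int k \<le> real q * v - real q * x + 1}"
  have "\<forall>j\<in>?J. \<exists>m::int. u < x + real j * \<alpha> - of_int m \<and> x + real j * \<alpha> - of_int m \<le> v"
    by auto
  from bchoice[OF this] obtain m :: "nat \<Rightarrow> int" where
    m: "\<And>j. j \<in> ?J \<Longrightarrow> u < x + real j * \<alpha> - of_int (m j)"
      "\<And>j. j \<in> ?J \<Longrightarrow> x + real j * \<alpha> - of_int (m j) \<le> v"
    by blast
  define f where "f j = int j * p - int q * m j" for j
  have "inj_on f ?J"
  proof (rule inj_onI)
    fix i j assume ij: "i \<in> ?J" "j \<in> ?J" "f i = f j"
    then have "(int i - int j) * p = int q * (m i - m j)"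
      by (simp add: f_def algebra_simps)
    then have "int q dvd (int i - int j) * p" by simp
    then have "int q dvd int i - int j"
      using cop by (simp add: coprime_commute coprime_dvd_mult_left_iff)
    moreover have "\<bar>int i - int j\<bar> < int q" using ij by auto
    ultimately have "int i - int j = 0"
      by (metis dvd_imp_le_int linorder_not_le abs_of_nat)
    then show "i = j" by simp
  qed
  moreover have "f ` ?J \<subseteq> ?K"
  proof (rule image_subsetI)
    fix j assume j: "j \<in> ?J"
    have e: "of_int (f j) = real q * (x + real j * \<alpha> - of_int (m j)) - real q * x - real j * (real q * \<alpha> - of_int p)"
      by (simp add: f_def algebra_simps)
    have "\<bar>real j * (real q * \<alpha> - of_int p)\<bar> \<le> real j * (1 / real q)"
      unfolding abs_mult using mult_left_mono[OF app, of "real j"] by simp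
    also have "\<dots> < 1" using j q by (simp add: divide_simps)
    finally have b: "\<bar>real j * (real q * \<alpha> - of_int p)\<bar> < 1" .
    have "real q * u < real q * (x + real j * \<alpha> - of_int (m j))"
      using m(1)[OF j] q by simp
    moreover have "real q * (x + real j * \<alpha> - of_int (m j)) \<le> real q * v"
      using m(2)[OF j] q by simp
    ultimately show "f j \<in> ?K"
      using e b by (simp add: abs_less_iff)
  qed
  moreover have le: "real q * u - real q * x - 1 \<le> real q * v - real q * x + 1"
    using mult_left_mono[OF uv, of "real q"] by simp
  ultimately have "card ?J \<le> card ?K"
    using card_inj_on_le card_int_Ioc_le(1)[OF le] by blast
  also have "real (card ?K) \<le> real q * (v - u) + 3"
    using card_int_Ioc_le(2)[OF le] by (simp add: algebra_simps)
  finally show ?thesis by simp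
qed

abbreviation orbit :: "real \<Rightarrow> real \<Rightarrow> nat \<Rightarrow> real" where
  "orbit \<alpha> x n \<equiv> circle_rep (x + real n * \<alpha>)"

definition hits :: "real \<Rightarrow> real \<Rightarrow> real \<Rightarrow> nat \<Rightarrow> nat" where
  "hits \<alpha> x l n = card {j. j < n \<and> orbit \<alpha> x j \<le> l}"

lemma hits_0 [simp]: "hits \<alpha> x l 0 = 0"
  by (simp add: hits_def)

lemma hits_add: "hits \<alpha> x l (m + n) = hits \<alpha> x l m + hits \<alpha> (x + real m * \<alpha>) l n"
proof -
  let ?P = "\<lambda>j. orbit \<alpha> x j \<le> l"
  have "{j. j < m + n \<and> ?P j} = {j. j < m \<and> ?P j} \<union> (\<lambda>j. m + j) ` {j. j < n \<and> ?P (m + j)}"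
  proof (intro set_eqI iffI)
    fix j assume j: "j \<in> {j. j < m + n \<and> ?P j}"
    show "j \<in> {j. j < m \<and> ?P j} \<union> (\<lambda>j. m + j) ` {j. j < n \<and> ?P (m + j)}"
    proof (cases "j < m")
      case False
      then have "j = m + (j - m)" by simp
      with j False show ?thesis by (intro UnI2 image_eqI[of _ _ "j - m"]) auto
    qed (use j in auto)
  qed auto
  moreover have "card ((\<lambda>j. m + j) ` {j. j < n \<and> ?P (m + j)}) = card {j. j < n \<and> ?P (m + j)}"
    by (rule card_image) simp
  moreover have "card ({j. j < m \<and> ?P j} \<union> (\<lambda>j. m + j) ` {j. j < n \<and> ?P (m + j)}) =
      card {j. j < m \<and> ?P j} + card ((\<lambda>j. m + j) ` {j. j < n \<and> ?P (m + j)})"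
    by (rule card_Un_disjoint) auto
  ultimately show ?thesis
    by (simp add: hits_def algebra_simps)
qed

text \<open>The lower bound is the upper bound for the complementary interval (l, 1], since the two
  counts add up to \<open>q\<close>.\<close>

lemma hits_block:
  assumes q: "0 < q" and cop: "coprime p (int q)" and app: "\<bar>real q * \<alpha> - of_int p\<bar> \<le> 1 / real q"
    and l: "0 \<le> l" "l \<le> 1"
  shows "\<bar>real (hits \<alpha> x l q) - real q * l\<bar> \<le> 3"
proof -
  let ?y = "\<lambda>j. orbit \<alpha> x j"
  have y: "?y j = x + real j * \<alpha> - of_int (\<lceil>x + real j * \<alpha>\<rceil> - 1)" for j
    by (simp add: circle_rep_def)
  have "{j. j < q \<and> ?y j \<le> l} \<subseteq> {j. j < q \<and> (\<exists>m::int. 0 < x + real j * \<alpha> - of_int m \<and> x + real j * \<alpha> - of_int m \<le> l)}"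
    by (intro Collect_mono impI) (metis y circle_rep_pos)
  then have "card {j. j < q \<and> ?y j \<le> l} \<le> card {j. j < q \<and> (\<exists>m::int. 0 < x + real j * \<alpha> - of_int m \<and> x + real j * \<alpha> - of_int m \<le> l)}"
    by (intro card_mono) auto
  then have up: "real (hits \<alpha> x l q) \<le> real q * l + 3"
    using block_upper_bound[OF q cop app l(1), of x] by (simp add: hits_def)
  have "{j. j < q \<and> \<not> ?y j \<le> l} \<subseteq> {j. j < q \<and> (\<exists>m::int. l < x + real j * \<alpha> - of_int m \<and> x + real j * \<alpha> - of_int m \<le> 1)}"
    by (intro Collect_mono impI) (metis y circle_rep_le_1 not_le)
  then have "card {j. j < q \<and> \<not> ?y j \<le> l} \<le> card {j. j < q \<and> (\<exists>m::int. l < x + real j * \<alpha> - of_int m \<and> x + real j * \<alpha> - of_int m \<le> 1)}"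
    by (intro card_mono) auto
  then have lo: "real (card {j. j < q \<and> \<not> ?y j \<le> l}) \<le> real q * (1 - l) + 3"
    using block_upper_bound[OF q cop app l(2), of x] by simp
  have "card {j. j < q \<and> ?y j \<le> l} + card {j. j < q \<and> \<not> ?y j \<le> l} = card ({j. j < q \<and> ?y j \<le> l} \<union> {j. j < q \<and> \<not> ?y j \<le> l})"
    by (rule card_Un_disjoint[symmetric]) auto
  also have "{j. j < q \<and> ?y j \<le> l} \<union> {j. j < q \<and> \<not> ?y j \<le> l} = {..<q}" by auto
  finally have "real (hits \<alpha> x l q) + real (card {j. j < q \<and> \<not> ?y j \<le> l}) = real q"
    by (simp add: hits_def flip: of_nat_add)
  with up lo show ?thesis by (simp add: algebra_simps abs_le_iff)
qed

lemma hits_blocks: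
  assumes q: "0 < q" and cop: "coprime p (int q)" and app: "\<bar>real q * \<alpha> - of_int p\<bar> \<le> 1 / real q"
    and l: "0 \<le> l" "l \<le> 1"
  shows "\<bar>real (hits \<alpha> x l (b * q)) - real (b * q) * l\<bar> \<le> 3 * real b"
proof (induction b)
  case (Suc b)
  have "real (hits \<alpha> x l (Suc b * q)) - real (Suc b * q) * l =
    (real (hits \<alpha> x l (b * q)) - real (b * q) * l) + (real (hits \<alpha> (x + real (b * q) * \<alpha>) l q) - real q * l)"
    using hits_add[of \<alpha> x l "b * q" q] by (simp add: algebra_simps)
  with Suc hits_block[OF assms, of "x + real (b * q) * \<alpha>"] show ?case
    by simp
qed simp

text \<open>An Ostrowski-type descent: long orbits are cut into periods of good approximations, and
  each cut at least halves the length of the remainder.\<close>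

lemma hits_descent:
  fixes \<alpha> l B B' :: real
  assumes l: "0 \<le> l" "l \<le> 1" and B: "0 \<le> B"
    and base: "\<And>n x. n \<le> N \<Longrightarrow> real n * l \<le> 1 \<Longrightarrow> \<bar>real (hits \<alpha> x l n) - real n * l\<bar> \<le> B'"
    and app: "\<And>n. n \<le> N \<Longrightarrow> 1 < real n * l \<Longrightarrow> \<exists>q p. 0 < q \<and> q \<le> n \<and> coprime p (int q) \<and>
      \<bar>real q * \<alpha> - of_int p\<bar> \<le> 1 / real q \<and> real n / real q \<le> B"
  shows "n \<le> N \<Longrightarrow> real n * l \<le> 2 ^ k \<Longrightarrow> \<bar>real (hits \<alpha> x l n) - real n * l\<bar> \<le> 3 * B * real k + B'"
proof (induction k arbitrary: n x)
  case 0
  then show ?case using base by simp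
next
  case (Suc k)
  show ?case
  proof (cases "real n * l \<le> 1")
    case True
    then have "\<bar>real (hits \<alpha> x l n) - real n * l\<bar> \<le> B'" using base Suc by blast
    also have "\<dots> \<le> 3 * B * real (Suc k) + B'" using B by simp
    finally show ?thesis .
  next
    case False
    then obtain q p where q: "0 < q" "q \<le> n" "coprime p (int q)"
      "\<bar>real q * \<alpha> - of_int p\<bar> \<le> 1 / real q" "real n / real q \<le> B"
      using app[of n] Suc.prems by auto
    let ?b = "n div q" and ?r = "n mod q"
    have n: "n = ?b * q + ?r" by simp
    have "2 * ?r \<le> n"
    proof -
      have "?b \<ge> 1" using q by (simp add: div_greater_zero_iff Suc_leI)
      then have "q \<le> ?b * q" by simp
      moreover have "?r < q" using q by simp
      ultimately show ?thesis using n by linarith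
    qed
    then have "2 * real ?r \<le> real n" by linarith
    then have "2 * (real ?r * l) \<le> real n * l" using l mult_right_mono by fastforce
    then have "real ?r * l \<le> 2 ^ k" using Suc.prems by simp
    moreover have "?r \<le> N" using Suc.prems by (meson le_trans mod_less_eq_dividend)
    ultimately have r: "\<bar>real (hits \<alpha> (x + real (?b * q) * \<alpha>) l ?r) - real ?r * l\<bar> \<le> 3 * B * real k + B'"
      by (rule Suc.IH[rotated])
    \<comment> \<open>The \<open>?b\<close> full periods cost 3 each, and there are at most n/q
      \<le> B of them.\<close>
    have "real ?b \<le> real n / real q" by (rule of_nat_div_le_of_nat)
    then have "real ?b \<le> B" using q by linarith
    have "real (hits \<alpha> x l n) - real n * l =
      (real (hits \<alpha> x l (?b * q)) - real (?b * q) * l) + (real (hits \<alpha> (x + real (?b * q) * \<alpha>) l ?r) - real ?r * l)"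
    proof -
      have h: "hits \<alpha> x l n = hits \<alpha> x l (?b * q) + hits \<alpha> (x + real (?b * q) * \<alpha>) l ?r"
        using hits_add[of \<alpha> x l "?b * q" ?r] by simp
      have "real n = real (?b * q) + real ?r"
        by (metis n of_nat_add)
      then have "real n * l = real (?b * q) * l + real ?r * l"
        by (simp only: distrib_right)
      then show ?thesis unfolding h of_nat_add by linarith
    qed
    with r hits_blocks[OF q(1,3,4) l, of x ?b] \<open>real ?b \<le> B\<close> show ?thesis
      by (simp add: algebra_simps)
  qed
qed

section \<open>Diophantine angles and the discrepancy they allow\<close>

text \<open>Rationals with denominator up to \<open>N\<close> are avoided at the Dirichlet scale
  c/q, relaxed by (q/N)^\<eta>. Without the relaxation the lengths of the forbidden intervals would
  add up to order c log N; with it the total stays of order c / \<eta>.\<close>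

definition diophantine :: "real \<Rightarrow> real \<Rightarrow> nat \<Rightarrow> real \<Rightarrow> bool" where
  "diophantine c \<eta> N \<alpha> \<longleftrightarrow> (\<forall>q p. 1 \<le> q \<and> q \<le> N \<longrightarrow>
     c / real q * (real q / real N) powr \<eta> \<le> \<bar>real q * \<alpha> - of_int (p::int)\<bar>)"

text \<open>Base case of the descent. Orbit points at distinct times below n \<le> N/t are at
  distance at least \<open>\<kappa>\<close> from each other, so an interval of length t/N holds at
  most t / (N \<kappa>) + 1 of them; this is a power of t, with no trace of
  \<open>N\<close>.\<close>

lemma hits_short:
  assumes dio: "diophantine c \<eta> N \<alpha>" and c: "0 < c" "c \<le> 1" and \<eta>: "0 < \<eta>" "\<eta> < 1"
    and t: "1 \<le> t" and n: "n \<le> N" "real n * (t / real N) \<le> 1" and N: "0 < N"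
  shows "real (hits \<alpha> x (t / real N) n) \<le> t powr \<eta> / c + 1"
proof -
  \<comment> \<open>Value of the lower bound (c/q) (q/N)^\<eta> at q = N/t. The bound decreases in q
    because \<eta> < 1, so this is its minimum over q \<le> N/t.\<close>
  define \<kappa> where "\<kappa> = c * t powr (1 - \<eta>) / real N"
  have \<kappa>: "0 < \<kappa>" using c t N by (simp add: \<kappa>_def)
  let ?J = "{j. j < n \<and> orbit \<alpha> x j \<le> t / real N}"
  define f where "f j = \<lceil>orbit \<alpha> x j / \<kappa>\<rceil>" for j
  have sep: "\<kappa> \<le> \<bar>real q * \<alpha> - of_int p\<bar>" if q: "1 \<le> q" "q \<le> n" for q p
  proof -
    have "\<kappa> = c * (real N / t) powr (\<eta> - 1) * real N powr (- \<eta>)"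
      using t N by (simp add: \<kappa>_def powr_divide powr_diff powr_minus field_simps)
    also have "\<dots> \<le> c * real q powr (\<eta> - 1) * real N powr (- \<eta>)"
    proof -
      have "real q \<le> real N / t"
      proof -
        have "real n \<le> real N / t" using n N t by (simp add: field_simps)
        then show ?thesis using q by linarith
      qed
      then have "(real N / t) powr (\<eta> - 1) \<le> real q powr (\<eta> - 1)"
        using q \<eta> by (intro powr_mono2') auto
      then show ?thesis using c by (intro mult_right_mono mult_left_mono) auto
    qed
    also have "\<dots> = c / real q * (real q / real N) powr \<eta>"
      using q N by (simp add: powr_divide powr_diff powr_minus field_simps)
    also have "\<dots> \<le> \<bar>real q * \<alpha> - of_int p\<bar>"
      using dio q n unfolding diophantine_def by (meson le_trans)
    finally show ?thesis .
  qed
  have lt: False if ij: "i \<in> ?J" "j \<in> ?J" "f i = f j" "j < i" for i j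
  proof -
    let ?a = "orbit \<alpha> x i" and ?b = "orbit \<alpha> x j"
    have "\<bar>?a / \<kappa> - ?b / \<kappa>\<bar> < 1"
      using ij(3) unfolding f_def by linarith
    then have "\<bar>?a - ?b\<bar> < \<kappa>" using \<kappa> by (simp add: field_simps abs_if split: if_splits)
    moreover have "?a - ?b = real (i - j) * \<alpha> - of_int (\<lceil>x + real i * \<alpha>\<rceil> - \<lceil>x + real j * \<alpha>\<rceil>)"
      using ij(4) by (simp add: circle_rep_def of_nat_diff algebra_simps)
    moreover have "1 \<le> i - j" "i - j \<le> n" using ij by auto
    ultimately show False using sep by (metis linorder_not_le)
  qed
  have "inj_on f ?J"
  proof (rule inj_onI)
    fix i j assume ij: "i \<in> ?J" "j \<in> ?J" "f i = f j"
    show "i = j"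
      using lt[OF ij] lt[OF ij(2,1) ij(3)[symmetric]] by (metis linorder_neqE_nat)
  qed
  moreover have "f ` ?J \<subseteq> {0<..\<lceil>t / real N / \<kappa>\<rceil>}"
  proof (rule image_subsetI)
    fix j assume "j \<in> ?J"
    then have "orbit \<alpha> x j / \<kappa> \<le> t / real N / \<kappa>"
      using \<kappa> by (intro divide_right_mono) auto
    then have "f j \<le> \<lceil>t / real N / \<kappa>\<rceil>" unfolding f_def by (rule ceiling_mono)
    moreover have "0 < orbit \<alpha> x j / \<kappa>" using \<kappa> circle_rep_pos by simp
    ultimately show "f j \<in> {0<..\<lceil>t / real N / \<kappa>\<rceil>}"
      by (simp add: f_def)
  qed
  ultimately have "card ?J \<le> card {0<..\<lceil>t / real N / \<kappa>\<rceil>}"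
    by (intro card_inj_on_le) auto
  moreover have "t / real N / \<kappa> > 0" using t N \<kappa> by simp
  ultimately have "real (hits \<alpha> x (t / real N) n) \<le> t / real N / \<kappa> + 1"
    unfolding hits_def by simp linarith
  also have "t / real N / \<kappa> = t powr \<eta> / c"
    using t N c by (simp add: \<kappa>_def powr_diff field_simps)
  finally show ?thesis .
qed

text \<open>A piece of length n > N/t has a Dirichlet approximation with error below 1/n, and the
  Diophantine condition then keeps n/q below a bound \<open>B\<close> of order t^(a/2), free of
  \<open>N\<close>. About log t cuts suffice, and they cost at most a further t^(a/4).\<close>

lemma hits_discrepancy:
  fixes a c t :: real
  assumes a: "0 < a" "a < 1" and c: "0 < c" "c \<le> 1" and N: "0 < N" and t: "1 \<le> t" "t \<le> real N"
    and dio: "diophantine c (a / (2 + a)) N \<alpha>"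
  shows "\<bar>real (hits \<alpha> x (t / real N) N) - t\<bar> \<le>
    (3 * c powr (- 1 - a / 2) * (4 / (a * ln 2) + 1) + 1 / c + 1) * t powr (3 * a / 4)"
proof -
  \<comment> \<open>This choice gives 1 / (1 - \<eta>) = 1 + a/2 and \<eta> / (1 - \<eta>) = a/2, so
    solving w^(1-\<eta>) < t^\<eta> / c for w = n/q yields exactly the exponent a/2 in
    \<open>B\<close>.\<close>
  define \<eta> where "\<eta> = a / (2 + a)"
  have \<eta>: "0 < \<eta>" "\<eta> < 1" "\<eta> \<le> 3 * a / 4" using a by (auto simp: \<eta>_def field_simps)
  define B where "B = t powr (a / 2) * c powr (- 1 - a / 2)"
  define l where "l = t / real N"
  have l: "0 \<le> l" "l \<le> 1" using t N by (auto simp: l_def)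
  have B0: "0 \<le> B" by (simp add: B_def)
  have tp: "1 \<le> t powr b" if "0 \<le> b" for b using t that by (simp add: ge_one_powr_ge_zero)
  define k where "k = nat \<lceil>log 2 t\<rceil>"
  have "\<bar>real (hits \<alpha> x l N) - real N * l\<bar> \<le> 3 * B * real k + (t powr \<eta> / c + 1)"
  proof (rule hits_descent[OF l B0])
    fix n x assume n: "n \<le> N" "real n * l \<le> 1"
    have "real (hits \<alpha> x l n) \<le> t powr \<eta> / c + 1"
      using hits_short[OF dio[folded \<eta>_def] c \<eta>(1,2) t(1) n(1) _ N, folded l_def] n by simp
    moreover have "0 \<le> real n * l" "0 \<le> t powr \<eta> / c" using l c by auto
    ultimately show "\<bar>real (hits \<alpha> x l n) - real n * l\<bar> \<le> t powr \<eta> / c + 1"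
      using n by (simp add: abs_le_iff)
  next
    fix n assume n: "n \<le> N" "1 < real n * l"
    then have "0 < n" by (cases n) auto
    then obtain h k where hk: "coprime h k" "0 < k" "k \<le> int n" "\<bar>of_int k * \<alpha> - of_int h\<bar> < 1 / real n"
      by (rule Dirichlet_approx_coprime)
    define q where "q = nat k"
    have q: "0 < q" "q \<le> n" "k = int q" using hk by (auto simp: q_def)
    have ap: "\<bar>real q * \<alpha> - of_int h\<bar> < 1 / real n" using hk q by simp
    define w where "w = real n / real q"
    have w: "0 < w" using q by (simp add: w_def)
    have "1 / real n \<le> 1 / real q" using q by (simp add: frac_le)
    moreover have "w \<le> B"
    proof -
      have "c / real q * (real q / real N) powr \<eta> < 1 / real n"
      proof -
        have "1 \<le> q \<and> q \<le> N" using q n by auto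
        then have "c / real q * (real q / real N) powr \<eta> \<le> \<bar>real q * \<alpha> - of_int h\<bar>"
          using dio unfolding diophantine_def \<eta>_def by blast
        with ap show ?thesis by linarith
      qed
      then have "c * (real q / real N) powr \<eta> * w < 1"
        using q \<open>0 < n\<close> by (simp add: w_def field_simps)
      \<comment> \<open>From n > N/t one gets q/N = n / (w N) > 1 / (t w); this removes
        \<open>N\<close> and leaves an inequality in \<open>w\<close> and \<open>t\<close>
        only.\<close>
      moreover have "1 / (t * w) \<le> real q / real N"
        using n q N t \<open>0 < n\<close> by (simp add: w_def l_def field_simps)
      then have "(1 / (t * w)) powr \<eta> \<le> (real q / real N) powr \<eta>"
        using \<eta> t w by (intro powr_mono2) auto
      then have "c * (1 / (t * w)) powr \<eta> * w \<le> c * (real q / real N) powr \<eta> * w"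
        using c w by (intro mult_right_mono mult_left_mono) auto
      ultimately have "c * (1 / (t * w)) powr \<eta> * w < 1" by linarith
      then have "w powr (1 - \<eta>) < t powr \<eta> / c"
        using t w c by (simp add: powr_divide powr_mult powr_diff field_simps)
      then have "(w powr (1 - \<eta>)) powr (1 + a / 2) \<le> (t powr \<eta> / c) powr (1 + a / 2)"
        using a by (intro powr_mono2) auto
      moreover have "(1 - \<eta>) * (1 + a / 2) = 1" "\<eta> * (1 + a / 2) = a / 2"
        using a by (auto simp: \<eta>_def field_simps)
      moreover have "(t powr \<eta> / c) powr (1 + a / 2) = t powr (\<eta> * (1 + a / 2)) * c powr (- (1 + a / 2))"
        using c t by (simp only: powr_divide powr_powr powr_minus_divide) simp
      ultimately show "w \<le> B"
        using w by (simp add: powr_powr B_def)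
    qed
    ultimately show "\<exists>q p. 0 < q \<and> q \<le> n \<and> coprime p (int q) \<and>
      \<bar>real q * \<alpha> - of_int p\<bar> \<le> 1 / real q \<and> real n / real q \<le> B"
      using q ap hk by (intro exI[of _ q] exI[of _ h]) (auto simp: w_def)
  next
    have "real N * l = t" using N by (simp add: l_def)
    also have "t = 2 powr (log 2 t)" using t by simp
    also have "\<dots> \<le> 2 powr (real k)" unfolding k_def by (intro powr_mono) (auto, linarith)
    also have "\<dots> = 2 ^ k" by (simp add: powr_realpow)
    finally show "real N * l \<le> 2 ^ k" .
  qed simp
  also have "real N * l = t" using N by (simp add: l_def)
  also have "3 * B * real k + (t powr \<eta> / c + 1) \<le>
    3 * B * ((4 / (a * ln 2) + 1) * t powr (a / 4)) + (t powr (3 * a / 4) / c + t powr (3 * a / 4))"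
  proof (intro add_mono mult_left_mono divide_right_mono)
    have "0 \<le> log 2 t" using t by simp
    then have "real k \<le> log 2 t + 1" unfolding k_def by linarith
    also have "log 2 t = ln t / ln 2" by (simp add: log_def)
    \<comment> \<open>Here ln t \<le> t^b / b with b = a/4: the logarithmic number of cuts is paid
      with half of the room between the exponents a/2 and a.\<close>
    also have "\<dots> \<le> (t powr (a / 4) / (a / 4)) / ln 2"
      using ln_powr_bound[of t "a / 4"] t a by (intro divide_right_mono) auto
    also have "\<dots> + 1 \<le> (t powr (a / 4) / (a / 4)) / ln 2 + t powr (a / 4)"
      using tp[of "a / 4"] a by simp
    also have "\<dots> = (4 / (a * ln 2) + 1) * t powr (a / 4)" using a by (simp add: field_simps)
    finally show "real k \<le> (4 / (a * ln 2) + 1) * t powr (a / 4)" by simp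
  qed (use \<eta> t tp B0 c a in \<open>auto intro: powr_mono\<close>)
  also have "\<dots> = (3 * c powr (- 1 - a / 2) * (4 / (a * ln 2) + 1) + 1 / c + 1) * t powr (3 * a / 4)"
  proof -
    have "t powr (3 * a / 4) = t powr (a / 2) * t powr (a / 4)"
      by (simp flip: powr_add)
    then show ?thesis by (simp add: B_def algebra_simps)
  qed
  finally show ?thesis by (simp add: l_def)
qed

section \<open>Measure of the exceptional angles\<close>

lemma sum_powr_le:
  fixes \<eta> :: real
  assumes "0 < \<eta>" "\<eta> < 1"
  shows "(\<Sum>q=1..N. real q powr (\<eta> - 1)) \<le> real N powr \<eta> / \<eta>"
proof (induction N)
  case (Suc N)
  have "\<eta> * real (Suc N) powr (\<eta> - 1) \<le> real (Suc N) powr \<eta> - real N powr \<eta>"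
  proof (cases "N = 0")
    case True
    then show ?thesis using assms by simp
  next
    case False
    have "\<exists>z. real N < z \<and> z < real (Suc N) \<and>
        real (Suc N) powr \<eta> - real N powr \<eta> = (real (Suc N) - real N) * (\<eta> * z powr (\<eta> - 1))"
      using False by (intro MVT2) (auto intro!: derivative_eq_intros simp: powr_diff field_simps)
    then obtain z where z: "real N < z" "z < real (Suc N)"
      "real (Suc N) powr \<eta> - real N powr \<eta> = \<eta> * z powr (\<eta> - 1)" by auto
    have "real (Suc N) powr (\<eta> - 1) \<le> z powr (\<eta> - 1)"
      using z assms by (intro powr_mono2') auto
    with z assms show ?thesis by simp
  qed
  then have "real (Suc N) powr (\<eta> - 1) \<le> real (Suc N) powr \<eta> / \<eta> - real N powr \<eta> / \<eta>"
    using assms by (simp add: field_simps)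
  with Suc.IH show ?case by simp
qed simp

lemma space_haar1 [simp]: "space haar1 = {0<..1}"
  by (simp add: haar1_def space_restrict_space)

lemma haar1_Int_in_sets: "A \<in> sets borel \<Longrightarrow> {0<..1} \<inter> A \<in> sets haar1"
  by (auto simp: haar1_def sets_restrict_space)

lemma measure_haar1_Icc_le: "u \<le> v \<Longrightarrow> measure haar1 ({0<..1} \<inter> {u..v}) \<le> v - u"
proof -
  assume uv: "u \<le> v"
  have "measure haar1 ({0<..1} \<inter> {u..v}) = measure lborel ({0<..1} \<inter> {u..v})"
    unfolding haar1_def by (rule measure_restrict_space) auto
  also have "\<dots> \<le> measure lborel {u..v}"
    by (rule measure_mono_fmeasurable) (use \<open>u \<le> v\<close> in \<open>auto intro!: fmeasurableI\<close>)
  finally show ?thesis using uv by simp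
qed

text \<open>Union bound over the fractions p/q: for each q there are q + 1 \<le> 2q intervals of
  length 2 \<delta>(q) / q, in total at most 4 \<delta>(q). The sum of q^(\<eta>-1) up to N is at
  most N^\<eta> / \<eta>, which cancels the factor N^(-\<eta>) in \<delta>.\<close>

lemma diophantine_measure:
  fixes c \<eta> :: real
  assumes c: "0 < c" "c \<le> 1" and \<eta>: "0 < \<eta>" "\<eta> < 1" and N: "0 < N"
  obtains E where "E \<in> sets haar1" "measure haar1 E \<le> 4 * c / \<eta>"
    "\<And>\<alpha>. \<alpha> \<in> {0<..1} - E \<Longrightarrow> diophantine c \<eta> N \<alpha>"
proof
  interpret prob_space haar1 by (rule prob_space_haar1)
  define \<delta> where "\<delta> q = c / real q * (real q / real N) powr \<eta>" for q
  define I where "I q p = {0<..1} \<inter> {(of_int p - \<delta> q) / real q .. (of_int p + \<delta> q) / real q}" for q p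
  define E where "E = (\<Union>q\<in>{1..N}. \<Union>p\<in>{0..int q}. I q p)"
  have \<delta>: "0 < \<delta> q" if "1 \<le> q" for q
    using c N that by (simp add: \<delta>_def)
  have \<delta>1: "\<delta> q \<le> 1" if q: "1 \<le> q" "q \<le> N" for q
  proof -
    have "(real q / real N) powr \<eta> \<le> 1"
      using q \<eta> by (intro powr_le1) auto
    moreover have "c / real q \<le> 1" using c q by (simp add: field_simps)
    ultimately show ?thesis unfolding \<delta>_def using c by (intro mult_le_one) auto
  qed
  have I: "I q p \<in> sets haar1" for q p unfolding I_def by (rule haar1_Int_in_sets) simp
  show "E \<in> sets haar1" unfolding E_def using I by auto
  have "measure haar1 E \<le> (\<Sum>q=1..N. measure haar1 (\<Union>p\<in>{0..int q}. I q p))"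
    unfolding E_def by (rule measure_UNION_le) (use I in auto)
  also have "\<dots> \<le> (\<Sum>q=1..N. 4 * c * real N powr (- \<eta>) * real q powr (\<eta> - 1))"
  proof (rule sum_mono)
    fix q assume q: "q \<in> {1..N}"
    have "measure haar1 (\<Union>p\<in>{0..int q}. I q p) \<le> (\<Sum>p\<in>{0..int q}. measure haar1 (I q p))"
      by (rule measure_UNION_le) (use I in auto)
    also have "\<dots> \<le> (\<Sum>p\<in>{0..int q}. 2 * \<delta> q / real q)"
    proof (rule sum_mono)
      fix p
      have "measure haar1 (I q p) \<le> (of_int p + \<delta> q) / real q - (of_int p - \<delta> q) / real q"
        unfolding I_def using \<delta>[of q] q by (intro measure_haar1_Icc_le divide_right_mono) auto
      then show "measure haar1 (I q p) \<le> 2 * \<delta> q / real q" by (simp add: diff_divide_distrib add_divide_distrib)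
    qed
    also have "\<dots> = real (q + 1) * (2 * \<delta> q / real q)" by simp
    also have "\<dots> \<le> (2 * real q) * (2 * \<delta> q / real q)"
      using q \<delta>[of q] by (intro mult_right_mono) auto
    also have "\<dots> = 4 * \<delta> q" using q by simp
    also have "\<dots> = 4 * c * real N powr (- \<eta>) * real q powr (\<eta> - 1)"
      using q N by (simp add: \<delta>_def powr_divide powr_minus powr_diff field_simps)
    finally show "measure haar1 (\<Union>p\<in>{0..int q}. I q p) \<le> 4 * c * real N powr (- \<eta>) * real q powr (\<eta> - 1)" .
  qed
  also have "\<dots> = 4 * c * real N powr (- \<eta>) * (\<Sum>q=1..N. real q powr (\<eta> - 1))"
    by (simp add: sum_distrib_left)
  also have "\<dots> \<le> 4 * c * real N powr (- \<eta>) * (real N powr \<eta> / \<eta>)"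
    using c by (intro mult_left_mono sum_powr_le \<eta>) auto
  also have "\<dots> = 4 * c / \<eta>" using N \<eta> by (simp add: powr_minus field_simps)
  finally show "measure haar1 E \<le> 4 * c / \<eta>" .
  fix \<alpha> :: real assume \<alpha>: "\<alpha> \<in> {0<..1} - E"
  show "diophantine c \<eta> N \<alpha>"
    unfolding diophantine_def
  proof (intro allI impI, rule ccontr)
    fix q and p :: int assume q: "1 \<le> q \<and> q \<le> N"
    assume "\<not> c / real q * (real q / real N) powr \<eta> \<le> \<bar>real q * \<alpha> - of_int p\<bar>"
    then have *: "\<bar>real q * \<alpha> - of_int p\<bar> < \<delta> q" by (simp add: \<delta>_def)
    \<comment> \<open>Since \<delta>(q) \<le> 1, only numerators from 0 to \<open>q\<close> can come
      close to q \<alpha>, so the finite union \<open>E\<close> covers all violations.\<close>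
    have "0 < real q * \<alpha>" "real q * \<alpha> \<le> real q" using \<alpha> q by (auto simp: mult_left_le)
    with * \<delta>1[of q] q have "-1 < real_of_int p" "real_of_int p < real q + 1" by linarith+
    then have "p \<in> {0..int q}" by auto
    moreover have "\<alpha> \<in> I q p" using \<alpha> * q by (auto simp: I_def field_simps abs_less_iff)
    ultimately have "\<alpha> \<in> E"
      using q unfolding E_def by (intro UN_I[of q] UN_I[of p]) auto
    with \<alpha> show False by simp
  qed
qed

section \<open>Reduction to the visits near the singularity\<close>

text \<open>Subtracting R^(-a) makes the truncation continuous at t = R. In the scaled variable t =
  N y it is the part of y^(-a) above the level (R/N)^(-a), divided by N^a.\<close>

definition trunc_pow :: "real \<Rightarrow> real \<Rightarrow> real \<Rightarrow> real" where
  "trunc_pow a R t = (if 0 < t \<and> t \<le> R then t powr (- a) - R powr (- a) else 0)"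

lemma has_integral_powr_Icc:
  fixes b u v :: real
  assumes "b \<noteq> 0" "0 < u" "u \<le> v"
  shows "((\<lambda>s. s powr (b - 1)) has_integral (v powr b / b - u powr b / b)) {u..v}"
proof (rule fundamental_theorem_of_calculus[OF assms(3)])
  fix s assume "s \<in> {u..v}"
  then show "((\<lambda>s. s powr b / b) has_vector_derivative s powr (b - 1)) (at s within {u..v})"
    using assms unfolding has_real_derivative_iff_has_vector_derivative[symmetric]
    by (auto intro!: derivative_eq_intros simp: powr_diff)
qed

lemma layer_cake_powr:
  fixes a \<rho> y :: real
  assumes a: "0 < a" and \<rho>: "0 < \<rho>" "\<rho> \<le> 1" and y: "0 < y" "y \<le> 1"
  shows "((\<lambda>s. a * s powr (- a - 1) * (if y \<le> s then 1 else 0)) has_integral (max y \<rho> powr (- a) - 1)) {\<rho>..1}"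
proof -
  have "((\<lambda>s. a * s powr (- a - 1)) has_integral a * (1 powr (- a) / (- a) - max y \<rho> powr (- a) / (- a))) {max y \<rho>..1}"
    using assms by (intro has_integral_mult_right has_integral_powr_Icc) auto
  also have "a * (1 powr (- a) / (- a) - max y \<rho> powr (- a) / (- a)) = max y \<rho> powr (- a) - 1"
    using a by (simp add: field_simps)
  finally have "((\<lambda>s. if s \<in> {max y \<rho>..1} then a * s powr (- a - 1) else 0) has_integral (max y \<rho> powr (- a) - 1)) {\<rho>..1}"
    by (subst has_integral_restrict) (use assms in auto)
  then show ?thesis
    by (rule has_integral_eq[rotated]) auto
qed

text \<open>Writing \<open>max y \<rho> powr - a\<close> as a superposition of the indicators of \<open>y \<le> s\<close> expresses the
  contribution of the points far from the singularity through the discrepancies alone.\<close>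

lemma birkhoff_sum_truncation:
  fixes a K R :: real
  assumes a: "0 < a" "a < 1" and R: "1 \<le> R" "R \<le> real N"
    and disc: "\<And>t. 1 \<le> t \<Longrightarrow> t \<le> real N \<Longrightarrow> \<bar>real (hits \<alpha> x (t / real N) N) - t\<bar> \<le> K * t powr (3 * a / 4)"
  shows "\<bar>birkhoff_sum a \<alpha> x N / real N powr a -
      ((\<Sum>n<N. trunc_pow a R (real N * orbit \<alpha> x n)) - a * R powr (1 - a) / (1 - a))\<bar>
    \<le> 4 * K * R powr (- a / 4)"
proof -
  have N: "0 < real N" using R by linarith
  define \<rho> where "\<rho> = R / real N"
  have \<rho>: "0 < \<rho>" "\<rho> \<le> 1" using R N by (auto simp: \<rho>_def)
  define y where "y n = orbit \<alpha> x n" for n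
  have y: "0 < y n" "y n \<le> 1" for n using circle_rep_pos circle_rep_le_1 by (auto simp: y_def)
  let ?h = "\<lambda>s. real (hits \<alpha> x s N)"
  have "((\<lambda>s. \<Sum>n<N. a * s powr (- a - 1) * (if y n \<le> s then 1 else 0)) has_integral
      (\<Sum>n<N. max (y n) \<rho> powr (- a) - 1)) {\<rho>..1}"
    by (intro has_integral_sum layer_cake_powr a \<rho> y) auto
  moreover have "(\<Sum>n<N. a * s powr (- a - 1) * (if y n \<le> s then 1 else 0)) = a * s powr (- a - 1) * ?h s" for s
  proof -
    have "(\<Sum>n<N. if y n \<le> s then 1 else 0 :: real) = real (card {n. n < N \<and> y n \<le> s})"
      by (simp add: sum.If_cases Int_def)
    then show ?thesis by (simp add: hits_def y_def flip: sum_distrib_left)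
  qed
  ultimately have 1: "((\<lambda>s. a * s powr (- a - 1) * ?h s) has_integral (\<Sum>n<N. max (y n) \<rho> powr (- a) - 1)) {\<rho>..1}"
    by simp
  have "((\<lambda>s. real N * a * s powr ((1 - a) - 1)) has_integral real N * a * (1 powr (1 - a) / (1 - a) - \<rho> powr (1 - a) / (1 - a))) {\<rho>..1}"
    using a \<rho> by (intro has_integral_mult_right has_integral_powr_Icc) auto
  then have 2: "((\<lambda>s. a * s powr (- a - 1) * (real N * s)) has_integral real N * a * (1 - \<rho> powr (1 - a)) / (1 - a)) {\<rho>..1}"
  proof (rule has_integral_eq_rhs[OF has_integral_eq[rotated]])
    fix s assume s: "s \<in> {\<rho>..1}"
    have "s = s powr 1" using s \<rho> by simp
    then have "s powr (- a - 1) * s = s powr (- a - 1) * s powr 1" by (rule arg_cong)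
    also have "\<dots> = s powr ((- a - 1) + 1)" by (rule powr_add[symmetric])
    finally show "real N * a * s powr ((1 - a) - 1) = a * s powr (- a - 1) * (real N * s)" by simp
  qed (simp add: diff_divide_distrib right_diff_distrib)
  \<comment> \<open>\<open>J\<close> is the integral of the discrepancy against a s^(-a-1) over the
    range from \<rho> = R/N to 1.\<close>
  define J where "J = (\<Sum>n<N. max (y n) \<rho> powr (- a) - 1) - real N * a * (1 - \<rho> powr (1 - a)) / (1 - a)"
  have 3: "((\<lambda>s. a * s powr (- a - 1) * ?h s - a * s powr (- a - 1) * (real N * s)) has_integral J) {\<rho>..1}"
    unfolding J_def by (rule has_integral_diff[OF 1 2])
  \<comment> \<open>The discrepancy bound K (N s)^(3a/4) turns the weight into s^(-a/4-1), whose
    integral is governed by the lower endpoint \<rho>; this produces the factor R^(-a/4).\<close>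
  have 4: "((\<lambda>s. a * K * real N powr (3 * a / 4) * s powr (- a / 4 - 1)) has_integral
      a * K * real N powr (3 * a / 4) * (1 powr (- a / 4) / (- a / 4) - \<rho> powr (- a / 4) / (- a / 4))) {\<rho>..1}"
    using a \<rho> by (intro has_integral_mult_right has_integral_powr_Icc) auto
  have "norm J \<le> a * K * real N powr (3 * a / 4) * (1 powr (- a / 4) / (- a / 4) - \<rho> powr (- a / 4) / (- a / 4))"
    unfolding integral_unique[OF 3, symmetric] integral_unique[OF 4, symmetric]
  proof (rule integral_norm_bound_integral)
    fix s assume s: "s \<in> {\<rho>..1}"
    have "\<bar>?h (real N * s / real N) - real N * s\<bar> \<le> K * (real N * s) powr (3 * a / 4)"
      using s R N by (intro disc) (auto simp: \<rho>_def field_simps)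
    then have d: "\<bar>?h s - real N * s\<bar> \<le> K * (real N * s) powr (3 * a / 4)" using N by simp
    have "norm (a * s powr (- a - 1) * ?h s - a * s powr (- a - 1) * (real N * s)) = a * s powr (- a - 1) * \<bar>?h s - real N * s\<bar>"
      using a by (simp add: abs_mult flip: right_diff_distrib)
    also have "\<dots> \<le> a * s powr (- a - 1) * (K * (real N * s) powr (3 * a / 4))"
      using a by (intro mult_left_mono d) auto
    also have "\<dots> = a * K * real N powr (3 * a / 4) * (s powr (- a - 1) * s powr (3 * a / 4))"
      using s \<rho> N by (simp add: powr_mult)
    also have "s powr (- a - 1) * s powr (3 * a / 4) = s powr (- a / 4 - 1)"
      by (simp flip: powr_add)
    finally show "norm (a * s powr (- a - 1) * ?h s - a * s powr (- a - 1) * (real N * s))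
       \<le> a * K * real N powr (3 * a / 4) * s powr (- a / 4 - 1)" .
  qed (use 3 4 in \<open>auto simp: has_integral_integrable\<close>)
  also have "\<dots> = 4 * K * real N powr (3 * a / 4) * (\<rho> powr (- a / 4) - 1)"
    using a by (simp add: field_simps)
  also have "\<dots> \<le> 4 * K * real N powr (3 * a / 4) * \<rho> powr (- a / 4)"
  proof -
    have "0 \<le> K" using order_trans[OF abs_ge_zero disc[of 1]] R by simp
    then show ?thesis by (intro mult_left_mono) auto
  qed
  also have "\<dots> = 4 * K * R powr (- a / 4) * real N powr a"
  proof -
    have "real N powr a = real N powr (3 * a / 4) * real N powr (a / 4)" by (simp flip: powr_add)
    then show ?thesis using R N by (simp add: \<rho>_def powr_divide powr_minus field_simps)
  qed
  finally have J: "\<bar>J\<bar> \<le> 4 * K * R powr (- a / 4) * real N powr a" by simp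
  have tr: "trunc_pow a R (real N * y n) = (y n powr (- a) - max (y n) \<rho> powr (- a)) / real N powr a" for n
  proof (cases "y n \<le> \<rho>")
    case True
    then have "real N * y n \<le> R" using N by (simp add: \<rho>_def field_simps)
    with True y[of n] N R show ?thesis
      by (simp add: trunc_pow_def max_def \<rho>_def powr_mult powr_divide powr_minus field_simps)
  next
    case False
    then have "\<not> real N * y n \<le> R" using N by (simp add: \<rho>_def field_simps)
    with False show ?thesis by (simp add: trunc_pow_def max_def)
  qed
  have ph: "phi a (x + real n * \<alpha>) = y n powr (- a) - 1 / (1 - a)" for n
    by (simp add: phi_def y_def powr_minus divide_inverse)
  have "birkhoff_sum a \<alpha> x N = (\<Sum>n<N. y n powr (- a)) - real N / (1 - a)"
    by (simp add: birkhoff_sum_def ph sum_subtractf)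
  also have "\<dots> = (\<Sum>n<N. y n powr (- a) - max (y n) \<rho> powr (- a)) + J - real N * a * \<rho> powr (1 - a) / (1 - a)"
  proof -
    \<comment> \<open>The subtracted mean N/(1-a) cancels the main term of the integral. Only the
      boundary term at \<rho> survives; divided by N^a it is the constant a R^(1-a) / (1-a).\<close>
    have e1: "real N / (1 - a) = real N + real N * a / (1 - a)"
      using a by (simp add: field_simps)
    have e2: "real N * a * (1 - \<rho> powr (1 - a)) / (1 - a) = real N * a / (1 - a) - real N * a * \<rho> powr (1 - a) / (1 - a)"
      by (simp add: right_diff_distrib diff_divide_distrib)
    show ?thesis unfolding J_def e1 e2 sum_subtractf by simp
  qed
  also have "(\<Sum>n<N. y n powr (- a) - max (y n) \<rho> powr (- a)) = (\<Sum>n<N. trunc_pow a R (real N * y n)) * real N powr a"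
    using N by (simp add: tr flip: sum_divide_distrib)
  also have "real N * a * \<rho> powr (1 - a) / (1 - a) = (a * R powr (1 - a) / (1 - a)) * real N powr a"
    using R N by (simp add: \<rho>_def powr_divide powr_diff field_simps)
  finally have "birkhoff_sum a \<alpha> x N / real N powr a = (\<Sum>n<N. trunc_pow a R (real N * y n)) + J / real N powr a - a * R powr (1 - a) / (1 - a)"
    using N by (simp add: field_simps)
  then have "birkhoff_sum a \<alpha> x N / real N powr a - ((\<Sum>n<N. trunc_pow a R (real N * y n)) - a * R powr (1 - a) / (1 - a)) = J / real N powr a"
    by simp
  moreover have "\<bar>J / real N powr a\<bar> \<le> 4 * K * R powr (- a / 4)"
    using J N by (simp add: abs_divide field_simps)
  ultimately show ?thesis by (simp add: y_def)
qed

section \<open>Riemann sums over coprime pairs\<close>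

text \<open>Makes it possible to fix a truncation parameter before \<open>N\<close> grows and never
  to name the limit: uniform approximation by convergent sequences gives the Cauchy property. The
  sieve, the Farey dissection and the comparison of characteristic functions all rest on it.\<close>

lemma convergent_approx:
  fixes c :: "nat \<Rightarrow> 'a::banach"
  assumes "\<And>\<epsilon>. 0 < \<epsilon> \<Longrightarrow> \<exists>u. convergent u \<and> (\<forall>\<^sub>F N in sequentially. norm (c N - u N) \<le> \<epsilon>)"
  shows "convergent c"
proof -
  have "Cauchy c"
  proof (rule metric_CauchyI)
    fix e :: real assume e: "0 < e"
    then obtain u where u: "convergent u" "\<forall>\<^sub>F N in sequentially. norm (c N - u N) \<le> e / 4"
      using assms[of "e / 4"] by auto
    obtain M where M: "\<And>N. M \<le> N \<Longrightarrow> norm (c N - u N) \<le> e / 4"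
      using u(2) unfolding eventually_sequentially by blast
    have "Cauchy u" using u(1) by (rule convergent_Cauchy)
    then obtain M' where M': "\<And>m n. M' \<le> m \<Longrightarrow> M' \<le> n \<Longrightarrow> dist (u m) (u n) < e / 4"
      using e unfolding Cauchy_def by (meson zero_less_divide_iff zero_less_numeral)
    show "\<exists>M. \<forall>m\<ge>M. \<forall>n\<ge>M. dist (c m) (c n) < e"
    proof (intro exI allI impI)
      fix m n assume mn: "max M M' \<le> m" "max M M' \<le> n"
      have "dist (c m) (c n) \<le> dist (c m) (u m) + dist (u m) (u n) + dist (u n) (c n)"
        using dist_triangle[of "c m" "c n" "u m"] dist_triangle[of "u m" "c n" "u n"] by linarith
      moreover have "dist (c m) (u m) \<le> e / 4" "dist (u n) (c n) \<le> e / 4"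
        using M[of m] M[of n] mn by (auto simp: dist_norm norm_minus_commute)
      moreover have "dist (u m) (u n) < e / 4" using M' mn by simp
      ultimately show "dist (c m) (c n) < e" using e by linarith
    qed
  qed
  then show ?thesis by (rule Cauchy_convergent)
qed

lemma measurable_haar1_borel: "f \<in> borel_measurable borel \<Longrightarrow> f \<in> borel_measurable haar1"
  by (auto simp: haar1_def intro!: measurable_restrict_space1)

lemma space_haar2 [simp]: "space haar2 = {0<..1} \<times> {0<..1}"
  by (simp add: haar2_def space_pair_measure)

lemma measurable_haar2_borel:
  assumes "f \<in> borel_measurable borel" shows "f \<in> borel_measurable haar2"
proof -
  have "(\<lambda>p. p) \<in> haar2 \<rightarrow>\<^sub>M borel"
    using measurable_Pair[of fst haar2 borel snd borel]
      measurable_compose[OF measurable_fst measurable_haar1_borel[of "\<lambda>x. x"], of haar1]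
      measurable_compose[OF measurable_snd measurable_haar1_borel[of "\<lambda>x. x"], of haar1]
    by (simp add: haar2_def borel_prod)
  then show ?thesis by (rule measurable_compose) fact
qed

lemma measure_haar1_Ioc:
  assumes "0 \<le> u" "u \<le> v" "v \<le> 1"
  shows "measure haar1 {u<..v} = v - u"
proof -
  have "measure haar1 {u<..v} = measure lborel {u<..v}"
    unfolding haar1_def using assms by (intro measure_restrict_space) auto
  then show ?thesis using assms by simp
qed

lemma measure_haar2_Times:
  assumes "A \<in> sets haar1" "B \<in> sets haar1"
  shows "measure haar2 (A \<times> B) = measure haar1 A * measure haar1 B"
proof -
  interpret prob_space haar1 by (rule prob_space_haar1)
  show ?thesis unfolding haar2_def measure_def
    by (simp only: emeasure_pair_measure_Times[OF assms] enn2real_mult)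
qed

text \<open>The double sum becomes the integral of a step function over a fixed space, so that
  Riemann sums can be treated by dominated convergence. Ceilings minus 1 index the cells (i/n,
  (i+1)/n], which tile (0,1].\<close>

lemma sum_eq_integral_ceiling:
  fixes g :: "nat \<Rightarrow> nat \<Rightarrow> complex"
  assumes n: "0 < n"
  shows "(\<Sum>i<n. \<Sum>j<n. g i j) / of_nat (n * n) =
    (\<integral>p. g (nat \<lceil>real n * fst p\<rceil> - 1) (nat \<lceil>real n * snd p\<rceil> - 1) \<partial>haar2)"
proof -
  interpret prob_space haar2 by (rule prob_space_haar2)
  define I where "I i = {real i / real n<..(real i + 1) / real n}" for i
  have I01: "I i \<subseteq> {0<..1}" if "i < n" for i
  proof -
    have "(real i + 1) / real n \<le> 1" using that n by simp
    moreover have "0 \<le> real i / real n" by simp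
    ultimately have "0 < x \<and> x \<le> 1" if "real i / real n < x \<and> x \<le> (real i + 1) / real n" for x
      using that by linarith
    then show ?thesis by (auto simp: I_def)
  qed
  have IS: "I i \<in> sets haar1" if "i < n" for i
  proof -
    have "{0<..1} \<inter> I i \<in> sets haar1" by (rule haar1_Int_in_sets) (simp add: I_def)
    then show ?thesis by (simp only: Int_absorb1[OF I01[OF that]])
  qed
  have Im: "measure haar1 (I i) = 1 / real n" if "i < n" for i
    unfolding I_def using that n by (subst measure_haar1_Ioc) (auto simp: divide_right_mono diff_divide_distrib[symmetric])
  have mem: "s \<in> I i \<longleftrightarrow> nat \<lceil>real n * s\<rceil> - 1 = i" if "0 < s" for s i
  proof -
    have "0 < \<lceil>real n * s\<rceil>" using that n by simp
    then have "nat \<lceil>real n * s\<rceil> - 1 = i \<longleftrightarrow> \<lceil>real n * s\<rceil> = int i + 1" by linarith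
    also have "\<dots> \<longleftrightarrow> real i < real n * s \<and> real n * s \<le> real i + 1" by linarith
    also have "\<dots> \<longleftrightarrow> s \<in> I i" using n by (simp add: I_def field_simps)
    finally show ?thesis ..
  qed
  have ran: "nat \<lceil>real n * s\<rceil> - 1 < n" if "0 < s" "s \<le> 1" for s
  proof -
    have "real n * s \<le> real n" using that by (simp add: mult_left_le)
    then have "\<lceil>real n * s\<rceil> \<le> int n" by (simp add: ceiling_le_iff)
    moreover have "0 < \<lceil>real n * s\<rceil>" using that n by simp
    ultimately show ?thesis by linarith
  qed
  have IT: "I i \<times> I j \<in> sets haar2" if "i < n" "j < n" for i j
    using IS that by (auto simp: haar2_def)
  have "(\<integral>p. g (nat \<lceil>real n * fst p\<rceil> - 1) (nat \<lceil>real n * snd p\<rceil> - 1) \<partial>haar2) =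
     (\<integral>p. (\<Sum>i<n. \<Sum>j<n. indicator (I i \<times> I j) p *\<^sub>R g i j) \<partial>haar2)"
  proof (rule Bochner_Integration.integral_cong[OF refl])
    fix p assume "p \<in> space haar2"
    then obtain s t where p: "p = (s, t)" "0 < s" "s \<le> 1" "0 < t" "t \<le> 1" by auto
    let ?i = "nat \<lceil>real n * s\<rceil> - 1" and ?j = "nat \<lceil>real n * t\<rceil> - 1"
    have "(\<Sum>i<n. \<Sum>j<n. indicator (I i \<times> I j) p *\<^sub>R g i j) = (\<Sum>i<n. \<Sum>j<n. if ?i = i then if ?j = j then g i j else 0 else 0)"
      using p mem by (intro sum.cong refl) (auto simp: indicator_def)
    also have "\<dots> = (\<Sum>i<n. if ?i = i then \<Sum>j<n. if ?j = j then g i j else 0 else 0)"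
      by (intro sum.cong refl) auto
    also have "\<dots> = g ?i ?j"
      using ran[OF p(2,3)] ran[OF p(4,5)] by (simp add: sum.delta)
    finally show "g (nat \<lceil>real n * fst p\<rceil> - 1) (nat \<lceil>real n * snd p\<rceil> - 1) = (\<Sum>i<n. \<Sum>j<n. indicator (I i \<times> I j) p *\<^sub>R g i j)"
      by (simp add: p)
  qed
  also have "\<dots> = (\<Sum>i<n. \<Sum>j<n. measure haar2 (I i \<times> I j) *\<^sub>R g i j)"
  proof -
    have int: "integrable haar2 (\<lambda>p. indicator (I i \<times> I j) p *\<^sub>R g i j)" if "i < n" "j < n" for i j
      using IT[OF that] by (intro integrable_scaleR_left) (simp add: emeasure_eq_measure)
    have "(\<integral>p. (\<Sum>i<n. \<Sum>j<n. indicator (I i \<times> I j) p *\<^sub>R g i j) \<partial>haar2) =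
       (\<Sum>i<n. \<integral>p. (\<Sum>j<n. indicator (I i \<times> I j) p *\<^sub>R g i j) \<partial>haar2)"
      using int by (intro Bochner_Integration.integral_sum Bochner_Integration.integrable_sum) auto
    also have "\<dots> = (\<Sum>i<n. \<Sum>j<n. \<integral>p. indicator (I i \<times> I j) p *\<^sub>R g i j \<partial>haar2)"
      using int by (intro sum.cong refl Bochner_Integration.integral_sum) auto
    also have "\<dots> = (\<Sum>i<n. \<Sum>j<n. measure haar2 (I i \<times> I j) *\<^sub>R g i j)"
      using IT by (intro sum.cong refl) (auto simp: emeasure_eq_measure sets.Int_space_eq2 simp del: space_haar2)
    finally show ?thesis .
  qed
  also have "\<dots> = (\<Sum>i<n. \<Sum>j<n. g i j / of_nat (n * n))"
    using IS Im by (intro sum.cong refl) (auto simp: measure_haar2_Times scaleR_conv_of_real)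
  also have "\<dots> = (\<Sum>i<n. \<Sum>j<n. g i j) / of_nat (n * n)"
    by (simp add: sum_divide_distrib)
  finally show ?thesis ..
qed

text \<open>The rescaled sample points of a residue class converge to the point of the square that
  selects their cell, so continuity almost everywhere and the uniform bound let dominated
  convergence act. The number of cells per side, divided by N, tends to 1/m.\<close>

lemma residue_Riemann_sum:
  fixes h :: "real \<times> real \<Rightarrow> complex"
  assumes bd: "\<And>p. norm (h p) \<le> M" and meas: "h \<in> borel_measurable borel"
    and cont: "AE p in haar2. isCont h p" and m: "0 < m"
  shows "convergent (\<lambda>N. (\<Sum>i<N div m + 1. \<Sum>j<N div m + 1.
      h (real (m * i + a) / real N, real (m * j + b) / real N)) / of_nat (N * N))"
proof -
  interpret prob_space haar2 by (rule prob_space_haar2)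
  define n where "n N = N div m + 1" for N
  let ?R = "\<lambda>a b N. \<Sum>i<n N. \<Sum>j<n N. h (real (m * i + a) / real N, real (m * j + b) / real N)"
  define \<sigma> where "\<sigma> a N s = real (m * (nat \<lceil>real (n N) * s\<rceil> - 1) + a) / real N" for a N and s :: real
  have nm: "(\<lambda>N. real (n N) / real N) \<longlonglongrightarrow> 1 / real m"
  proof (rule real_tendsto_sandwich)
    show "\<forall>\<^sub>F N in sequentially. 1 / real m \<le> real (n N) / real N"
    proof (rule eventually_mono[OF eventually_gt_at_top[of 0]])
      fix N :: nat assume N: "0 < N"
      have "N < m * n N" unfolding n_def using m by (metis Suc_eq_plus1 dividend_less_times_div mult_Suc_right add.commute)
      then have "real N \<le> real m * real (n N)" by (simp flip: of_nat_mult)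
      then show "1 / real m \<le> real (n N) / real N" using m N by (simp add: field_simps)
    qed
    show "\<forall>\<^sub>F N in sequentially. real (n N) / real N \<le> 1 / real m + 1 / real N"
    proof (rule eventually_mono[OF eventually_gt_at_top[of 0]])
      fix N :: nat assume N: "0 < N"
      have "real (N div m) \<le> real N / real m" by (rule of_nat_div_le_of_nat)
      then show "real (n N) / real N \<le> 1 / real m + 1 / real N" using m N by (simp add: n_def field_simps)
    qed
    show "(\<lambda>N. 1 / real m + 1 / real N) \<longlonglongrightarrow> 1 / real m"
      using tendsto_add[OF tendsto_const lim_1_over_n, of "1 / real m"] by simp
  qed simp
  have \<sigma>: "(\<lambda>N. \<sigma> a N s) \<longlonglongrightarrow> s" if s: "0 < s" for s a
  proof (rule real_tendsto_sandwich)
    have b: "real (n N) * s - 1 \<le> real (nat \<lceil>real (n N) * s\<rceil> - 1)" "real (nat \<lceil>real (n N) * s\<rceil> - 1) \<le> real (n N) * s" for N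
    proof -
      have "0 < real (n N) * s" using s by (simp add: n_def)
      then have "0 < \<lceil>real (n N) * s\<rceil>" by simp
      then have "real (nat \<lceil>real (n N) * s\<rceil> - 1) = of_int \<lceil>real (n N) * s\<rceil> - 1" by linarith
      then show "real (n N) * s - 1 \<le> real (nat \<lceil>real (n N) * s\<rceil> - 1)" "real (nat \<lceil>real (n N) * s\<rceil> - 1) \<le> real (n N) * s" by linarith+
    qed
    show "\<forall>\<^sub>F N in sequentially. real m * (real (n N) / real N * s) - real m * (1 / real N) \<le> \<sigma> a N s"
    proof (rule eventually_mono[OF eventually_gt_at_top[of 0]])
      fix N :: nat assume N: "0 < N"
      have "real m * (real (n N) * s - 1) \<le> real m * real (nat \<lceil>real (n N) * s\<rceil> - 1) + real a"
        using mult_left_mono[OF b(1), of "real m" N] by simp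
      from divide_right_mono[OF this, of "real N"] show "real m * (real (n N) / real N * s) - real m * (1 / real N) \<le> \<sigma> a N s"
        by (simp add: \<sigma>_def diff_divide_distrib right_diff_distrib)
    qed
    show "\<forall>\<^sub>F N in sequentially. \<sigma> a N s \<le> real m * (real (n N) / real N * s) + real a * (1 / real N)"
    proof (rule eventually_mono[OF eventually_gt_at_top[of 0]])
      fix N :: nat assume N: "0 < N"
      have "real m * real (nat \<lceil>real (n N) * s\<rceil> - 1) + real a \<le> real m * (real (n N) * s) + real a"
        using mult_left_mono[OF b(2), of "real m" N] by simp
      from divide_right_mono[OF this, of "real N"] show "\<sigma> a N s \<le> real m * (real (n N) / real N * s) + real a * (1 / real N)"
        by (simp add: \<sigma>_def add_divide_distrib)
    qed
    have "(\<lambda>N. real m * (real (n N) / real N * s) - real m * (1 / real N)) \<longlonglongrightarrow> real m * (1 / real m * s) - real m * 0"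
      by (intro tendsto_intros nm lim_1_over_n)
    then show "(\<lambda>N. real m * (real (n N) / real N * s) - real m * (1 / real N)) \<longlonglongrightarrow> s" using m by simp
    have "(\<lambda>N. real m * (real (n N) / real N * s) + real a * (1 / real N)) \<longlonglongrightarrow> real m * (1 / real m * s) + real a * 0"
      by (intro tendsto_intros nm lim_1_over_n)
    then show "(\<lambda>N. real m * (real (n N) / real N * s) + real a * (1 / real N)) \<longlonglongrightarrow> s" using m by simp
  qed
  have "(\<lambda>N. \<integral>p. h (\<sigma> a N (fst p), \<sigma> b N (snd p)) \<partial>haar2) \<longlonglongrightarrow> (\<integral>p. h p \<partial>haar2)"
  proof (rule integral_dominated_convergence[where w = "\<lambda>_. M"])
    show "h \<in> borel_measurable haar2" by (rule measurable_haar2_borel[OF meas])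
    have [measurable]: "h \<in> borel_measurable (borel \<Otimes>\<^sub>M borel)" using meas by (simp add: borel_prod)
    have "(\<lambda>p. h (\<sigma> a N (fst p), \<sigma> b N (snd p))) \<in> borel_measurable (borel \<Otimes>\<^sub>M borel)" for N
      unfolding \<sigma>_def by measurable
    then show "(\<lambda>p. h (\<sigma> a N (fst p), \<sigma> b N (snd p))) \<in> borel_measurable haar2" for N
      by (intro measurable_haar2_borel) (simp add: borel_prod)
    show "AE p in haar2. (\<lambda>N. h (\<sigma> a N (fst p), \<sigma> b N (snd p))) \<longlonglongrightarrow> h p"
      using cont
    proof (rule AE_mp, intro AE_I2 impI)
      fix p assume p: "p \<in> space haar2" "isCont h p"
      have "(\<lambda>N. (\<sigma> a N (fst p), \<sigma> b N (snd p))) \<longlonglongrightarrow> (fst p, snd p)"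
        using p by (intro tendsto_Pair \<sigma>) auto
      with p(2) show "(\<lambda>N. h (\<sigma> a N (fst p), \<sigma> b N (snd p))) \<longlonglongrightarrow> h p"
        using isCont_tendsto_compose[of "(fst p, snd p)" h] by simp
    qed
  qed (use bd in auto)
  then have "(\<lambda>N. of_real ((real (n N) / real N)\<^sup>2) * (\<integral>p. h (\<sigma> a N (fst p), \<sigma> b N (snd p)) \<partial>haar2))
     \<longlonglongrightarrow> of_real ((1 / real m)\<^sup>2) * (\<integral>p. h p \<partial>haar2)"
    by (intro tendsto_intros nm)
  moreover have "of_real ((real (n N) / real N)\<^sup>2) * (\<integral>p. h (\<sigma> a N (fst p), \<sigma> b N (snd p)) \<partial>haar2) =
    ?R a b N / of_nat (N * N)" for N
  proof -
    have "(\<integral>p. h (\<sigma> a N (fst p), \<sigma> b N (snd p)) \<partial>haar2) =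
      ?R a b N / of_nat (n N * n N)"
      unfolding \<sigma>_def
      by (rule sum_eq_integral_ceiling[of "n N" "\<lambda>i j. h (real (m * i + a) / real N, real (m * j + b) / real N)", symmetric])
         (simp add: n_def)
    moreover have "n N \<noteq> 0" by (simp add: n_def)
    ultimately show ?thesis by (simp add: power2_eq_square field_simps)
  qed
  ultimately have "(\<lambda>N. ?R a b N / of_nat (N * N))
      \<longlonglongrightarrow> of_real ((1 / real m)\<^sup>2) * (\<integral>p. h p \<partial>haar2)"
    by simp
  then show ?thesis unfolding n_def by (rule convergentI)
qed

text \<open>Progressions with \<open>N div m + 1\<close> terms overshoot \<open>N\<close>, which is
  harmless because \<open>f\<close> vanishes there.\<close>

lemma sum_residues:
  fixes f :: "nat \<Rightarrow> 'a::comm_monoid_add"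
  assumes m: "0 < m" and f: "\<And>q. N < q \<Longrightarrow> f q = 0"
  shows "(\<Sum>q=1..N. f q) = (\<Sum>a=1..m. \<Sum>i<N div m + 1. f (m * i + a))"
proof -
  have *: "(\<Sum>q=1..m * n. f q) = (\<Sum>i<n. \<Sum>a=1..m. f (m * i + a))" for n
  proof (induction n)
    case (Suc n)
    have "{1..m * Suc n} = {1..m * n} \<union> {m * n + 1..m * n + m}" by auto
    then have "(\<Sum>q=1..m * Suc n. f q) = (\<Sum>q=1..m * n. f q) + (\<Sum>q=m * n + 1..m * n + m. f q)"
      by (simp only:) (rule sum.union_disjoint, auto)
    also have "(\<Sum>q=m * n + 1..m * n + m. f q) = (\<Sum>a=1..m. f (m * n + a))"
      using sum.shift_bounds_cl_nat_ivl[of f 1 "m * n" m] by (simp add: add.commute)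
    finally show ?case using Suc by simp
  qed simp
  have "N < m * (N div m + 1)"
    using m by (metis Suc_eq_plus1 dividend_less_times_div mult_Suc_right add.commute)
  then have "(\<Sum>q=1..N. f q) = (\<Sum>q=1..m * (N div m + 1). f q)"
    using f by (intro sum.mono_neutral_left) auto
  also have "\<dots> = (\<Sum>a=1..m. \<Sum>i<N div m + 1. f (m * i + a))"
    unfolding * by (rule sum.swap)
  finally show ?thesis .
qed

abbreviation pair_sum :: "(nat \<Rightarrow> nat \<Rightarrow> bool) \<Rightarrow> (real \<times> real \<Rightarrow> complex) \<Rightarrow> nat \<Rightarrow> complex" where
  "pair_sum W h N \<equiv> \<Sum>q=1..N. \<Sum>q'=1..N. if W q q' then h (real q / real N, real q' / real N) else 0"

text \<open>A condition periodic modulo \<open>m\<close> merely selects residue classes, so the sum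
  is a finite combination of the Riemann sums above; the support of \<open>h\<close> removes the
  sample points beyond \<open>N\<close>.\<close>

lemma periodic_Riemann_sum:
  fixes h :: "real \<times> real \<Rightarrow> complex"
  assumes bd: "\<And>p. norm (h p) \<le> M" and meas: "h \<in> borel_measurable borel"
    and cont: "AE p in haar2. isCont h p" and m: "0 < m"
    and supp: "\<And>s t. 1 < s \<or> 1 < t \<Longrightarrow> h (s, t) = 0"
    and per: "\<And>i j a b. W (m * i + a) (m * j + b) = W a b"
  shows "convergent (\<lambda>N. pair_sum W h N / of_nat (N * N))"
proof -
  define n where "n N = N div m + 1" for N
  let ?R = "\<lambda>a b N. \<Sum>i<n N. \<Sum>j<n N. h (real (m * i + a) / real N, real (m * j + b) / real N)"
  have z: "1 < real q / real N" if "N < q" "0 < N" for q N using that by simp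
  have eq: "pair_sum W h N =
      (\<Sum>a=1..m. \<Sum>b=1..m. if W a b then
        ?R a b N else 0)"
    if N: "0 < N" for N
  proof -
    have "pair_sum W h N =
      (\<Sum>a=1..m. \<Sum>i<n N. \<Sum>q'=1..N. if W (m * i + a) q' then h (real (m * i + a) / real N, real q' / real N) else 0)"
      unfolding n_def by (rule sum_residues[OF m]) (intro sum.neutral ballI, use z N supp in auto)
    also have "\<dots> = (\<Sum>a=1..m. \<Sum>i<n N. \<Sum>b=1..m. \<Sum>j<n N. if W (m * i + a) (m * j + b)
        then h (real (m * i + a) / real N, real (m * j + b) / real N) else 0)"
      unfolding n_def by (intro sum.cong refl sum_residues[OF m]) (use z N supp in auto)
    also have "\<dots> = (\<Sum>a=1..m. \<Sum>b=1..m. \<Sum>i<n N. \<Sum>j<n N. if W a b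
        then h (real (m * i + a) / real N, real (m * j + b) / real N) else 0)"
      unfolding per by (intro sum.cong refl sum.swap)
    also have "\<dots> = (\<Sum>a=1..m. \<Sum>b=1..m. if W a b then
        ?R a b N else 0)"
      by (intro sum.cong refl) simp
    finally show ?thesis .
  qed
  define L where "L a b = lim (\<lambda>N. ?R a b N / of_nat (N * N))" for a b
  have L: "(\<lambda>N. ?R a b N / of_nat (N * N)) \<longlonglongrightarrow> L a b" for a b
    unfolding L_def convergent_LIMSEQ_iff[symmetric] n_def by (rule residue_Riemann_sum[OF bd meas cont m])
  have "(\<lambda>N. \<Sum>a=1..m. \<Sum>b=1..m. if W a b then ?R a b N / of_nat (N * N) else 0)
     \<longlonglongrightarrow> (\<Sum>a=1..m. \<Sum>b=1..m. if W a b then L a b else 0)"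
    by (intro tendsto_sum) (use L in auto)
  moreover have "\<forall>\<^sub>F N in sequentially. (\<Sum>a=1..m. \<Sum>b=1..m. if W a b then ?R a b N / of_nat (N * N) else 0) =
      pair_sum W h N / of_nat (N * N)"
    by (rule eventually_mono[OF eventually_gt_at_top[of 0]])
       (simp only: eq sum_divide_distrib if_distrib[of "\<lambda>x. x / _"] div_0 cong: if_cong)
  ultimately show ?thesis
    unfolding convergent_def by (blast intro: Lim_transform_eventually)
qed

lemma card_multiples_le: "0 < d \<Longrightarrow> real (card {q \<in> {1..N}. d dvd q}) \<le> real N / real d"
proof -
  assume d: "0 < d"
  have "{q \<in> {1..N}. d dvd q} \<subseteq> (\<lambda>k. d * k) ` {1..N div d}"
  proof
    fix q assume "q \<in> {q \<in> {1..N}. d dvd q}"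
    then obtain k where "q = d * k" "1 \<le> d * k" "d * k \<le> N" by auto
    moreover from this have "1 \<le> k" by (cases k) auto
    moreover have "k \<le> N div d" using d \<open>d * k \<le> N\<close> by (simp add: less_eq_div_iff_mult_less_eq mult.commute)
    ultimately show "q \<in> (\<lambda>k. d * k) ` {1..N div d}" by auto
  qed
  then have "card {q \<in> {1..N}. d dvd q} \<le> card ((\<lambda>k. d * k) ` {1..N div d})" by (intro card_mono) auto
  also have "\<dots> \<le> N div d" using card_image_le[of "{1..N div d}"] by simp
  finally have "real (card {q \<in> {1..N}. d dvd q}) \<le> real (N div d)" by simp
  also have "\<dots> \<le> real N / real d" by (rule of_nat_div_le_of_nat)
  finally show ?thesis .
qed

lemma sum_inverse_squares_tail:
  assumes P: "0 < P"
  shows "(\<Sum>d=P+1..N. 1 / (real d)\<^sup>2) \<le> 1 / real P"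
proof (cases "P \<le> N")
  case True
  then have "(\<Sum>d=P+1..N. 1 / (real d)\<^sup>2) \<le> 1 / real P - 1 / real N"
  proof (induction N rule: dec_induct)
    case (step n)
    have "1 / (real (Suc n))\<^sup>2 \<le> 1 / real n - 1 / real (Suc n)"
      using step P by (simp add: divide_simps power2_eq_square)
    with step show ?case by simp
  qed simp
  then show ?thesis by (smt (verit) divide_nonneg_nonneg of_nat_0_le_iff)
qed simp

text \<open>Sieving only by the divisors up to \<open>P\<close> leaves a condition periodic modulo \<open>P!\<close>; the error is
  of density at most \<open>1 / P\<close>.\<close>

lemma coprime_Riemann_sum:
  fixes h :: "real \<times> real \<Rightarrow> complex"
  assumes bd: "\<And>p. norm (h p) \<le> M" and meas: "h \<in> borel_measurable borel"
    and cont: "AE p in haar2. isCont h p"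
    and supp: "\<And>s t. 1 < s \<or> 1 < t \<Longrightarrow> h (s, t) = 0"
  shows "convergent (\<lambda>N. pair_sum coprime h N / of_nat (N * N))"
proof (rule convergent_approx)
  fix \<epsilon> :: real assume \<epsilon>: "0 < \<epsilon>"
  have M: "0 \<le> M" using order_trans[OF norm_ge_zero bd] .
  obtain P :: nat where P: "0 < P" "M / real P \<le> \<epsilon>"
  proof
    let ?P = "nat \<lceil>M / \<epsilon>\<rceil> + 1"
    show "0 < ?P" by simp
    have "M / \<epsilon> \<le> real ?P" by linarith
    then show "M / real ?P \<le> \<epsilon>" using \<epsilon> by (simp add: field_simps)
  qed
  define W where "W q q' \<longleftrightarrow> (\<forall>d\<in>{2..P}. \<not> (d dvd q \<and> d dvd q'))" for q q' :: nat
  define H where "H N q q' = h (real q / real N, real q' / real N)" for N q q' :: nat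
  let ?C = "\<lambda>N. \<Sum>q=1..N. \<Sum>q'=1..N. if coprime q q' then H N q q' else 0"
  let ?W = "\<lambda>N. \<Sum>q=1..N. \<Sum>q'=1..N. if W q q' then H N q q' else 0"
  have per: "W (fact P * i + a) (fact P * j + b) = W a b" for i j a b
  proof -
    have "d dvd fact P * i + a \<longleftrightarrow> d dvd a" if "d \<in> {2..P}" for d i a
    proof -
      have "d dvd fact P" using that by (intro dvd_fact) auto
      then have "d dvd fact P * i" by simp
      then show ?thesis by (rule dvd_add_right_iff)
    qed
    then show ?thesis unfolding W_def by blast
  qed
  have copW: "W q q'" if "coprime q q'" for q q'
    using that coprime_common_divisor_nat[OF that] unfolding W_def by fastforce
  \<comment> \<open>If the sieve passes a pair that is not coprime, its gcd exceeds \<open>P\<close>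
    and is one of the divisors counted on the right.\<close>
  have diff: "norm ((if coprime q q' then H N q q' else 0) - (if W q q' then H N q q' else 0))
     \<le> (\<Sum>d=P+1..N. if d dvd q \<and> d dvd q' then M else 0)" if q: "q \<in> {1..N}" "q' \<in> {1..N}" for q q' N
  proof (cases "W q q' \<and> \<not> coprime q q'")
    case True
    let ?g = "gcd q q'"
    have "?g \<noteq> 1" using True by (simp add: coprime_iff_gcd_eq_1)
    moreover have "?g \<noteq> 0" using q by auto
    ultimately have "2 \<le> ?g" by linarith
    moreover have "\<not> ?g \<in> {2..P}" using True unfolding W_def by (meson gcd_dvd1 gcd_dvd2)
    moreover have "?g \<le> N" using q by (meson atLeastAtMost_iff dvd_imp_le gcd_dvd1 le_trans less_le_trans zero_less_one)
    ultimately have g: "?g \<in> {P+1..N}" by auto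
    have "(if ?g dvd q \<and> ?g dvd q' then M else 0) \<le> (\<Sum>d=P+1..N. if d dvd q \<and> d dvd q' then M else 0)"
      using M by (intro member_le_sum[OF g]) auto
    with True bd show ?thesis by (auto simp: H_def intro: order_trans)
  next
    case False
    then have "norm ((if coprime q q' then H N q q' else 0) - (if W q q' then H N q q' else 0)) = 0"
      using copW by auto
    also have "0 \<le> (\<Sum>d=P+1..N. if d dvd q \<and> d dvd q' then M else 0)" using M by (intro sum_nonneg) auto
    finally show ?thesis .
  qed
  have "norm (?C N / of_nat (N * N)
      - ?W N / of_nat (N * N)) \<le> \<epsilon>" if N: "0 < N" for N
  proof -
    have "norm (?C N
      - ?W N) =
      norm (\<Sum>q=1..N. \<Sum>q'=1..N. (if coprime q q' then H N q q' else 0) - (if W q q' then H N q q' else 0))"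
      by (simp only: sum_subtractf)
    also have "\<dots> \<le> (\<Sum>q=1..N. \<Sum>q'=1..N. \<Sum>d=P+1..N. if d dvd q \<and> d dvd q' then M else 0)"
      by (intro sum_norm_le diff)
    also have "\<dots> = (\<Sum>q=1..N. \<Sum>d=P+1..N. \<Sum>q'=1..N. if d dvd q \<and> d dvd q' then M else 0)"
      by (intro sum.cong refl sum.swap)
    also have "\<dots> = (\<Sum>d=P+1..N. \<Sum>q=1..N. \<Sum>q'=1..N. if d dvd q \<and> d dvd q' then M else 0)"
      by (rule sum.swap)
    also have "\<dots> \<le> (\<Sum>d=P+1..N. M * (real N * real N) * (1 / (real d)\<^sup>2))"
    proof (rule sum_mono)
      fix d assume d: "d \<in> {P+1..N}"
      let ?A = "{q \<in> {1..N}. d dvd q}"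
      have "(\<Sum>q=1..N. \<Sum>q'=1..N. if d dvd q \<and> d dvd q' then M else 0) =
        (\<Sum>q=1..N. if d dvd q then \<Sum>q'=1..N. if d dvd q' then M else 0 else 0)"
        by (intro sum.cong refl) auto
      also have "\<dots> = real (card ?A) * (real (card ?A) * M)"
        by (simp add: sum.If_cases Int_def)
      also have "\<dots> \<le> (real N / real d) * ((real N / real d) * M)"
        using card_multiples_le[of d N] d M by (intro mult_mono) auto
      finally show "(\<Sum>q=1..N. \<Sum>q'=1..N. if d dvd q \<and> d dvd q' then M else 0) \<le> M * (real N * real N) * (1 / (real d)\<^sup>2)"
        by (simp add: power2_eq_square mult_ac)
    qed
    also have "\<dots> = M * (real N * real N) * (\<Sum>d=P+1..N. 1 / (real d)\<^sup>2)"
      by (simp only: sum_distrib_left)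
    also have "\<dots> \<le> M * (real N * real N) * (1 / real P)"
      using M by (intro mult_left_mono sum_inverse_squares_tail P) auto
    also have "\<dots> = M / real P * real (N * N)" by simp
    also have "\<dots> \<le> \<epsilon> * real (N * N)" using P by (intro mult_right_mono) auto
    finally show ?thesis using N
      by (simp add: norm_divide norm_mult pos_divide_le_eq flip: diff_divide_distrib)
  qed
  then have "\<forall>\<^sub>F N in sequentially. norm (?C N / of_nat (N * N)
      - ?W N / of_nat (N * N)) \<le> \<epsilon>"
    by (rule eventually_mono[OF eventually_gt_at_top[of 0]])
  moreover have "convergent (\<lambda>N. ?W N / of_nat (N * N))"
    unfolding H_def by (rule periodic_Riemann_sum[where m = "fact P" and W = W, OF bd meas cont _ supp per]) auto
  ultimately show "\<exists>u. convergent u \<and> (\<forall>\<^sub>F N in sequentially. norm (pair_sum coprime h N / of_nat (N * N) - u N) \<le> \<epsilon>)"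
    unfolding H_def by blast
qed

section \<open>Farey arcs\<close>

text \<open>Denominators of neighbouring fractions in the Farey sequence of level \<open>N\<close>,
  the left one first: N < q + q' says that their mediant has not yet appeared.\<close>

definition farey_pairs :: "nat \<Rightarrow> (nat \<times> nat) set" where
  "farey_pairs N = {(q, q'). 0 < q \<and> q \<le> N \<and> 0 < q' \<and> q' \<le> N \<and> N < q + q' \<and> coprime q q'}"

text \<open>Numerator of the left endpoint. The determinant condition p' q - p q' = 1 amounts to p
  q' = -1 modulo q, which for coprime q, q' has one solution from 0 to q - 1.\<close>

definition farey_num :: "nat \<Rightarrow> nat \<Rightarrow> int" where
  "farey_num q q' = (THE p. 0 \<le> p \<and> p < int q \<and> int q dvd 1 + p * int q')"

text \<open>The right end is the neighbour p'/q', written as p/q + 1/(q q') so that p' need not be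
  chosen. The arcs are open on the left, in agreement with the domain (0,1].\<close>

definition farey_arc :: "nat \<Rightarrow> nat \<Rightarrow> real set" where
  "farey_arc q q' = {of_int (farey_num q q') / real q <.. of_int (farey_num q q') / real q + 1 / (real q * real q')}"

lemma finite_farey_pairs [simp]: "finite (farey_pairs N)"
  by (rule finite_subset[of _ "{..N} \<times> {..N}"]) (auto simp: farey_pairs_def)

lemma farey_num_eqI:
  assumes "coprime q q'" "0 \<le> p" "p < int q" "int q dvd 1 + p * int q'"
  shows "farey_num q q' = p"
  unfolding farey_num_def
proof (rule the_equality)
  show "0 \<le> p \<and> p < int q \<and> int q dvd 1 + p * int q'" using assms by simp
  fix r assume r: "0 \<le> r \<and> r < int q \<and> int q dvd 1 + r * int q'"
  have "int q dvd (1 + r * int q') - (1 + p * int q')"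
    using r assms(4) by (intro dvd_diff) auto
  then have "int q dvd (r - p) * int q'" by (simp add: algebra_simps)
  then have "int q dvd r - p" using assms(1) by (simp add: coprime_dvd_mult_left_iff)
  moreover have "\<bar>r - p\<bar> < int q" using r assms by auto
  ultimately have "r - p = 0" by (metis dvd_imp_le_int linorder_not_le abs_of_nat)
  then show "r = p" by simp
qed

lemma farey_num:
  assumes "coprime q q'" "0 < q" "0 < q'"
  obtains p' where "p' * int q - farey_num q q' * int q' = 1" "0 \<le> farey_num q q'" "p' \<le> int q'"
proof -
  obtain u v where uv: "u * int q + v * int q' = 1"
    using assms(1) bezout_int[of "int q" "int q'"] by auto
  define p where "p = (- v) mod int q"
  have p: "0 \<le> p" "p < int q" using assms by (auto simp: p_def)
  have "(1 + p * int q') mod int q = (1 + (- v) * int q') mod int q"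
    unfolding p_def by (metis mod_add_right_eq mod_mult_left_eq)
  also have "1 + (- v) * int q' = u * int q" using uv by (simp add: algebra_simps)
  finally have d: "int q dvd 1 + p * int q'" by (simp add: mod_eq_0_iff_dvd)
  then obtain p' where p': "1 + p * int q' = int q * p'" by auto
  have "farey_num q q' = p" by (rule farey_num_eqI[OF assms(1) p d])
  moreover have "p' \<le> int q'"
  proof -
    have "int q * p' \<le> 1 + (int q - 1) * int q'" using p unfolding p'[symmetric] by (simp add: mult_right_mono)
    also have "\<dots> \<le> int q * int q'" using assms by (simp add: algebra_simps)
    finally show ?thesis using assms by simp
  qed
  ultimately show ?thesis using that[of p'] p p' by (simp add: mult.commute)
qed

lemma farey_arc_eq:
  assumes "p' * int q - farey_num q q' * int q' = 1" "0 < q" "0 < q'"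
  shows "farey_arc q q' = {of_int (farey_num q q') / real q <.. of_int p' / real q'}"
proof -
  have "of_int p' * real q - of_int (farey_num q q') * real q' = 1"
    using arg_cong[OF assms(1), of real_of_int] by simp
  then have "1 / (real q * real q') = (of_int p' * real q - of_int (farey_num q q') * real q') / (real q * real q')"
    by simp
  then have "of_int (farey_num q q') / real q + 1 / (real q * real q') = of_int p' / real q'"
    using assms(2,3) by (simp add: diff_divide_distrib)
  then show ?thesis by (simp add: farey_arc_def)
qed

text \<open>The numbers p' n - m q' and m q - p n are positive integers, and q times the first plus
  q' times the second is n because the determinant is 1.\<close>

lemma denominator_between:
  fixes p p' m :: int and q q' n :: nat
  assumes "p' * int q - p * int q' = 1" "0 < q" "0 < q'" "0 < n"
    and "of_int p / real q < of_int m / real n" "of_int m / real n < of_int p' / real q'"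
  shows "q + q' \<le> n"
proof -
  have "real_of_int (p * int n) < of_int (m * int q)" "real_of_int (m * int q') < of_int (p' * int n)"
    using assms by (simp_all add: field_simps)
  then have "p * int n < m * int q" "m * int q' < p' * int n"
    by (simp_all only: of_int_less_iff)
  then have "int q * 1 + int q' * 1 \<le> int q * (p' * int n - m * int q') + int q' * (m * int q - p * int n)"
    by (intro add_mono mult_left_mono) auto
  also have "\<dots> = int n * (p' * int q - p * int q')" by (simp add: algebra_simps)
  finally show ?thesis using assms by simp
qed

lemma coprime_if_det_1:
  fixes a b c d :: int
  assumes "a * d - b * c = 1"
  shows "coprime b d" "coprime a c"
proof -
  show "coprime b d"
  proof (rule coprimeI)
    fix e assume "e dvd b" "e dvd d"
    then have "e dvd a * d - b * c" by (intro dvd_diff) auto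
    then show "is_unit e" using assms by simp
  qed
  show "coprime a c"
  proof (rule coprimeI)
    fix e assume "e dvd a" "e dvd c"
    then have "e dvd a * d - b * c" by (intro dvd_diff) auto
    then show "is_unit e" using assms by simp
  qed
qed

text \<open>If corresponding endpoints differed, one of them would lie strictly between the
  endpoints of the other arc with a denominator at most \<open>N\<close>, hence below the sum of the
  two denominators there. Equal fractions in lowest terms have equal denominators.\<close>

lemma farey_arc_unique:
  assumes "(q, q') \<in> farey_pairs N" "(r, r') \<in> farey_pairs N" "\<alpha> \<in> farey_arc q q'" "\<alpha> \<in> farey_arc r r'"
  shows "(q, q') = (r, r')"
proof -
  have q: "0 < q" "q \<le> N" "0 < q'" "q' \<le> N" "N < q + q'" "coprime q q'" using assms by (auto simp: farey_pairs_def)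
  have r: "0 < r" "r \<le> N" "0 < r'" "r' \<le> N" "N < r + r'" "coprime r r'" using assms by (auto simp: farey_pairs_def)
  obtain p' where p': "p' * int q - farey_num q q' * int q' = 1" using farey_num[OF q(6,1,3)] by metis
  obtain s' where s': "s' * int r - farey_num r r' * int r' = 1" using farey_num[OF r(6,1,3)] by metis
  define p s where "p = farey_num q q'" and "s = farey_num r r'"
  note p' = p'[folded p_def] and s' = s'[folded s_def]
  have a1: "of_int p / real q < \<alpha>" "\<alpha> \<le> of_int p' / real q'"
    using assms(3) farey_arc_eq[OF p'[unfolded p_def] q(1,3)] by (auto simp: p_def)
  have a2: "of_int s / real r < \<alpha>" "\<alpha> \<le> of_int s' / real r'"
    using assms(4) farey_arc_eq[OF s'[unfolded s_def] r(1,3)] by (auto simp: s_def)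
  have "\<not> of_int p / real q < of_int s / real r"
    using denominator_between[OF p' q(1,3) r(1), of s] a1 a2 q r by linarith
  moreover have "\<not> of_int s / real r < of_int p / real q"
    using denominator_between[OF s' r(1,3) q(1), of p] a1 a2 q r by linarith
  ultimately have "of_int p / real q = of_int s / real r" by linarith
  then have "real_of_int (p * int r) = of_int (s * int q)" using q r by (simp add: field_simps)
  then have e1: "p * int r = s * int q" by (simp only: of_int_eq_iff)
  have "\<not> of_int p' / real q' < of_int s' / real r'"
    using denominator_between[OF s' r(1,3) q(3), of p'] a1 a2 q r by linarith
  moreover have "\<not> of_int s' / real r' < of_int p' / real q'"
    using denominator_between[OF p' q(1,3) r(3), of s'] a1 a2 q r by linarith
  ultimately have "of_int p' / real q' = of_int s' / real r'" by linarith
  then have "real_of_int (p' * int r') = of_int (s' * int q')" using q r by (simp add: field_simps)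
  then have e2: "p' * int r' = s' * int q'" by (simp only: of_int_eq_iff)
  note c = coprime_if_det_1[OF p'] and d = coprime_if_det_1[OF s']
  have "int q dvd p * int r" "int r dvd s * int q" "int q' dvd p' * int r'" "int r' dvd s' * int q'"
    using e1 e2 by (metis dvd_triv_right)+
  then have "int q dvd int r" "int r dvd int q" "int q' dvd int r'" "int r' dvd int q'"
    using c d by (metis coprime_commute coprime_dvd_mult_right_iff)+
  then show ?thesis by (simp add: dvd_antisym)
qed

lemma farey_arc_subset:
  assumes "(q, q') \<in> farey_pairs N"
  shows "farey_arc q q' \<subseteq> {0<..1}"
proof -
  have q: "0 < q" "0 < q'" "coprime q q'" using assms by (auto simp: farey_pairs_def)
  obtain p' where p': "p' * int q - farey_num q q' * int q' = 1" "0 \<le> farey_num q q'" "p' \<le> int q'"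
    using farey_num[OF q(3,1,2)] by metis
  have "0 \<le> of_int (farey_num q q') / real q" using p' by simp
  moreover have "of_int p' / real q' \<le> 1" using p'(3) q by (simp add: divide_le_eq)
  ultimately show ?thesis unfolding farey_arc_eq[OF p'(1) q(1,2)] by auto
qed

text \<open>Induction on the level: the passage to N + 1 splits exactly the arcs with q + q' = N +
  1, at the mediant, and \<open>\<alpha>\<close> lies in one of the halves. The bounds on p and p'
  serve to recognise p as \<open>farey_num q q'\<close>.\<close>

lemma farey_arc_exists:
  assumes \<alpha>: "0 < \<alpha>" "\<alpha> \<le> 1" and N: "1 \<le> N"
  obtains q q' where "(q, q') \<in> farey_pairs N" "\<alpha> \<in> farey_arc q q'"
proof -
  have "\<exists>p q p' q'. p' * int q - p * int q' = 1 \<and> 0 < q \<and> q \<le> N \<and> 0 < q' \<and> q' \<le> N \<and> N < q + q' \<and>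
     0 \<le> p \<and> p' \<le> int q' \<and> of_int p / real q < \<alpha> \<and> \<alpha> \<le> of_int p' / real q'"
    using N
  proof (induction N rule: dec_induct)
    case base
    show ?case using \<alpha> by (intro exI[of _ 0] exI[of _ 1]) auto
  next
    case (step N)
    then obtain p q p' q' where h: "p' * int q - p * int q' = 1" "0 < q" "q \<le> N" "0 < q'" "q' \<le> N" "N < q + q'"
     "0 \<le> p" "p' \<le> int q'" "of_int p / real q < \<alpha>" "\<alpha> \<le> of_int p' / real q'" by blast
    show ?case
    proof (cases "Suc N < q + q'")
      case True
      then show ?thesis using h by (intro exI[of _ p] exI[of _ q] exI[of _ p'] exI[of _ q']) auto
    next
      case False
      then have e: "q + q' = Suc N" using h by simp
      have pq: "p \<le> int q"
      proof -
        have "p * int q' \<le> int q' * int q" using h mult_right_mono[OF h(8), of "int q"] by linarith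
        then show ?thesis using h by (simp add: mult.commute)
      qed
      show ?thesis
      proof (cases "\<alpha> \<le> of_int (p + p') / real (q + q')")
        case True
        have "(p + p') * int q - p * int (q + q') = 1" using h(1) by (simp add: algebra_simps)
        then show ?thesis using h e True pq
          by (intro exI[of _ p] exI[of _ q] exI[of _ "p + p'"] exI[of _ "q + q'"]) auto
      next
        case False
        have "p' * int (q + q') - (p + p') * int q' = 1" using h(1) by (simp add: algebra_simps)
        moreover have "0 \<le> p'"
        proof -
          have "p' * int q \<ge> 0" using h(1,7) by (smt (verit) of_nat_0_le_iff mult_nonneg_nonneg)
          then show ?thesis using h(2) by (simp add: zero_le_mult_iff)
        qed
        ultimately show ?thesis using h e False
          by (intro exI[of _ "p + p'"] exI[of _ "q + q'"] exI[of _ p'] exI[of _ q']) auto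
      qed
    qed
  qed
  then obtain p q p' q' where h: "p' * int q - p * int q' = 1" "0 < q" "q \<le> N" "0 < q'" "q' \<le> N" "N < q + q'"
     "0 \<le> p" "p' \<le> int q'" "of_int p / real q < \<alpha>" "\<alpha> \<le> of_int p' / real q'" by blast
  have c: "coprime q q'"
  proof (rule coprimeI)
    fix d assume "d dvd q" "d dvd q'"
    then have "int d dvd p' * int q - p * int q'" by (intro dvd_diff dvd_mult) auto
    then show "is_unit d" using h(1) by simp
  qed
  have "p < int q"
  proof -
    have "p * int q' < int q' * int q" using h(1) mult_right_mono[OF h(8), of "int q"] by linarith
    then show ?thesis using h by (simp add: mult.commute)
  qed
  moreover have "1 + p * int q' = int q * p'" using h(1) by (simp add: algebra_simps)
  then have "int q dvd 1 + p * int q'" by simp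
  ultimately have p: "farey_num q q' = p" using c h by (intro farey_num_eqI) auto
  show ?thesis
  proof (rule that)
    show "(q, q') \<in> farey_pairs N" using c h by (auto simp: farey_pairs_def)
    show "\<alpha> \<in> farey_arc q q'" using farey_arc_eq[of p' q q'] h p by auto
  qed
qed

section \<open>Integration over the Farey dissection\<close>

lemma integral_haar1: "(\<integral>x. f x \<partial>haar1) = (\<integral>x. indicator {0<..1} x *\<^sub>R f x \<partial>lborel)"
  for f :: "real \<Rightarrow> 'a::{banach, second_countable_topology}"
  unfolding haar1_def by (rule integral_restrict_space) auto

lemma integrable_haar1: "integrable haar1 f \<longleftrightarrow> integrable lborel (\<lambda>x. indicator {0<..1} x *\<^sub>R f x)"
  for f :: "real \<Rightarrow> 'a::{banach, second_countable_topology}"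
  unfolding haar1_def by (rule integrable_restrict_space) auto

abbreviation farey_point :: "nat \<Rightarrow> nat \<Rightarrow> real \<Rightarrow> real" where
  "farey_point q q' r \<equiv> of_int (farey_num q q') / real q + r / (real q * real q')"

text \<open>The arcs partition (0,1], and r in (0,1] is the relative position in an arc; the
  Jacobian is the arc length 1/(q q').\<close>

lemma farey_integral:
  fixes G :: "real \<Rightarrow> complex"
  assumes G: "integrable haar1 G" and N: "1 \<le> N"
  shows "(\<integral>\<alpha>. G \<alpha> \<partial>haar1) = (\<Sum>(q, q')\<in>farey_pairs N.
    (\<integral>r. G (farey_point q q' r) \<partial>haar1) / of_nat (q * q'))"
proof -
  let ?A = "\<lambda>x. farey_arc (fst x) (snd x)"
  have ind: "indicator {0<..1} \<alpha> *\<^sub>R G \<alpha> = (\<Sum>x\<in>farey_pairs N. indicator (?A x) \<alpha> *\<^sub>R G \<alpha>)" for \<alpha>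
  proof (cases "\<alpha> \<in> {0<..1}")
    case True
    then have "0 < \<alpha>" "\<alpha> \<le> 1" by auto
    then obtain q q' where q: "(q, q') \<in> farey_pairs N" "\<alpha> \<in> farey_arc q q'"
      by (rule farey_arc_exists[OF _ _ N])
    have "(\<Sum>x\<in>farey_pairs N. indicator (?A x) \<alpha> *\<^sub>R G \<alpha>) = (\<Sum>x\<in>farey_pairs N. if x = (q, q') then G \<alpha> else 0)"
    proof (rule sum.cong[OF refl])
      fix x assume x: "x \<in> farey_pairs N"
      show "indicator (?A x) \<alpha> *\<^sub>R G \<alpha> = (if x = (q, q') then G \<alpha> else 0)"
      proof (cases "\<alpha> \<in> ?A x")
        case True
        then have "(fst x, snd x) = (q, q')"
          using x q by (intro farey_arc_unique[of "fst x" "snd x" N q q' \<alpha>]) auto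
        then show ?thesis using True by (simp add: prod_eq_iff)
      next
        case False
        then show ?thesis using q by auto
      qed
    qed
    also have "\<dots> = G \<alpha>" using q by simp
    finally show ?thesis using True by simp
  next
    case False
    then have "\<alpha> \<notin> ?A x" if "x \<in> farey_pairs N" for x
      using farey_arc_subset[of "fst x" "snd x" N] that by auto
    with False show ?thesis by (simp add: sum.neutral)
  qed
  have int: "integrable lborel (\<lambda>\<alpha>. indicator (?A x) \<alpha> *\<^sub>R G \<alpha>)" if "x \<in> farey_pairs N" for x
  proof -
    have "integrable lborel (\<lambda>\<alpha>. indicator (?A x) \<alpha> *\<^sub>R (indicator {0<..1} \<alpha> *\<^sub>R G \<alpha>))"
      by (rule integrable_mult_indicator) (use G in \<open>auto simp: integrable_haar1 farey_arc_def\<close>)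
    then show ?thesis
      by (rule Bochner_Integration.integrable_cong[OF refl, THEN iffD1, rotated])
         (use farey_arc_subset[of "fst x" "snd x" N] that in \<open>auto simp: indicator_def\<close>)
  qed
  have "(\<integral>\<alpha>. G \<alpha> \<partial>haar1) = (\<integral>\<alpha>. (\<Sum>x\<in>farey_pairs N. indicator (?A x) \<alpha> *\<^sub>R G \<alpha>) \<partial>lborel)"
    unfolding integral_haar1 ind ..
  also have "\<dots> = (\<Sum>x\<in>farey_pairs N. \<integral>\<alpha>. indicator (?A x) \<alpha> *\<^sub>R G \<alpha> \<partial>lborel)"
    by (intro Bochner_Integration.integral_sum int)
  also have "\<dots> = (\<Sum>(q, q')\<in>farey_pairs N.
    (\<integral>r. G (farey_point q q' r) \<partial>haar1) / of_nat (q * q'))"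
  proof (rule sum.cong[OF refl], clarify)
    fix q q' assume "(q, q') \<in> farey_pairs N"
    then have q: "0 < q" "0 < q'" by (auto simp: farey_pairs_def)
    let ?c = "1 / (real q * real q')" and ?t = "of_int (farey_num q q') / real q"
    have c: "0 < ?c" using q by simp
    have "(\<integral>\<alpha>. indicator (farey_arc q q') \<alpha> *\<^sub>R G \<alpha> \<partial>lborel) =
      \<bar>?c\<bar> *\<^sub>R (\<integral>r. indicator (farey_arc q q') (?t + ?c * r) *\<^sub>R G (?t + ?c * r) \<partial>lborel)"
      by (rule lborel_integral_real_affine) (use q in simp)
    also have "(\<lambda>r. indicator (farey_arc q q') (?t + ?c * r) *\<^sub>R G (?t + ?c * r)) =
        (\<lambda>r. indicator {0<..1} r *\<^sub>R G (?t + r / (real q * real q')))"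
      using q by (auto simp: farey_arc_def indicator_def fun_eq_iff field_simps)
    also have "\<bar>?c\<bar> *\<^sub>R (\<integral>r. indicator {0<..1} r *\<^sub>R G (?t + r / (real q * real q')) \<partial>lborel) =
        (\<integral>r. G (?t + r / (real q * real q')) \<partial>haar1) / of_nat (q * q')"
      using q by (simp add: integral_haar1 scaleR_conv_of_real)
    finally show "(\<integral>\<alpha>. indicator (farey_arc (fst (q, q')) (snd (q, q'))) \<alpha> *\<^sub>R G \<alpha> \<partial>lborel) =
        (\<integral>r. G (?t + r / (real q * real q')) \<partial>haar1) / of_nat (q * q')" by simp
  qed
  finally show ?thesis .
qed

text \<open>\<open>farey_integral\<close> for the constant 1; the summands are the arc
  lengths.\<close>

lemma sum_farey_pairs:
  assumes "1 \<le> N"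
  shows "(\<Sum>(q, q')\<in>farey_pairs N. 1 / real (q * q')) = 1"
proof -
  interpret prob_space haar1 by (rule prob_space_haar1)
  have "(1::complex) = (\<Sum>(q, q')\<in>farey_pairs N. 1 / of_nat (q * q'))"
    using farey_integral[of "\<lambda>_. 1" N] assms prob_space by (simp del: of_nat_mult space_haar1)
  also have "\<dots> = of_real (\<Sum>(q, q')\<in>farey_pairs N. 1 / real (q * q'))"
    by (simp add: case_prod_unfold)
  finally show ?thesis by (metis of_real_1 of_real_eq_iff)
qed

text \<open>For a given q \<le> \<delta> N the partner q' is one of the q integers in (N - q, N],
  all at least N/2, so this q contributes at most 2/N. It serves to discard the arcs on which the
  Farey basis degenerates.\<close>

lemma farey_pairs_small:
  fixes \<delta> :: real
  assumes \<delta>: "0 < \<delta>" "\<delta> \<le> 1 / 2" and N: "1 \<le> N"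
  shows "(\<Sum>(q, q')\<in>{x \<in> farey_pairs N. real (fst x) \<le> \<delta> * real N}. 1 / real (q * q')) \<le> 2 * \<delta>"
proof -
  have fin: "finite {q. 0 < q \<and> real q \<le> \<delta> * real N}"
    by (rule finite_subset[of _ "{..nat \<lfloor>\<delta> * real N\<rfloor>}"]) (auto simp: le_nat_floor)
  have "(\<Sum>(q, q')\<in>{x \<in> farey_pairs N. real (fst x) \<le> \<delta> * real N}. 1 / real (q * q')) \<le>
    (\<Sum>(q, q')\<in>(SIGMA q:{q. 0 < q \<and> real q \<le> \<delta> * real N}. {N - q<..N}). 1 / real (q * q'))"
    using fin by (intro sum_mono2) (auto simp: farey_pairs_def)
  also have "\<dots> = (\<Sum>q\<in>{q. 0 < q \<and> real q \<le> \<delta> * real N}. \<Sum>q'\<in>{N - q<..N}. 1 / real (q * q'))"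
    using fin by (subst sum.Sigma) auto
  also have "\<dots> \<le> (\<Sum>q\<in>{q. 0 < q \<and> real q \<le> \<delta> * real N}. 2 / real N)"
  proof (rule sum_mono)
    fix q assume "q \<in> {q. 0 < q \<and> real q \<le> \<delta> * real N}"
    then have q: "0 < q" "real q \<le> \<delta> * real N" by auto
    have h: "real q \<le> real N / 2" using q mult_right_mono[OF \<delta>(2), of "real N"] by simp
    then have qN: "q \<le> N" by simp
    have "(\<Sum>q'\<in>{N - q<..N}. 1 / real (q * q')) \<le> (\<Sum>q'\<in>{N - q<..N}. 1 / (real q * (real N / 2)))"
    proof (rule sum_mono)
      fix q' assume "q' \<in> {N - q<..N}"
      then have "real N / 2 \<le> real q'" using h by auto
      then show "1 / real (q * q') \<le> 1 / (real q * (real N / 2))"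
        using q N by (simp add: frac_le mult_left_mono del: times_divide_eq_right)
    qed
    also have "\<dots> = 2 / real N" using q N qN by simp
    finally show "(\<Sum>q'\<in>{N - q<..N}. 1 / real (q * q')) \<le> 2 / real N" .
  qed
  also have "\<dots> = real (card {q. 0 < q \<and> real q \<le> \<delta> * real N}) * (2 / real N)" by simp
  also have "\<dots> \<le> (\<delta> * real N) * (2 / real N)"
  proof (rule mult_right_mono)
    have "{q. 0 < q \<and> real q \<le> \<delta> * real N} \<subseteq> {0<..nat \<lfloor>\<delta> * real N\<rfloor>}" by (auto simp: le_nat_floor)
    then have "card {q. 0 < q \<and> real q \<le> \<delta> * real N} \<le> card {0<..nat \<lfloor>\<delta> * real N\<rfloor>}" by (intro card_mono) auto
    also have "real (card {0<..nat \<lfloor>\<delta> * real N\<rfloor>}) \<le> \<delta> * real N" using \<delta> by simp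
    finally show "real (card {q. 0 < q \<and> real q \<le> \<delta> * real N}) \<le> \<delta> * real N" by simp
  qed simp
  finally show ?thesis using N by simp
qed

lemma farey_pairs_swap: "(q, q') \<in> farey_pairs N \<longleftrightarrow> (q', q) \<in> farey_pairs N"
  by (auto simp: farey_pairs_def coprime_commute)

section \<open>Grid sums\<close>

abbreviation grid_point :: "real \<Rightarrow> real \<Rightarrow> real \<Rightarrow> real \<Rightarrow> real \<Rightarrow> real \<Rightarrow> int \<Rightarrow> int \<Rightarrow> real \<times> real" where
  "grid_point u1 v1 u2 v2 y1 y2 j k \<equiv>
    ((of_int j + y1) * u1 + (of_int k + y2) * u2, (of_int j + y1) * v1 + (of_int k + y2) * v2)"

text \<open>Sum over an affine lattice: (y1, y2) is the offset in the coordinates of the basis (u1,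
  v1), (u2, v2). With an unordered infinite sum, a bijective change of index requires no
  convergence.\<close>

definition grid_sum :: "(real \<times> real \<Rightarrow> real) \<Rightarrow> real \<Rightarrow> real \<Rightarrow> real \<Rightarrow> real \<Rightarrow> real \<Rightarrow> real \<Rightarrow> real" where
  "grid_sum F u1 v1 u2 v2 y1 y2 = (\<Sum>\<^sub>\<infinity>(j, k)\<in>(UNIV :: (int \<times> int) set).
     F (grid_point u1 v1 u2 v2 y1 y2 j k))"

text \<open>An integer matrix of determinant 1 permutes the index set; the same matrix acts on the
  offset, so the set of summation points is unchanged.\<close>

lemma grid_sum_unimodular:
  fixes a b c d :: int
  assumes det: "a * d - b * c = 1"
  shows "grid_sum F u1 v1 u2 v2 (of_int a * y1 + of_int b * y2) (of_int c * y1 + of_int d * y2) =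
    grid_sum F (of_int a * u1 + of_int c * u2) (of_int a * v1 + of_int c * v2)
      (of_int b * u1 + of_int d * u2) (of_int b * v1 + of_int d * v2) y1 y2"
proof -
  define g where "g = (\<lambda>(j, k). (a * j + b * k, c * j + d * k))"
  have "bij g"
  proof (rule o_bij[where g = "\<lambda>(j, k). (d * j - b * k, a * k - c * j)"])
    have "d * (a * j + b * k) - b * (c * j + d * k) = j" "a * (c * j + d * k) - c * (a * j + b * k) = k" for j k
    proof -
      have "d * (a * j + b * k) - b * (c * j + d * k) = (a * d - b * c) * j"
        "a * (c * j + d * k) - c * (a * j + b * k) = (a * d - b * c) * k" by (simp_all add: algebra_simps)
      then show "d * (a * j + b * k) - b * (c * j + d * k) = j" "a * (c * j + d * k) - c * (a * j + b * k) = k"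
        using det by simp_all
    qed
    then show "(\<lambda>(j, k). (d * j - b * k, a * k - c * j)) \<circ> g = id"
      by (auto simp: g_def fun_eq_iff)
    have "a * (d * j - b * k) + b * (a * k - c * j) = j" "c * (d * j - b * k) + d * (a * k - c * j) = k" for j k
    proof -
      have "a * (d * j - b * k) + b * (a * k - c * j) = (a * d - b * c) * j"
        "c * (d * j - b * k) + d * (a * k - c * j) = (a * d - b * c) * k" by (simp_all add: algebra_simps)
      then show "a * (d * j - b * k) + b * (a * k - c * j) = j" "c * (d * j - b * k) + d * (a * k - c * j) = k"
        using det by simp_all
    qed
    then show "g \<circ> (\<lambda>(j, k). (d * j - b * k, a * k - c * j)) = id"
      by (auto simp: g_def fun_eq_iff)
  qed
  from infsum_reindex_bij_betw[OF this] show ?thesis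
    unfolding grid_sum_def
    by (rule trans[OF sym]) (auto intro!: infsum_cong arg_cong[where f = F] simp: g_def algebra_simps)
qed

lemma grid_sum_periodic:
  "grid_sum F u1 v1 u2 v2 (y1 + of_int m) (y2 + of_int n) = grid_sum F u1 v1 u2 v2 y1 y2"
proof -
  have "bij (\<lambda>(j, k). (j + m, k + n))"
    by (rule o_bij[where g = "\<lambda>(j, k). (j - m, k - n)"]) (auto simp: fun_eq_iff)
  from infsum_reindex_bij_betw[OF this] show ?thesis
    unfolding grid_sum_def
    by (rule trans[OF sym, rotated]) (auto intro!: infsum_cong arg_cong[where f = F] simp: algebra_simps)
qed

text \<open>By Cramer's rule only boundedly many grid points meet the support of \<open>F\<close>.\<close>

lemma grid_sum_finite:
  fixes A C :: real
  assumes supp: "\<And>u v. A < \<bar>u\<bar> \<or> A < \<bar>v\<bar> \<Longrightarrow> F (u, v) = 0"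
    and det: "u1 * v2 - u2 * v1 = -1"
    and C: "\<bar>u1\<bar> \<le> C" "\<bar>v1\<bar> \<le> C" "\<bar>u2\<bar> \<le> C" "\<bar>v2\<bar> \<le> C" "\<bar>y1\<bar> \<le> C" "\<bar>y2\<bar> \<le> C"
    and J: "2 * A * C + C \<le> of_int J"
  shows "grid_sum F u1 v1 u2 v2 y1 y2 = (\<Sum>j=-J..J. \<Sum>k=-J..J.
     F (grid_point u1 v1 u2 v2 y1 y2 j k))"
proof -
  let ?f = "\<lambda>(j, k). F (grid_point u1 v1 u2 v2 y1 y2 j k)"
  have z: "?f (j, k) = 0" if "(j, k) \<notin> {-J..J} \<times> {-J..J}" for j k :: int
  proof (rule ccontr)
    define U V where "U = (of_int j + y1) * u1 + (of_int k + y2) * u2"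
      and "V = (of_int j + y1) * v1 + (of_int k + y2) * v2"
    assume "?f (j, k) \<noteq> 0"
    then have UV: "\<bar>U\<bar> \<le> A" "\<bar>V\<bar> \<le> A" using supp[of U V] unfolding U_def V_def by fastforce+
    have "V * u2 - U * v2 = - ((of_int j + y1) * (u1 * v2 - u2 * v1))"
      by (simp add: U_def V_def algebra_simps)
    then have 1: "of_int j + y1 = V * u2 - U * v2" using det by simp
    have "U * v1 - V * u1 = - ((of_int k + y2) * (u1 * v2 - u2 * v1))"
      by (simp add: U_def V_def algebra_simps)
    then have 2: "of_int k + y2 = U * v1 - V * u1" using det by simp
    have b: "\<bar>x * y\<bar> \<le> A * C" if "\<bar>x\<bar> \<le> A" "\<bar>y\<bar> \<le> C" for x y
      unfolding abs_mult using that by (intro mult_mono) auto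
    have "\<bar>real_of_int j\<bar> \<le> of_int J" using 1 b[OF UV(2) C(3)] b[OF UV(1) C(4)] C(5) J by linarith
    moreover have "\<bar>real_of_int k\<bar> \<le> of_int J" using 2 b[OF UV(1) C(2)] b[OF UV(2) C(1)] C(6) J by linarith
    ultimately have "\<bar>j\<bar> \<le> J" "\<bar>k\<bar> \<le> J" by (simp_all only: of_int_abs[symmetric] of_int_le_iff)
    then show False using that by auto
  qed
  have "grid_sum F u1 v1 u2 v2 y1 y2 = (\<Sum>\<^sub>\<infinity>x\<in>{-J..J} \<times> {-J..J}. ?f x)"
    unfolding grid_sum_def
  proof (rule infsum_cong_neutral)
    fix x assume "x \<in> UNIV - {-J..J} \<times> {-J..J}"
    then show "?f x = 0" using z[of "fst x" "snd x"] by (simp only: prod.collapse) blast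
  qed auto
  also have "\<dots> = (\<Sum>x\<in>{-J..J} \<times> {-J..J}. ?f x)" by (rule infsum_finite) simp
  finally show ?thesis by (simp add: sum.cartesian_product)
qed

lemma grid_sum_bound_exists:
  fixes A C :: real
  obtains J :: int where "2 * A * C + C \<le> of_int J"
  using ex_le_of_int by blast

text \<open>A common bound \<open>C\<close> on basis and offset gives one finite index box for all
  parameters, so regularity passes from \<open>F\<close> to a finite sum. The same device yields
  continuity in the next lemma.\<close>

lemma measurable_grid_sum:
  assumes F: "F \<in> borel_measurable borel" and supp: "\<And>u v. A < \<bar>u\<bar> \<or> A < \<bar>v\<bar> \<Longrightarrow> F (u, v) = 0"
    and m: "u1 \<in> borel_measurable M" "v1 \<in> borel_measurable M" "u2 \<in> borel_measurable M"
      "v2 \<in> borel_measurable M" "y1 \<in> borel_measurable M" "y2 \<in> borel_measurable M"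
    and b: "\<And>w. w \<in> space M \<Longrightarrow> u1 w * v2 w - u2 w * v1 w = -1 \<and> \<bar>u1 w\<bar> \<le> C \<and> \<bar>v1 w\<bar> \<le> C \<and> \<bar>u2 w\<bar> \<le> C \<and> \<bar>v2 w\<bar> \<le> C
      \<and> \<bar>y1 w\<bar> \<le> C \<and> \<bar>y2 w\<bar> \<le> C"
  shows "(\<lambda>w. grid_sum F (u1 w) (v1 w) (u2 w) (v2 w) (y1 w) (y2 w)) \<in> borel_measurable M"
proof -
  obtain J :: int where J: "2 * A * C + C \<le> of_int J" by (rule grid_sum_bound_exists)
  note [measurable] = m
  have [measurable]: "F \<in> borel_measurable (borel \<Otimes>\<^sub>M borel)" using F by (simp add: borel_prod)
  have "(\<lambda>w. \<Sum>j=-J..J. \<Sum>k=-J..J. F (grid_point (u1 w) (v1 w) (u2 w) (v2 w) (y1 w) (y2 w) j k)) \<in> borel_measurable M"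
    by measurable
  moreover have "grid_sum F (u1 w) (v1 w) (u2 w) (v2 w) (y1 w) (y2 w) =
    (\<Sum>j=-J..J. \<Sum>k=-J..J. F (grid_point (u1 w) (v1 w) (u2 w) (v2 w) (y1 w) (y2 w) j k))" if "w \<in> space M" for w
    by (rule grid_sum_finite[where A = A and F = F, OF supp]) (use b[OF that] J in auto)
  ultimately show ?thesis
    by (subst measurable_cong) auto
qed

lemma continuous_on_grid_sum:
  assumes F: "continuous_on UNIV F" and supp: "\<And>u v. A < \<bar>u\<bar> \<or> A < \<bar>v\<bar> \<Longrightarrow> F (u, v) = 0"
    and m: "continuous_on S u1" "continuous_on S v1" "continuous_on S u2"
      "continuous_on S v2" "continuous_on S y1" "continuous_on S y2"
    and b: "\<And>w. w \<in> S \<Longrightarrow> u1 w * v2 w - u2 w * v1 w = -1 \<and> \<bar>u1 w\<bar> \<le> C \<and> \<bar>v1 w\<bar> \<le> C \<and> \<bar>u2 w\<bar> \<le> C \<and> \<bar>v2 w\<bar> \<le> C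
      \<and> \<bar>y1 w\<bar> \<le> C \<and> \<bar>y2 w\<bar> \<le> C"
  shows "continuous_on S (\<lambda>w. grid_sum F (u1 w) (v1 w) (u2 w) (v2 w) (y1 w) (y2 w))"
proof -
  obtain J :: int where J: "2 * A * C + C \<le> of_int J" by (rule grid_sum_bound_exists)
  have "continuous_on S (\<lambda>w. \<Sum>j=-J..J. \<Sum>k=-J..J. F (grid_point (u1 w) (v1 w) (u2 w) (v2 w) (y1 w) (y2 w) j k))"
    by (intro continuous_on_sum continuous_on_compose2[OF F] continuous_intros m) auto
  moreover have "grid_sum F (u1 w) (v1 w) (u2 w) (v2 w) (y1 w) (y2 w) =
    (\<Sum>j=-J..J. \<Sum>k=-J..J. F (grid_point (u1 w) (v1 w) (u2 w) (v2 w) (y1 w) (y2 w) j k))" if "w \<in> S" for w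
    by (rule grid_sum_finite[where A = A and F = F, OF supp]) (use b[OF that] J in auto)
  ultimately show ?thesis
    by (subst continuous_on_cong[OF refl]) auto
qed

text \<open>The grid of orbit points, in the basis of the two Farey neighbours of \<open>\<alpha>\<close>.\<close>

lemma grid_sum_farey:
  assumes q: "0 < q" "0 < q'" and N: "0 < N" and det: "p' * int q - p * int q' = 1"
    and \<alpha>: "\<alpha> = of_int p / real q + r / (real q * real q')"
  shows "grid_sum F (1 / real N) (real N * \<alpha>) 0 (- real N) 0 (- x) =
    grid_sum F (real q / real N) (r / (real q' / real N)) (real q' / real N) (- (1 - r) / (real q / real N))
      (real q' * x) (- (real q * x))"
proof -
  have det': "of_int p' * real q - of_int p * real q' = 1" using arg_cong[OF det, of real_of_int] by simp
  \<comment> \<open>The new basis vectors are (q/N, N (q \<alpha> - p)) and (q'/N, N (q' \<alpha> -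
    p')). The identities \<open>e1\<close> and \<open>e2\<close> express their heights through q/N,
    q'/N and r alone.\<close>
  have e1: "of_int (int q) * (real N * \<alpha>) + of_int p * (- real N) = r / (real q' / real N)"
    using q N by (simp add: \<alpha> field_simps)
  have e2: "of_int (int q') * (real N * \<alpha>) + of_int p' * (- real N) = - (1 - r) / (real q / real N)"
  proof -
    have "of_int (int q') * (real N * \<alpha>) + of_int p' * (- real N) =
      real N * ((of_int p * real q' - of_int p' * real q) + r) / real q"
      using q N by (simp add: \<alpha> field_simps)
    also have "of_int p * real q' - of_int p' * real q = -1" using det' by simp
    finally show ?thesis using q N by simp
  qed
  have "grid_sum F (1 / real N) (real N * \<alpha>) 0 (- real N) (of_int (int q) * (real q' * x) + of_int (int q') * (- (real q * x)))
      (of_int p * (real q' * x) + of_int p' * (- (real q * x))) =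
    grid_sum F (of_int (int q) * (1 / real N) + of_int p * 0) (of_int (int q) * (real N * \<alpha>) + of_int p * (- real N))
      (of_int (int q') * (1 / real N) + of_int p' * 0) (of_int (int q') * (real N * \<alpha>) + of_int p' * (- real N)) (real q' * x) (- (real q * x))"
    by (rule grid_sum_unimodular) (use det in \<open>simp add: algebra_simps\<close>)
  \<comment> \<open>This identity and the next one say that (q' x, -q x) are the coordinates of the
    offset (0, -x) in the Farey basis.\<close>
  moreover have "of_int (int q) * (real q' * x) + of_int (int q') * (- (real q * x)) = 0" by simp
  moreover have "of_int p * (real q' * x) + of_int p' * (- (real q * x)) = - x"
  proof -
    have "of_int p * (real q' * x) + of_int p' * (- (real q * x)) = - ((of_int p' * real q - of_int p * real q') * x)"
      by (simp add: algebra_simps)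
    then show ?thesis by (simp add: det')
  qed
  ultimately show ?thesis unfolding e1 e2 by simp
qed

section \<open>Averages along closed geodesics of the torus\<close>

lemma circle_rep_borel [measurable]: "circle_rep \<in> borel_measurable borel"
  unfolding circle_rep_def by measurable

lemma haar1_integral_bound:
  fixes f :: "real \<Rightarrow> complex"
  assumes "f \<in> borel_measurable haar1" "\<And>x. x \<in> {0<..1} \<Longrightarrow> norm (f x) \<le> K"
  shows "integrable haar1 f" "norm (\<integral>x. f x \<partial>haar1) \<le> K"
proof -
  interpret prob_space haar1 by (rule prob_space_haar1)
  show i: "integrable haar1 f"
    by (rule integrable_const_bound[where B = K]) (use assms in \<open>auto intro!: AE_I2\<close>)
  have "norm (\<integral>x. f x \<partial>haar1) \<le> (\<integral>x. norm (f x) \<partial>haar1)"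
    by (rule Bochner_Integration.integral_norm_bound)
  also have "\<dots> \<le> (\<integral>x. K \<partial>haar1)"
    by (rule Bochner_Integration.integral_mono) (use i assms in auto)
  finally show "norm (\<integral>x. f x \<partial>haar1) \<le> K" using prob_space by simp
qed

lemma integrable_haar1_bounded:
  fixes f :: "real \<Rightarrow> complex"
  assumes "f \<in> borel_measurable borel" "\<And>x. norm (f x) \<le> K"
  shows "integrable haar1 f"
proof -
  interpret prob_space haar1 by (rule prob_space_haar1)
  show ?thesis
    by (rule integrable_const_bound[where B = K]) (use assms measurable_haar1_borel in auto)
qed

lemma integrable_Ioc_bounded:
  fixes f :: "real \<Rightarrow> complex"
  assumes "f \<in> borel_measurable borel" "\<And>x. norm (f x) \<le> K"
  shows "integrable lborel (\<lambda>x. indicator {u<..v} x *\<^sub>R f x)"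
proof -
  have "emeasure lborel {u<..v} < \<infinity>" by (cases "u \<le> v") auto
  then show ?thesis
    by (intro integrableI_bounded_set_indicator[where B = K]) (use assms in auto)
qed

lemma integral_Ioc_split:
  fixes f :: "real \<Rightarrow> complex"
  assumes f: "f \<in> borel_measurable borel" "\<And>x. norm (f x) \<le> K" and uvw: "u \<le> v" "v \<le> w"
  shows "(\<integral>x. indicator {u<..w} x *\<^sub>R f x \<partial>lborel) =
    (\<integral>x. indicator {u<..v} x *\<^sub>R f x \<partial>lborel) + (\<integral>x. indicator {v<..w} x *\<^sub>R f x \<partial>lborel)"
proof -
  have "indicator {u<..w} x *\<^sub>R f x = indicator {u<..v} x *\<^sub>R f x + indicator {v<..w} x *\<^sub>R f x" for x
    using uvw by (auto simp: indicator_def)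
  then show ?thesis
    using Bochner_Integration.integral_add[OF integrable_Ioc_bounded[OF f, of u v] integrable_Ioc_bounded[OF f, of v w]]
    by simp
qed

lemma integral_Ioc_shift:
  fixes f :: "real \<Rightarrow> complex"
  shows "(\<integral>x. indicator {u<..v} x *\<^sub>R f (x + c) \<partial>lborel) = (\<integral>x. indicator {u + c<..v + c} x *\<^sub>R f x \<partial>lborel)"
proof -
  have "(\<integral>x. indicator {u + c<..v + c} x *\<^sub>R f x \<partial>lborel) = \<bar>1\<bar> *\<^sub>R (\<integral>x. indicator {u + c<..v + c} (c + 1 * x) *\<^sub>R f (c + 1 * x) \<partial>lborel)"
    by (rule lborel_integral_real_affine) simp
  also have "(\<lambda>x. indicator {u + c<..v + c} (c + 1 * x) *\<^sub>R f (c + 1 * x)) = (\<lambda>x. indicator {u<..v} x *\<^sub>R f (x + c))"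
    by (auto simp: indicator_def fun_eq_iff add.commute)
  finally show ?thesis by simp
qed

lemma integral_period:
  fixes f :: "real \<Rightarrow> complex"
  assumes f: "f \<in> borel_measurable borel" "\<And>x. norm (f x) \<le> K" and per: "\<And>x m. f (x + of_int m) = f x"
  shows "(\<integral>x. indicator {c<..c + 1} x *\<^sub>R f x \<partial>lborel) = (\<integral>x. f x \<partial>haar1)"
proof -
  let ?I = "\<lambda>u v. \<integral>x. indicator {u<..v} x *\<^sub>R f x \<partial>lborel"
  define e where "e = c - of_int \<lfloor>c\<rfloor>"
  have e: "0 \<le> e" "e \<le> 1" unfolding e_def by linarith+
  have sh: "?I (u + of_int m) (v + of_int m) = ?I u v" for u v m
    using integral_Ioc_shift[of u v f "of_int m"] by (simp add: per)
  have "?I c (c + 1) = ?I e (e + 1)"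
    using sh[of e "\<lfloor>c\<rfloor>" "e + 1"] by (simp add: e_def algebra_simps)
  also have "\<dots> = ?I e 1 + ?I 1 (e + 1)" by (rule integral_Ioc_split[OF f]) (use e in auto)
  also have "?I 1 (e + 1) = ?I 0 e" using sh[of 0 1 e] by simp
  also have "?I e 1 + ?I 0 e = ?I 0 1" using integral_Ioc_split[OF f, of 0 e 1] e by simp
  finally show ?thesis by (simp add: integral_haar1)
qed

lemma integral_haar1_shift:
  fixes f :: "real \<Rightarrow> complex"
  assumes f: "f \<in> borel_measurable borel" "\<And>x. norm (f x) \<le> K" and per: "\<And>x m. f (x + of_int m) = f x"
  shows "(\<integral>x. f (x + c) \<partial>haar1) = (\<integral>x. f x \<partial>haar1)"
  using integral_period[OF assms, of c] integral_Ioc_shift[of 0 1 f c] by (simp add: integral_haar1 add.commute)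

text \<open>Multiplication by \<open>q\<close> maps (0,1] onto q full periods.\<close>

lemma integral_haar1_scale:
  fixes f :: "real \<Rightarrow> complex"
  assumes f: "f \<in> borel_measurable borel" "\<And>x. norm (f x) \<le> K" and per: "\<And>x m. f (x + of_int m) = f x"
    and q: "0 < q"
  shows "(\<integral>x. f (real q * x) \<partial>haar1) = (\<integral>x. f x \<partial>haar1)"
proof -
  let ?I = "\<lambda>u v. \<integral>x. indicator {u<..v} x *\<^sub>R f x \<partial>lborel"
  have "?I 0 (real q) = of_nat q * (\<integral>x. f x \<partial>haar1)"
  proof (induction q)
    case (Suc q)
    have "?I 0 (real (Suc q)) = ?I 0 (real q) + ?I (real q) (real q + 1)"
      using integral_Ioc_split[OF f, of 0 "real q" "real (Suc q)"] by (simp add: add.commute)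
    then show ?case using Suc integral_period[OF f per, of "real q"] by (simp add: algebra_simps)
  qed simp
  moreover have "?I 0 (real q) = of_nat q * (\<integral>x. f (real q * x) \<partial>haar1)"
  proof -
    have "?I 0 (real q) = \<bar>real q\<bar> *\<^sub>R (\<integral>x. indicator {0<..real q} (0 + real q * x) *\<^sub>R f (0 + real q * x) \<partial>lborel)"
      by (rule lborel_integral_real_affine) (use q in simp)
    also have "(\<lambda>x. indicator {0<..real q} (0 + real q * x) *\<^sub>R f (0 + real q * x)) = (\<lambda>x. indicator {0<..1} x *\<^sub>R f (real q * x))"
      using q by (auto simp: indicator_def fun_eq_iff zero_less_mult_iff)
    finally show ?thesis by (simp add: integral_haar1 scaleR_conv_of_real)
  qed
  ultimately have "of_nat q * (\<integral>x. f (real q * x) \<partial>haar1) = of_nat q * (\<integral>x. f x \<partial>haar1)"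
    by (rule trans[OF sym, rotated])
  then show ?thesis using q by simp
qed

text \<open>The map i -> q' i + k permutes the residues modulo q, and periodicity removes the
  quotient. It is needed with q' = 1, to shift by k/q, and with k = 0, to undo the factor
  q'.\<close>

lemma sum_residue_shift:
  fixes f :: "real \<Rightarrow> 'a::comm_monoid_add"
  assumes per: "\<And>x m. f (x + of_int m) = f x" and q: "0 < q" and cop: "coprime q q'"
  shows "(\<Sum>i<q. f (c + (real q' * real i + of_int k) / real q)) = (\<Sum>i<q. f (c + real i / real q))"
proof -
  define g where "g i = nat ((int q' * int i + k) mod int q)" for i
  have g: "int (g i) = (int q' * int i + k) mod int q" for i
    using q by (simp add: g_def)
  have gq: "g i < q" for i
    using g[of i] q by (metis of_nat_0_less_iff of_nat_less_iff pos_mod_bound)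
  have inj: "inj_on g {..<q}"
  proof (rule inj_onI)
    fix i j assume ij: "i \<in> {..<q}" "j \<in> {..<q}" "g i = g j"
    then have "(int q' * int i + k) mod int q = (int q' * int j + k) mod int q" by (metis g)
    then have "int q dvd (int q' * int i + k) - (int q' * int j + k)" by (rule mod_eq_dvd_iff[THEN iffD1])
    then have "int q dvd int q' * (int i - int j)" by (simp add: algebra_simps)
    then have "int q dvd int i - int j" using cop by (simp add: coprime_dvd_mult_right_iff)
    moreover have "\<bar>int i - int j\<bar> < int q" using ij by auto
    ultimately have "int i - int j = 0" by (metis dvd_imp_le_int linorder_not_le abs_of_nat)
    then show "i = j" by simp
  qed
  have "g ` {..<q} = {..<q}"
    by (rule card_subset_eq) (use gq card_image[OF inj] in auto)
  then have bij: "bij_betw g {..<q} {..<q}" using inj by (simp add: bij_betw_def)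
  have "f (c + (real q' * real i + of_int k) / real q) = f (c + real (g i) / real q)" for i
  proof -
    define m where "m = (int q' * int i + k) div int q"
    have "int q' * int i + k = int (g i) + int q * m" unfolding g m_def by simp
    then have "real_of_int (int q' * int i + k) = real_of_int (int (g i) + int q * m)" by (rule arg_cong)
    then have "real q' * real i + of_int k = real (g i) + real q * of_int m" by simp
    then have "c + (real q' * real i + of_int k) / real q = c + real (g i) / real q + of_int m"
      using q by (simp add: field_simps)
    then show ?thesis by (simp only: per)
  qed
  then show ?thesis using sum.reindex_bij_betw[OF bij, of "\<lambda>i. f (c + real i / real q)"] by simp
qed

text \<open>The closed geodesic \<open>x \<mapsto> (q' x, - q x)\<close> is invariant under translation by \<open>(i / q, 0)\<close>, so that it
  equidistributes in the torus as soon as \<open>q\<close> is large.\<close>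

lemma closed_geodesic_average:
  fixes p :: "real \<Rightarrow> real \<Rightarrow> complex"
  assumes meas: "(\<lambda>(y1, y2). p y1 y2) \<in> borel_measurable (borel \<Otimes>\<^sub>M borel)"
    and bd: "\<And>y1 y2. norm (p y1 y2) \<le> 1"
    and per: "\<And>y1 y2 m n. p (y1 + of_int m) (y2 + of_int n) = p y1 y2"
    and q: "0 < q" and cop: "coprime q q'"
    and osc: "\<And>y1 z1 y2. \<bar>y1 - z1\<bar> \<le> 1 / real q \<Longrightarrow> norm (p y1 y2 - p z1 y2) \<le> \<epsilon>"
  shows "norm ((\<integral>x. p (real q' * x) (- (real q * x)) \<partial>haar1) - (\<integral>y2. (\<integral>y1. p y1 (- y2) \<partial>haar1) \<partial>haar1)) \<le> \<epsilon>"
proof -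
  interpret prob_space haar1 by (rule prob_space_haar1)
  have per1: "p (y1 + of_int m) y2 = p y1 y2" and per2: "p y1 (y2 + of_int m) = p y1 y2" for y1 y2 m
    using per[of y1 m y2 0] per[of y1 0 y2 m] by simp_all
  have [measurable]: "(\<lambda>x. p (f x) (g x)) \<in> borel_measurable M"
    if [measurable]: "f \<in> borel_measurable M" "g \<in> borel_measurable M" for f g and M :: "'x measure"
    using measurable_compose[OF measurable_Pair[OF that] meas] by simp
  \<comment> \<open>Average of \<open>p\<close> over the translates by i/q in the first variable; it
    has period 1/q there.\<close>
  define \<Psi> where "\<Psi> c y2 = (\<Sum>i<q. p (c + real i / real q) y2) / of_nat q" for c y2
  have \<Psi>m: "(\<lambda>x. \<Psi> (f x) (g x)) \<in> borel_measurable M"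
    if [measurable]: "f \<in> borel_measurable M" "g \<in> borel_measurable M" for f g and M :: "real measure"
    unfolding \<Psi>_def by measurable
  have avg: "norm (\<Sum>i<q. h i) \<le> real q * K" if "\<And>i. norm (h i) \<le> K" for h :: "nat \<Rightarrow> complex" and K
    using sum_norm_bound[of "{..<q}" h K] that by simp
  have \<Psi>bd: "norm (\<Psi> c y2) \<le> 1" for c y2
    using avg[of "\<lambda>i. p (c + real i / real q) y2" 1] bd q by (simp add: \<Psi>_def norm_divide divide_le_eq)
  have \<Psi>osc: "norm (\<Psi> c y2 - \<Psi> d y2) \<le> \<epsilon>" for c d y2
  proof -
    \<comment> \<open>By the period 1/q, \<open>d\<close> may be moved to within 1/q of
      \<open>c\<close>, where the oscillation of \<open>p\<close> is at most \<epsilon>. Hence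
      \<open>\<Psi>\<close> is nearly constant in its first argument.\<close>
    define k where "k = \<lfloor>(c - d) * real q\<rfloor>"
    have k: "of_int k \<le> (c - d) * real q" "(c - d) * real q < of_int k + 1" unfolding k_def by linarith+
    have "of_int k / real q \<le> c - d" "c - d < (of_int k + 1) / real q"
      using k q by (simp_all add: pos_divide_le_eq pos_less_divide_eq)
    then have "\<bar>c - (d + of_int k / real q)\<bar> \<le> 1 / real q"
      by (simp add: add_divide_distrib abs_le_iff)
    then have o: "norm (p (c + real i / real q) y2 - p (d + of_int k / real q + real i / real q) y2) \<le> \<epsilon>" for i
      by (intro osc) simp
    have "\<Psi> d y2 = (\<Sum>i<q. p (d + of_int k / real q + real i / real q) y2) / of_nat q"
      using sum_residue_shift[of "\<lambda>y. p y y2" q 1 d k, OF per1 q]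
      by (simp add: \<Psi>_def add_divide_distrib algebra_simps)
    then have "\<Psi> c y2 - \<Psi> d y2 = (\<Sum>i<q. p (c + real i / real q) y2 - p (d + of_int k / real q + real i / real q) y2) / of_nat q"
      by (simp add: \<Psi>_def sum_subtractf diff_divide_distrib)
    then show ?thesis using avg[OF o] q by (simp add: norm_divide divide_le_eq mult.commute)
  qed
  have int1: "integrable haar1 (\<lambda>y. p (f y) (g y))" if "f \<in> borel_measurable borel" "g \<in> borel_measurable borel" for f g
    by (rule integrable_haar1_bounded[where K = 1]) (use bd that in auto)
  have int2: "integrable haar1 (\<lambda>y. \<Psi> (f y) (g y))" if "f \<in> borel_measurable borel" "g \<in> borel_measurable borel" for f g
    by (rule integrable_haar1_bounded[where K = 1]) (use \<Psi>bd \<Psi>m that in auto)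
  define m where "m y2 = (\<integral>y1. p y1 y2 \<partial>haar1)" for y2
  have m\<Psi>: "m y2 = (\<integral>y1. \<Psi> y1 y2 \<partial>haar1)" for y2
  proof -
    have sh: "(\<integral>y1. p (y1 + real i / real q) y2 \<partial>haar1) = m y2" for i
      unfolding m_def by (rule integral_haar1_shift[where K = 1]) (use bd per1 in auto)
    have "(\<integral>y1. \<Psi> y1 y2 \<partial>haar1) = (\<Sum>i<q. \<integral>y1. p (y1 + real i / real q) y2 \<partial>haar1) / of_nat q"
      unfolding \<Psi>_def by (simp add: Bochner_Integration.integral_sum int1)
    then show ?thesis using q by (simp add: sh)
  qed
  have close: "norm (\<Psi> c y2 - m y2) \<le> \<epsilon>" for c y2
  proof -
    have "\<Psi> c y2 - m y2 = (\<integral>y1. \<Psi> c y2 - \<Psi> y1 y2 \<partial>haar1)"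
      unfolding m\<Psi> using int2[of "\<lambda>y. y" "\<lambda>_. y2"] prob_space by (simp add: Bochner_Integration.integral_diff)
    also have "norm \<dots> \<le> \<epsilon>"
      by (rule haar1_integral_bound(2))
         (use \<Psi>osc int2[of "\<lambda>_. c" "\<lambda>_. y2"] int2[of "\<lambda>y. y" "\<lambda>_. y2"] in \<open>auto intro: borel_measurable_integrable\<close>)
    finally show ?thesis .
  qed
  have "(\<lambda>(y2, y1). p y1 y2) \<in> borel_measurable (borel \<Otimes>\<^sub>M haar1)"
  proof -
    have "snd \<in> borel_measurable ((borel :: real measure) \<Otimes>\<^sub>M haar1)"
      by (rule measurable_compose[OF measurable_snd measurable_haar1_borel]) simp
    then have "(\<lambda>x. p (snd x) (fst x)) \<in> borel_measurable ((borel :: real measure) \<Otimes>\<^sub>M haar1)"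
      by measurable
    then show ?thesis by (simp add: case_prod_unfold)
  qed
  then have m_meas [measurable]: "m \<in> borel_measurable borel"
    unfolding m_def by (rule borel_measurable_lebesgue_integral)
  have m_bd: "norm (m y2) \<le> 1" for y2
    unfolding m_def by (rule haar1_integral_bound(2)) (use bd int1[of "\<lambda>y. y" "\<lambda>_. y2"] in auto)
  define g where "g x = p (real q' * x) (- (real q * x))" for x
  have g: "g \<in> borel_measurable borel" unfolding g_def by measurable
  have gper: "g (x + of_int k) = g x" for x k
    using per[of "real q' * x" "int q' * k" "- (real q * x)" "- (int q * k)"] by (simp add: g_def algebra_simps)
  have gbd: "norm (g x) \<le> 1" for x by (simp add: g_def bd)
  \<comment> \<open>Translating x by i/q moves (q' x, -q x) by (q' i / q, -i): the second coordinate
    changes by an integer and, as q' is invertible modulo q, the first runs over all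
    translates.\<close>
  have gs: "(\<Sum>i<q. g (x + real i / real q)) / of_nat q = \<Psi> (real q' * x) (- (real q * x))" for x
  proof -
    have "g (x + real i / real q) = p (real q' * x + (real q' * real i + of_int 0) / real q) (- (real q * x))" for i
      using per2[of "real q' * x + real q' * real i / real q" "- (real q * x)" "- int i"] q
      by (simp add: g_def algebra_simps)
    then show ?thesis
      using sum_residue_shift[of "\<lambda>y. p y (- (real q * x))" q q' "real q' * x" 0, OF per1 q cop]
      by (simp add: \<Psi>_def)
  qed
  have "(\<integral>x. g x \<partial>haar1) = (\<Sum>i<q. \<integral>x. g (x + real i / real q) \<partial>haar1) / of_nat q"
    using q by (simp add: integral_haar1_shift[OF g gbd gper])
  also have "\<dots> = (\<integral>x. (\<Sum>i<q. g (x + real i / real q)) / of_nat q \<partial>haar1)"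
  proof -
    have "integrable haar1 (\<lambda>x. g (x + real i / real q))" for i
      by (rule integrable_haar1_bounded[where K = 1]) (use g gbd in auto)
    then show ?thesis by (simp add: Bochner_Integration.integral_sum)
  qed
  also have "\<dots> = (\<integral>x. \<Psi> (real q' * x) (- (real q * x)) \<partial>haar1)" by (simp only: gs)
  finally have 1: "(\<integral>x. g x \<partial>haar1) = (\<integral>x. \<Psi> (real q' * x) (- (real q * x)) \<partial>haar1)" .
  have mi: "integrable haar1 (\<lambda>x. m (- (real q * x)))"
    by (rule integrable_haar1_bounded[where K = 1]) (use m_bd in auto)
  have \<Psi>i: "integrable haar1 (\<lambda>x. \<Psi> (real q' * x) (- (real q * x)))" by (rule int2) auto
  \<comment> \<open>Only the second coordinate is left, and x -> q x preserves the measure of the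
    circle.\<close>
  have "(\<integral>x. m (- (real q * x)) \<partial>haar1) = (\<integral>y2. m (- y2) \<partial>haar1)"
  proof (rule integral_haar1_scale[where f = "\<lambda>y. m (- y)" and K = 1, OF _ _ _ q])
    show "m (- (x + of_int k)) = m (- x)" for x k
      using per2[of _ "- x" "- k"] by (simp add: m_def)
  qed (use m_bd in auto)
  then have "(\<integral>x. g x \<partial>haar1) - (\<integral>y2. m (- y2) \<partial>haar1) = (\<integral>x. \<Psi> (real q' * x) (- (real q * x)) - m (- (real q * x)) \<partial>haar1)"
    using 1 mi \<Psi>i by simp
  also have "norm \<dots> \<le> \<epsilon>"
    by (rule haar1_integral_bound(2)) (use close mi \<Psi>i in auto)
  finally show ?thesis by (simp add: g_def m_def)
qed

section \<open>Equidistribution of the random grid\<close>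

lemma haar1_integral_close:
  fixes f g :: "real \<Rightarrow> complex"
  assumes f: "f \<in> borel_measurable haar1" "\<And>x. x \<in> {0<..1} \<Longrightarrow> norm (f x) \<le> 1"
    and g: "g \<in> borel_measurable haar1" "\<And>x. x \<in> {0<..1} \<Longrightarrow> norm (g x) \<le> 1"
    and close: "\<And>x. x \<in> {0<..1} \<Longrightarrow> norm (f x - g x) \<le> \<epsilon>"
  shows "norm ((\<integral>x. f x \<partial>haar1) - (\<integral>x. g x \<partial>haar1)) \<le> \<epsilon>"
proof -
  have "(\<integral>x. f x \<partial>haar1) - (\<integral>x. g x \<partial>haar1) = (\<integral>x. f x - g x \<partial>haar1)"
    using haar1_integral_bound(1)[OF f] haar1_integral_bound(1)[OF g] by simp
  also have "norm \<dots> \<le> \<epsilon>"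
    by (rule haar1_integral_bound(2)) (use f g close in auto)
  finally show ?thesis .
qed

lemma measurable_haar1_section:
  fixes f :: "'b \<Rightarrow> real \<Rightarrow> complex"
  assumes "(\<lambda>(x, y). f x y) \<in> borel_measurable (M \<Otimes>\<^sub>M haar1)"
  shows "(\<lambda>x. \<integral>y. f x y \<partial>haar1) \<in> borel_measurable M"
proof -
  interpret prob_space haar1 by (rule prob_space_haar1)
  show ?thesis by (rule borel_measurable_lebesgue_integral[OF assms])
qed

lemma AE_haar1_neq: "AE x in haar1. x \<noteq> c"
proof -
  have "AE x in lborel. x \<in> {0<..1} \<longrightarrow> x \<noteq> c"
    using AE_lborel_singleton[of c] by eventually_elim auto
  then show ?thesis unfolding haar1_def by (subst AE_restrict_space_iff) auto
qed

text \<open>The integrand of the Riemann sum over coprime pairs can jump only on lines of this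
  form.\<close>

lemma AE_haar2_neq_line: "AE p in haar2. fst p \<noteq> c \<and> snd p \<noteq> c \<and> fst p + snd p \<noteq> d"
proof -
  interpret prob_space haar1 by (rule prob_space_haar1)
  interpret pair_prob_space haar1 haar1 ..
  have [measurable]: "(\<lambda>x. x) \<in> borel_measurable haar1" by (rule measurable_haar1_borel) simp
  show ?thesis unfolding haar2_def
  proof (rule AE_pair_measure)
    have "{p \<in> space (haar1 \<Otimes>\<^sub>M haar1). fst p \<noteq> c \<and> snd p \<noteq> c \<and> fst p + snd p \<noteq> d} =
      (\<lambda>p. (fst p, snd p)) -` {p. fst p \<noteq> c \<and> snd p \<noteq> c \<and> fst p + snd p \<noteq> d} \<inter> space (haar1 \<Otimes>\<^sub>M haar1)" by auto
    also have "\<dots> \<in> sets (haar1 \<Otimes>\<^sub>M haar1)"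
    proof (rule measurable_sets)
      show "(\<lambda>p. (fst p, snd p)) \<in> haar1 \<Otimes>\<^sub>M haar1 \<rightarrow>\<^sub>M (borel :: (real \<times> real) measure)"
        unfolding borel_prod[symmetric]
        by (intro measurable_Pair measurable_compose[OF measurable_fst] measurable_compose[OF measurable_snd]) auto
      show "{p :: real \<times> real. fst p \<noteq> c \<and> snd p \<noteq> c \<and> fst p + snd p \<noteq> d} \<in> sets borel"
        by (intro borel_open open_Collect_conj open_Collect_neq continuous_intros)
    qed
    finally show "{p \<in> space (haar1 \<Otimes>\<^sub>M haar1). fst p \<noteq> c \<and> snd p \<noteq> c \<and> fst p + snd p \<noteq> d} \<in> sets (haar1 \<Otimes>\<^sub>M haar1)" .
    show "AE x in haar1. AE y in haar1. fst (x, y) \<noteq> c \<and> snd (x, y) \<noteq> c \<and> fst (x, y) + snd (x, y) \<noteq> d"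
      using AE_haar1_neq[of c]
    proof eventually_elim
      case (elim x)
      show ?case using AE_haar1_neq[of c] AE_haar1_neq[of "d - x"] by eventually_elim (use elim in auto)
    qed
  qed
qed

section \<open>Bounded functionals of the grid sum\<close>

locale grid_functional =
  fixes F :: "real \<times> real \<Rightarrow> real" and A :: real and U :: "real \<Rightarrow> complex"
  assumes F: "continuous_on UNIV F" and supp: "\<And>u v. A < \<bar>u\<bar> \<or> A < \<bar>v\<bar> \<Longrightarrow> F (u, v) = 0"
    and U: "continuous_on UNIV U" "\<And>x. norm (U x) \<le> 1"
begin

text \<open>The functional in Farey coordinates: s and s' stand for q/N and q'/N, r for the position
  in the arc, y1 and y2 for the offset.\<close>

definition Y :: "real \<Rightarrow> real \<Rightarrow> real \<Rightarrow> real \<Rightarrow> real \<Rightarrow> complex" where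
  "Y s s' r y1 y2 = U (grid_sum F s (r / s') s' (- (1 - r) / s) y1 y2)"

text \<open>This grid consists of the points (j/N, N (x + j \<alpha> - k)): rescaled time, and
  rescaled signed distance of a lift of the orbit from the singularity.\<close>

definition X :: "nat \<Rightarrow> real \<Rightarrow> real \<Rightarrow> real" where
  "X N \<alpha> x = grid_sum F (1 / real N) (real N * \<alpha>) 0 (- real N) 0 (- x)"

lemma F_borel: "F \<in> borel_measurable borel"
  using F by (rule borel_measurable_continuous_onI)

lemma U_borel [measurable]: "U \<in> borel_measurable borel"
  using U(1) by (rule borel_measurable_continuous_onI)

lemma Y_bound: "norm (Y s s' r y1 y2) \<le> 1"
  by (simp add: Y_def U)

lemma Y_periodic: "Y s s' r (y1 + of_int m) (y2 + of_int n) = Y s s' r y1 y2"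
  by (simp add: Y_def grid_sum_periodic)

text \<open>The summand 2 leaves room for offsets up to 2 in absolute value, so that one constant
  serves for basis and offset.\<close>

lemma basis_bounds:
  fixes s s' r \<delta> :: real
  assumes "0 < \<delta>" "\<delta> \<le> s" "s \<le> 1" "\<delta> \<le> s'" "s' \<le> 1" "0 \<le> r" "r \<le> 1"
  shows "s * (- (1 - r) / s) - s' * (r / s') = -1"
    "\<bar>s\<bar> \<le> 1 / \<delta> + 2" "\<bar>r / s'\<bar> \<le> 1 / \<delta> + 2" "\<bar>s'\<bar> \<le> 1 / \<delta> + 2" "\<bar>- (1 - r) / s\<bar> \<le> 1 / \<delta> + 2"
proof -
  have d: "0 < 1 / \<delta>" using assms by simp
  have "r / s' \<le> 1 / \<delta>" "(1 - r) / s \<le> 1 / \<delta>" using assms by (auto intro!: frac_le)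
  then show "\<bar>r / s'\<bar> \<le> 1 / \<delta> + 2" "\<bar>- (1 - r) / s\<bar> \<le> 1 / \<delta> + 2"
    using assms by auto
  show "\<bar>s\<bar> \<le> 1 / \<delta> + 2" using d assms by linarith
  show "\<bar>s'\<bar> \<le> 1 / \<delta> + 2" using d assms by linarith
  show "s * (- (1 - r) / s) - s' * (r / s') = -1" using assms by (simp add: field_simps)
qed

text \<open>The offset is first reduced to (0,1], where the uniform bounds for
  \<open>grid_sum\<close> hold; periodicity returns to the original offset.\<close>

lemma measurable_Y:
  assumes s: "0 < s" "s \<le> 1" "0 < s'" "s' \<le> 1"
    and m [measurable]: "r \<in> borel_measurable M" "y1 \<in> borel_measurable M" "y2 \<in> borel_measurable M"
    and r: "\<And>w. w \<in> space M \<Longrightarrow> 0 \<le> r w \<and> r w \<le> 1"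
  shows "(\<lambda>w. Y s s' (r w) (y1 w) (y2 w)) \<in> borel_measurable M"
proof -
  define \<delta> where "\<delta> = min s s'"
  have \<delta>: "0 < \<delta>" "\<delta> \<le> s" "\<delta> \<le> s'" using s by (auto simp: \<delta>_def)
  have c: "\<bar>circle_rep x\<bar> \<le> 1 / \<delta> + 2" for x
  proof -
    have "0 < 1 / \<delta>" using \<delta> by simp
    then show ?thesis using circle_rep_pos[of x] circle_rep_le_1[of x] by linarith
  qed
  have "(\<lambda>w. grid_sum F s (r w / s') s' (- (1 - r w) / s) (circle_rep (y1 w)) (circle_rep (y2 w))) \<in> borel_measurable M"
  proof (rule measurable_grid_sum[where F = F and A = A and C = "1 / \<delta> + 2", OF F_borel supp])
    fix w assume "w \<in> space M"
    then have "0 \<le> r w" "r w \<le> 1" using r by auto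
    from basis_bounds[OF \<delta>(1,2) s(2) \<delta>(3) s(4) this] c
    show "s * (- (1 - r w) / s) - s' * (r w / s') = - 1 \<and> \<bar>s\<bar> \<le> 1 / \<delta> + 2 \<and> \<bar>r w / s'\<bar> \<le> 1 / \<delta> + 2 \<and>
      \<bar>s'\<bar> \<le> 1 / \<delta> + 2 \<and> \<bar>- (1 - r w) / s\<bar> \<le> 1 / \<delta> + 2 \<and> \<bar>circle_rep (y1 w)\<bar> \<le> 1 / \<delta> + 2 \<and> \<bar>circle_rep (y2 w)\<bar> \<le> 1 / \<delta> + 2"
      by blast
  qed measurable
  then have "(\<lambda>w. Y s s' (r w) (circle_rep (y1 w)) (circle_rep (y2 w))) \<in> borel_measurable M"
    unfolding Y_def by measurable
  moreover have "Y s s' r (circle_rep y1) (circle_rep y2) = Y s s' r y1 y2" for r y1 y2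
    using Y_periodic[of s s' r "circle_rep y1" "\<lceil>y1\<rceil> - 1" "circle_rep y2" "\<lceil>y2\<rceil> - 1"]
    by (simp add: circle_rep_def)
  ultimately show ?thesis by simp
qed

text \<open>Uniform continuity on a compact parameter set. It extends to all real offsets because y1
  and z1 can be shifted by the same integer, after which y1 lies in [0,1] and its neighbour z1 in
  [-1,2].\<close>

lemma Y_equicontinuous:
  assumes \<delta>: "0 < \<delta>" and \<epsilon>: "0 < \<epsilon>"
  obtains d where "0 < d" "\<And>s s' t t' r y1 z1 y2. s \<in> {\<delta>..1} \<Longrightarrow> s' \<in> {\<delta>..1} \<Longrightarrow> t \<in> {\<delta>..1} \<Longrightarrow> t' \<in> {\<delta>..1} \<Longrightarrow>
    r \<in> {0..1} \<Longrightarrow> \<bar>s - t\<bar> < d \<Longrightarrow> \<bar>s' - t'\<bar> < d \<Longrightarrow> \<bar>y1 - z1\<bar> < d \<Longrightarrow> norm (Y s s' r y1 y2 - Y t t' r z1 y2) \<le> \<epsilon>"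
proof -
  define S where "S = {\<delta>..1} \<times> {\<delta>..1} \<times> {0..1::real} \<times> {-1..2::real} \<times> {0..1::real}"
  let ?s = "\<lambda>w::real\<times>real\<times>real\<times>real\<times>real. fst w" and ?s' = "\<lambda>w::real\<times>real\<times>real\<times>real\<times>real. fst (snd w)"
    and ?r = "\<lambda>w::real\<times>real\<times>real\<times>real\<times>real. fst (snd (snd w))"
    and ?y1 = "\<lambda>w::real\<times>real\<times>real\<times>real\<times>real. fst (snd (snd (snd w)))"
    and ?y2 = "\<lambda>w::real\<times>real\<times>real\<times>real\<times>real. snd (snd (snd (snd w)))"
  have "continuous_on S (\<lambda>w. grid_sum F (?s w) (?r w / ?s' w) (?s' w) (- (1 - ?r w) / ?s w) (?y1 w) (?y2 w))"
  proof (rule continuous_on_grid_sum[where F = F and A = A and C = "1 / \<delta> + 2", OF F supp])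
    fix w assume "w \<in> S"
    then have w: "\<delta> \<le> ?s w" "?s w \<le> 1" "\<delta> \<le> ?s' w" "?s' w \<le> 1" "0 \<le> ?r w" "?r w \<le> 1"
      "-1 \<le> ?y1 w" "?y1 w \<le> 2" "0 \<le> ?y2 w" "?y2 w \<le> 1" by (auto simp: S_def)
    have "0 < 1 / \<delta>" using \<delta> by simp
    with w have "\<bar>?y1 w\<bar> \<le> 1 / \<delta> + 2" "\<bar>?y2 w\<bar> \<le> 1 / \<delta> + 2" by linarith+
    with basis_bounds[OF \<delta> w(1-6)]
    show "?s w * (- (1 - ?r w) / ?s w) - ?s' w * (?r w / ?s' w) = - 1 \<and> \<bar>?s w\<bar> \<le> 1 / \<delta> + 2 \<and> \<bar>?r w / ?s' w\<bar> \<le> 1 / \<delta> + 2 \<and>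
      \<bar>?s' w\<bar> \<le> 1 / \<delta> + 2 \<and> \<bar>- (1 - ?r w) / ?s w\<bar> \<le> 1 / \<delta> + 2 \<and> \<bar>?y1 w\<bar> \<le> 1 / \<delta> + 2 \<and> \<bar>?y2 w\<bar> \<le> 1 / \<delta> + 2"
      by blast
  qed (use \<delta> in \<open>auto intro!: continuous_intros simp: S_def\<close>)
  then have "continuous_on S (\<lambda>w. Y (?s w) (?s' w) (?r w) (?y1 w) (?y2 w))"
    unfolding Y_def by (rule continuous_on_compose2[OF U(1)]) auto
  moreover have "compact S" unfolding S_def by (intro compact_Times compact_Icc)
  ultimately have "uniformly_continuous_on S (\<lambda>w. Y (?s w) (?s' w) (?r w) (?y1 w) (?y2 w))"
    by (rule compact_uniformly_continuous)
  then obtain d0 where d0: "0 < d0" "\<And>w w'. w \<in> S \<Longrightarrow> w' \<in> S \<Longrightarrow> dist w' w < d0 \<Longrightarrow>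
     dist (Y (?s w') (?s' w') (?r w') (?y1 w') (?y2 w')) (Y (?s w) (?s' w) (?r w) (?y1 w) (?y2 w)) < \<epsilon>"
    unfolding uniformly_continuous_on_def using \<epsilon> by blast
  show ?thesis
  proof (rule that[of "min 1 (d0 / 3)"])
    show "0 < min 1 (d0 / 3)" using d0 by simp
    fix s s' t t' r y1 z1 y2 :: real
    assume h: "s \<in> {\<delta>..1}" "s' \<in> {\<delta>..1}" "t \<in> {\<delta>..1}" "t' \<in> {\<delta>..1}" "r \<in> {0..1}"
      "\<bar>s - t\<bar> < min 1 (d0 / 3)" "\<bar>s' - t'\<bar> < min 1 (d0 / 3)" "\<bar>y1 - z1\<bar> < min 1 (d0 / 3)"
    define y z v where "y = y1 - of_int \<lfloor>y1\<rfloor>" and "z = z1 - of_int \<lfloor>y1\<rfloor>" and "v = y2 - of_int \<lfloor>y2\<rfloor>"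
    have yv: "0 \<le> y" "y \<le> 1" "0 \<le> v" "v \<le> 1" unfolding y_def v_def by linarith+
    have yz: "y - z = y1 - z1" by (simp add: y_def z_def)
    then have "-1 \<le> z" "z \<le> 2" using h(8) yv by auto
    have "dist (s, s', r, y, v) (t, t', r, z, v) < d0"
    proof -
      have "dist (a, b) (c, e) \<le> dist a c + dist b e" for a c :: real and b e :: "'z::metric_space"
        unfolding dist_Pair_Pair using sqrt_sum_squares_le_sum_abs[of "dist a c" "dist b e"] by simp
      note le = this
      have "dist (y, v) (z, v) \<le> \<bar>y - z\<bar>" using le[of y v z v] by (simp add: dist_real_def)
      then have "dist (r, y, v) (r, z, v) \<le> \<bar>y - z\<bar>" using le[of r "(y, v)" r "(z, v)"] by simp
      then have "dist (s', r, y, v) (t', r, z, v) \<le> \<bar>s' - t'\<bar> + \<bar>y - z\<bar>"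
        using le[of s' "(r, y, v)" t' "(r, z, v)"] by (simp add: dist_real_def)
      then have "dist (s, s', r, y, v) (t, t', r, z, v) \<le> \<bar>s - t\<bar> + \<bar>s' - t'\<bar> + \<bar>y - z\<bar>"
        using le[of s "(s', r, y, v)" t "(t', r, z, v)"] by (simp add: dist_real_def)
      also have "\<dots> < d0" using h(6-8) yz by simp
      finally show ?thesis .
    qed
    moreover have "(s, s', r, y, v) \<in> S" "(t, t', r, z, v) \<in> S"
      using h yv \<open>-1 \<le> z\<close> \<open>z \<le> 2\<close> by (auto simp: S_def)
    ultimately have "dist (Y s s' r y v) (Y t t' r z v) < \<epsilon>"
      using d0(2)[of "(t, t', r, z, v)" "(s, s', r, y, v)"] by simp
    moreover have "Y s s' r y v = Y s s' r y1 y2" "Y t t' r z v = Y t t' r z1 y2"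
      using Y_periodic[of s s' r y "\<lfloor>y1\<rfloor>" v "\<lfloor>y2\<rfloor>"] Y_periodic[of t t' r z "\<lfloor>y1\<rfloor>" v "\<lfloor>y2\<rfloor>"]
      by (simp_all add: y_def z_def v_def)
    ultimately show "norm (Y s s' r y1 y2 - Y t t' r z1 y2) \<le> \<epsilon>" by (simp add: dist_norm)
  qed
qed

abbreviation torus_mean :: "real \<Rightarrow> real \<Rightarrow> real \<Rightarrow> complex" where
  "torus_mean s s' r \<equiv> \<integral>y2. (\<integral>y1. Y s s' r y1 (- y2) \<partial>haar1) \<partial>haar1"

text \<open>The value that \<open>seg\<close> approaches once the closed geodesic has
  equidistributed: the offset is uniform on the torus and independent of r.\<close>

definition mean :: "real \<Rightarrow> real \<Rightarrow> complex" where
  "mean s s' = (\<integral>r. torus_mean s s' r \<partial>haar1)"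

text \<open>Expectation over one Farey arc, normalised by its length; x drives the offset along the
  closed geodesic.\<close>

definition seg :: "nat \<Rightarrow> nat \<Rightarrow> nat \<Rightarrow> complex" where
  "seg N q q' = (\<integral>r. (\<integral>x. Y (real q / real N) (real q' / real N) r (real q' * x) (- (real q * x)) \<partial>haar1) \<partial>haar1)"

context
  fixes s s' :: real
  assumes s: "0 < s" "s \<le> 1" "0 < s'" "s' \<le> 1"
begin

lemma id_haar1 [measurable]: "(\<lambda>x. x) \<in> borel_measurable haar1"
  by (rule measurable_haar1_borel) simp

lemma measurable_Y1:
  "r \<in> {0..1} \<Longrightarrow> (\<lambda>y1. Y s s' r y1 y2) \<in> borel_measurable haar1"
  by (rule measurable_Y[OF s]) auto

lemma fst_haar1: "fst \<in> borel_measurable (haar1 \<Otimes>\<^sub>M M)"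
  and snd_haar1: "snd \<in> borel_measurable (M \<Otimes>\<^sub>M haar1)"
  using measurable_compose[OF measurable_fst id_haar1] measurable_compose[OF measurable_snd id_haar1] by auto

lemma measurable_Y2:
  "r \<in> {0..1} \<Longrightarrow> (\<lambda>y2. \<integral>y1. Y s s' r y1 (- y2) \<partial>haar1) \<in> borel_measurable haar1"
  unfolding case_prod_unfold
  by (rule measurable_haar1_section, unfold case_prod_unfold, rule measurable_Y[OF s])
     (auto intro!: fst_haar1 snd_haar1 borel_measurable_uminus)

lemma measurable_Y3:
  "(\<lambda>r. torus_mean s s' r) \<in> borel_measurable haar1"
proof (rule measurable_haar1_section, unfold case_prod_unfold, rule measurable_haar1_section,
    unfold case_prod_unfold, rule measurable_Y[OF s])
  show "(\<lambda>w. fst (fst w)) \<in> borel_measurable ((haar1 \<Otimes>\<^sub>M haar1) \<Otimes>\<^sub>M haar1)"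
    by (rule measurable_compose[OF measurable_fst fst_haar1])
  show "snd \<in> borel_measurable ((haar1 \<Otimes>\<^sub>M haar1) \<Otimes>\<^sub>M haar1)" by (rule snd_haar1)
  show "(\<lambda>w. - snd (fst w)) \<in> borel_measurable ((haar1 \<Otimes>\<^sub>M haar1) \<Otimes>\<^sub>M haar1)"
    by (intro borel_measurable_uminus measurable_compose[OF measurable_fst snd_haar1])
qed (auto simp: space_pair_measure)

lemma measurable_seg1:
  "r \<in> {0..1} \<Longrightarrow> (\<lambda>x. Y s s' r (c * x) (- (d * x))) \<in> borel_measurable haar1"
  by (rule measurable_Y[OF s]) auto

lemma measurable_seg2:
  "(\<lambda>r. \<integral>x. Y s s' r (c * x) (- (d * x)) \<partial>haar1) \<in> borel_measurable haar1"
proof (rule measurable_haar1_section, unfold case_prod_unfold, rule measurable_Y[OF s])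
  show "fst \<in> borel_measurable (haar1 \<Otimes>\<^sub>M haar1)" by (rule fst_haar1)
  show "(\<lambda>w. c * snd w) \<in> borel_measurable (haar1 \<Otimes>\<^sub>M haar1)" "(\<lambda>w. - (d * snd w)) \<in> borel_measurable (haar1 \<Otimes>\<^sub>M haar1)"
    using snd_haar1[of haar1] by measurable
qed (auto simp: space_pair_measure)

lemma Y_integral_bounds:
  assumes "r \<in> {0..1}"
  shows "norm (\<integral>y1. Y s s' r y1 y2 \<partial>haar1) \<le> 1"
    "norm (torus_mean s s' r) \<le> 1"
    "norm (\<integral>x. Y s s' r (c * x) (- (d * x)) \<partial>haar1) \<le> 1"
proof -
  show 1: "norm (\<integral>y1. Y s s' r y1 y2 \<partial>haar1) \<le> 1" for y2
    by (rule haar1_integral_bound(2)) (auto intro: measurable_Y1 Y_bound assms)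
  show "norm (torus_mean s s' r) \<le> 1"
    by (rule haar1_integral_bound(2)) (auto intro: measurable_Y2 1 assms)
  show "norm (\<integral>x. Y s s' r (c * x) (- (d * x)) \<partial>haar1) \<le> 1"
    by (rule haar1_integral_bound(2)) (auto intro: measurable_seg1 Y_bound assms)
qed

lemma mean_bound: "norm (mean s s') \<le> 1"
  unfolding mean_def by (rule haar1_integral_bound(2)) (auto intro: measurable_Y3 Y_integral_bounds)

end

text \<open>The modulus of continuity of \<open>Y\<close> is uniform in r and in the offset, hence
  survives the three integrations.\<close>

lemma mean_continuous:
  assumes \<delta>: "0 < \<delta>"
  shows "continuous_on ({\<delta>..1} \<times> {\<delta>..1}) (\<lambda>p. mean (fst p) (snd p))"
  unfolding continuous_on_iff
proof (intro ballI allI impI)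
  fix p and e :: real assume p: "p \<in> {\<delta>..1} \<times> {\<delta>..1}" and e: "0 < e"
  then obtain d where d: "0 < d" "\<And>s s' t t' r y1 z1 y2. s \<in> {\<delta>..1} \<Longrightarrow> s' \<in> {\<delta>..1} \<Longrightarrow> t \<in> {\<delta>..1} \<Longrightarrow> t' \<in> {\<delta>..1} \<Longrightarrow>
    r \<in> {0..1} \<Longrightarrow> \<bar>s - t\<bar> < d \<Longrightarrow> \<bar>s' - t'\<bar> < d \<Longrightarrow> \<bar>y1 - z1\<bar> < d \<Longrightarrow> norm (Y s s' r y1 y2 - Y t t' r z1 y2) \<le> e / 2"
    using Y_equicontinuous[OF \<delta>, of "e / 2"] by (auto simp del: atLeastAtMost_iff)
  show "\<exists>d>0. \<forall>x'\<in>{\<delta>..1} \<times> {\<delta>..1}. dist x' p < d \<longrightarrow> dist (mean (fst x') (snd x')) (mean (fst p) (snd p)) < e"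
  proof (intro exI[of _ d] conjI d(1) ballI impI)
    fix p' assume p': "p' \<in> {\<delta>..1} \<times> {\<delta>..1}" "dist p' p < d"
    obtain s s' t t' where st: "p' = (s, s')" "p = (t, t')" by (metis surj_pair)
    have m: "s \<in> {\<delta>..1}" "s' \<in> {\<delta>..1}" "t \<in> {\<delta>..1}" "t' \<in> {\<delta>..1}" using p p' st by auto
    have c: "\<bar>s - t\<bar> < d" "\<bar>s' - t'\<bar> < d"
      using p'(2) dist_fst_le[of p' p] dist_snd_le[of p' p] by (auto simp: st dist_real_def)
    have pos: "0 < s" "s \<le> 1" "0 < s'" "s' \<le> 1" and pos': "0 < t" "t \<le> 1" "0 < t'" "t' \<le> 1"
      using m \<delta> by auto
    have 1: "norm (Y s s' r y1 y2 - Y t t' r y1 y2) \<le> e / 2" if "r \<in> {0..1}" for r y1 y2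
      by (rule d(2)[OF m that c]) (use d(1) in simp)
    have 2: "norm ((\<integral>y1. Y s s' r y1 y2 \<partial>haar1) - (\<integral>y1. Y t t' r y1 y2 \<partial>haar1)) \<le> e / 2" if "r \<in> {0..1}" for r y2
      by (rule haar1_integral_close[OF measurable_Y1[OF pos that] _ measurable_Y1[OF pos' that]])
         (rule Y_bound 1[OF that])+
    have 3: "norm (torus_mean s s' r - torus_mean t t' r) \<le> e / 2"
      if "r \<in> {0..1}" for r
      by (rule haar1_integral_close[OF measurable_Y2[OF pos that] _ measurable_Y2[OF pos' that]])
         (rule Y_integral_bounds(1)[OF pos that] Y_integral_bounds(1)[OF pos' that] 2[OF that])+
    have "norm (mean s s' - mean t t') \<le> e / 2"
      unfolding mean_def
    proof (rule haar1_integral_close[OF measurable_Y3[OF pos] _ measurable_Y3[OF pos']])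
      fix r :: real assume "r \<in> {0<..1}"
      then have r: "r \<in> {0..1}" by simp
      show "norm (torus_mean s s' r) \<le> 1"
        "norm (torus_mean t t' r) \<le> 1"
        by (rule Y_integral_bounds(2)[OF pos r] Y_integral_bounds(2)[OF pos' r])+
      show "norm (torus_mean s s' r - torus_mean t t' r) \<le> e / 2"
        by (rule 3[OF r])
    qed
    then show "dist (mean (fst p') (snd p')) (mean (fst p) (snd p)) < e"
      using e by (simp add: st dist_norm)
  qed
qed

text \<open>On these arcs q > \<delta> N, so for large \<open>N\<close> the spacing 1/q is below the
  modulus of continuity of \<open>Y\<close>, uniformly over the arcs.\<close>

lemma seg_close_mean:
  assumes \<delta>: "0 < \<delta>" and \<epsilon>: "0 < \<epsilon>"
  shows "\<forall>\<^sub>F N in sequentially. \<forall>(q, q')\<in>farey_pairs N. \<delta> * real N < real q \<longrightarrow> \<delta> * real N < real q' \<longrightarrow>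
    norm (seg N q q' - mean (real q / real N) (real q' / real N)) \<le> \<epsilon>"
proof -
  obtain d where d: "0 < d" "\<And>s s' t t' r y1 z1 y2. s \<in> {\<delta>..1} \<Longrightarrow> s' \<in> {\<delta>..1} \<Longrightarrow> t \<in> {\<delta>..1} \<Longrightarrow> t' \<in> {\<delta>..1} \<Longrightarrow>
    r \<in> {0..1} \<Longrightarrow> \<bar>s - t\<bar> < d \<Longrightarrow> \<bar>s' - t'\<bar> < d \<Longrightarrow> \<bar>y1 - z1\<bar> < d \<Longrightarrow> norm (Y s s' r y1 y2 - Y t t' r z1 y2) \<le> \<epsilon>"
    using Y_equicontinuous[OF \<delta> \<epsilon>] by (auto simp del: atLeastAtMost_iff)
  obtain N0 :: nat where N0: "1 / (\<delta> * d) < real N0" using reals_Archimedean2 by blast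
  show ?thesis
  proof (rule eventually_mono[OF eventually_ge_at_top[of "max 1 N0"]], clarify)
    fix N q q' assume N: "max 1 N0 \<le> N" and q: "(q, q') \<in> farey_pairs N" and b: "\<delta> * real N < real q" "\<delta> * real N < real q'"
    have N1: "0 < real N" "1 / (\<delta> * d) < real N" using N N0 by (simp, linarith)
    have qq: "0 < q" "q \<le> N" "0 < q'" "q' \<le> N" "coprime q q'" using q by (auto simp: farey_pairs_def)
    let ?s = "real q / real N" and ?s' = "real q' / real N"
    have s: "0 < ?s" "?s \<le> 1" "0 < ?s'" "?s' \<le> 1" using qq N1 by auto
    have sd: "?s \<in> {\<delta>..1}" "?s' \<in> {\<delta>..1}" using b s N1 by (auto simp: field_simps)
    have "1 < real N * (\<delta> * d)" using N1(2) \<delta> d(1) by (simp add: pos_divide_less_eq)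
    also have "\<dots> \<le> real q * d" using b(1) d(1) by (simp add: mult_ac mult_right_mono)
    finally have qd: "1 / real q < d" using qq by (simp add: divide_less_eq mult.commute)
    show "norm (seg N q q' - mean ?s ?s') \<le> \<epsilon>"
      unfolding seg_def mean_def
    proof (rule haar1_integral_close[OF measurable_seg2[OF s] _ measurable_Y3[OF s]])
      fix r :: real assume r: "r \<in> {0<..1}"
      then have r': "r \<in> {0..1}" by simp
      show "norm (\<integral>x. Y ?s ?s' r (real q' * x) (- (real q * x)) \<partial>haar1) \<le> 1"
        "norm (torus_mean ?s ?s' r) \<le> 1"
        by (rule Y_integral_bounds[OF s r'])+
      show "norm ((\<integral>x. Y ?s ?s' r (real q' * x) (- (real q * x)) \<partial>haar1) -
          torus_mean ?s ?s' r) \<le> \<epsilon>"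
      proof (rule closed_geodesic_average[where p = "Y ?s ?s' r", OF _ Y_bound Y_periodic qq(1,5)])
        show "(\<lambda>(y1, y2). Y ?s ?s' r y1 y2) \<in> borel_measurable (borel \<Otimes>\<^sub>M borel)"
          unfolding case_prod_unfold by (rule measurable_Y[OF s]) (use r' in auto)
        show "norm (Y ?s ?s' r y1 y2 - Y ?s ?s' r z1 y2) \<le> \<epsilon>" if "\<bar>y1 - z1\<bar> \<le> 1 / real q" for y1 z1 y2
          by (rule d(2)) (use sd r' that qd d(1) in auto)
      qed
    qed
  qed
qed

lemma measurable_X:
  assumes N: "0 < N"
  shows "(\<lambda>p. X N (fst p) (snd p)) \<in> borel_measurable (haar1 \<Otimes>\<^sub>M haar1)"
  unfolding X_def
proof (rule measurable_grid_sum[where F = F and A = A and C = "real N + 1", OF F_borel supp])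
  have [measurable]: "fst \<in> borel_measurable (haar1 \<Otimes>\<^sub>M haar1)" "snd \<in> borel_measurable (haar1 \<Otimes>\<^sub>M haar1)"
    using fst_haar1[of 1 1 haar1] snd_haar1[of 1 1 haar1] by auto
  show "(\<lambda>p. real N * fst p) \<in> borel_measurable (haar1 \<Otimes>\<^sub>M haar1)"
    "(\<lambda>p. - snd p) \<in> borel_measurable (haar1 \<Otimes>\<^sub>M haar1)" by measurable
  fix p :: "real \<times> real" assume "p \<in> space (haar1 \<Otimes>\<^sub>M haar1)"
  then have p: "0 < fst p" "fst p \<le> 1" "0 < snd p" "snd p \<le> 1" by (auto simp: space_pair_measure)
  have n: "0 \<le> 1 / real N" "1 / real N \<le> 1" "real N * fst p \<le> real N" "0 \<le> real N * fst p"
    using N p by (auto simp: mult_left_le)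
  have "1 / real N * - real N - 0 * (real N * fst p) = - 1" using N by simp
  moreover have "\<bar>1 / real N\<bar> \<le> real N + 1" "\<bar>real N * fst p\<bar> \<le> real N + 1" "\<bar>0 :: real\<bar> \<le> real N + 1"
    "\<bar>- real N\<bar> \<le> real N + 1" "\<bar>- snd p\<bar> \<le> real N + 1"
    using n p by linarith+
  ultimately show "1 / real N * - real N - 0 * (real N * fst p) = - 1 \<and> \<bar>1 / real N\<bar> \<le> real N + 1 \<and>
    \<bar>real N * fst p\<bar> \<le> real N + 1 \<and> \<bar>0\<bar> \<le> real N + 1 \<and> \<bar>- real N\<bar> \<le> real N + 1 \<and> \<bar>0\<bar> \<le> real N + 1 \<and>
    \<bar>- snd p\<bar> \<le> real N + 1"
    by blast
qed auto

abbreviation EU :: "nat \<Rightarrow> complex" where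
  "EU N \<equiv> \<integral>\<alpha>. (\<integral>x. U (X N \<alpha> x) \<partial>haar1) \<partial>haar1"

text \<open>On each arc \<open>grid_sum_farey\<close> rewrites the grid in the basis of the arc, and
  the integral over \<alpha> becomes one over r.\<close>

lemma farey_representation:
  assumes N: "1 \<le> N"
  shows "EU N = (\<Sum>(q, q')\<in>farey_pairs N. seg N q q' / of_nat (q * q'))"
proof -
  define G where "G \<alpha> = (\<integral>x. U (X N \<alpha> x) \<partial>haar1)" for \<alpha>
  have m: "(\<lambda>p. U (X N (fst p) (snd p))) \<in> borel_measurable (haar1 \<Otimes>\<^sub>M haar1)"
    using measurable_compose[OF measurable_X U_borel] N by simp
  then have Gm: "G \<in> borel_measurable haar1"
    unfolding G_def by (intro measurable_haar1_section) (simp add: case_prod_unfold)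
  have "(\<lambda>x. U (X N \<alpha> x)) \<in> borel_measurable haar1" if "\<alpha> \<in> {0<..1}" for \<alpha>
    using measurable_compose[OF measurable_Pair1' m, of \<alpha>] that by simp
  then have Gb: "norm (G \<alpha>) \<le> 1" if "\<alpha> \<in> {0<..1}" for \<alpha>
    unfolding G_def using that by (intro haar1_integral_bound(2)) (auto simp: U)
  have "(\<integral>\<alpha>. G \<alpha> \<partial>haar1) = (\<Sum>(q, q')\<in>farey_pairs N.
    (\<integral>r. G (farey_point q q' r) \<partial>haar1) / of_nat (q * q'))"
    by (rule farey_integral[OF haar1_integral_bound(1)[OF Gm Gb] N])
  also have "\<dots> = (\<Sum>(q, q')\<in>farey_pairs N. seg N q q' / of_nat (q * q'))"
  proof (rule sum.cong[OF refl], clarify)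
    fix q q' assume "(q, q') \<in> farey_pairs N"
    then have q: "0 < q" "0 < q'" "coprime q q'" by (auto simp: farey_pairs_def)
    obtain p' where p': "p' * int q - farey_num q q' * int q' = 1" using farey_num[OF q(3,1,2)] by metis
    have "G (farey_point q q' r) =
      (\<integral>x. Y (real q / real N) (real q' / real N) r (real q' * x) (- (real q * x)) \<partial>haar1)" for r
      unfolding G_def X_def Y_def using grid_sum_farey[OF q(1,2) _ p' refl, of N] N by simp
    then show "(\<integral>r. G (farey_point q q' r) \<partial>haar1) / of_nat (q * q') =
      seg N q q' / of_nat (q * q')" by (simp add: seg_def)
  qed
  finally show ?thesis by (simp add: G_def)
qed

lemma seg_bound:
  assumes "(q, q') \<in> farey_pairs N"
  shows "norm (seg N q q') \<le> 1"
proof -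
  have q: "0 < real q / real N" "real q / real N \<le> 1" "0 < real q' / real N" "real q' / real N \<le> 1"
    using assms by (auto simp: farey_pairs_def)
  show ?thesis unfolding seg_def
    by (rule haar1_integral_bound(2)) (auto intro: measurable_seg2[OF q] Y_integral_bounds[OF q])
qed

text \<open>With s = q/N and s' = q'/N the weight 1/(q q') equals N^(-2) / (s s'), and N < q + q'
  becomes 1 < s + s'. The sum is thus a Riemann sum over coprime pairs for \<open>mean s s'\<close>
  divided by s s', cut off at \<delta> to keep the integrand bounded.\<close>

lemma farey_main_part_convergent:
  assumes \<delta>: "0 < \<delta>" "\<delta> < 1"
  shows "convergent (\<lambda>N. \<Sum>(q, q')\<in>{x \<in> farey_pairs N. \<delta> * real N < real (fst x) \<and> \<delta> * real N < real (snd x)}.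
    mean (real q / real N) (real q' / real N) / of_nat (q * q'))"
proof -
  define S :: "(real \<times> real) set" where "S = {p. \<delta> < fst p \<and> \<delta> < snd p \<and> fst p \<le> 1 \<and> snd p \<le> 1 \<and> 1 < fst p + snd p}"
  define k where "k p = mean (fst p) (snd p) / of_real (fst p * snd p)" for p
  define h where "h p = (if p \<in> S then k p else 0)" for p
  have S_sub: "S \<subseteq> {\<delta>..1} \<times> {\<delta>..1}" by (auto simp: S_def)
  have "continuous_on ({\<delta>..1} \<times> {\<delta>..1}) k"
    unfolding k_def using \<delta> by (intro continuous_intros mean_continuous) auto
  then have kS: "continuous_on S k" by (rule continuous_on_subset) (rule S_sub)
  have S_borel: "S \<in> sets borel"
  proof -
    have "S = {p. \<delta> < fst p} \<inter> {p. \<delta> < snd p} \<inter> {p. fst p \<le> 1} \<inter> {p. snd p \<le> 1} \<inter> {p. 1 < fst p + snd p}"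
      by (auto simp: S_def)
    also have "\<dots> \<in> sets borel"
      by (intro sets.Int borel_open borel_closed open_Collect_less closed_Collect_le continuous_intros)
    finally show ?thesis .
  qed
  have hm: "h \<in> borel_measurable borel"
    unfolding h_def using S_borel kS by (rule borel_measurable_continuous_on_if) auto
  have hb: "norm (h p) \<le> 1 / (\<delta> * \<delta>)" for p
  proof (cases "p \<in> S")
    case True
    then have p: "\<delta> < fst p" "\<delta> < snd p" "fst p \<le> 1" "snd p \<le> 1" by (auto simp: S_def)
    have "norm (mean (fst p) (snd p)) \<le> 1" using p \<delta> by (intro mean_bound) auto
    moreover have "\<delta> * \<delta> \<le> fst p * snd p" using p \<delta> by (intro mult_mono) auto
    ultimately have "norm (mean (fst p) (snd p)) / (fst p * snd p) \<le> 1 / (\<delta> * \<delta>)"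
      using p \<delta> by (intro frac_le) auto
    then show ?thesis using True p \<delta> by (simp add: h_def k_def norm_divide norm_mult)
  next
    case False
    then show ?thesis using \<delta> by (simp add: h_def)
  qed
  have hc: "AE p in haar2. isCont h p"
    using AE_haar2_neq_line[of \<delta> 1] AE_haar2_neq_line[of 1 1]
  proof eventually_elim
    case (elim p)
    define O1 :: "(real \<times> real) set" where "O1 = {p. \<delta> < fst p} \<inter> {p. \<delta> < snd p} \<inter> {p. fst p < 1} \<inter> {p. snd p < 1} \<inter> {p. 1 < fst p + snd p}"
    define O2 :: "(real \<times> real) set" where "O2 = {p. fst p < \<delta>} \<union> {p. snd p < \<delta>} \<union> {p. 1 < fst p} \<union> {p. 1 < snd p} \<union> {p. fst p + snd p < 1}"
    have o1: "open O1" unfolding O1_def by (intro open_Int open_Collect_less continuous_intros)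
    have o2: "open O2" unfolding O2_def by (intro open_Un open_Collect_less continuous_intros)
    have "O1 \<subseteq> S" by (auto simp: O1_def S_def)
    then have "continuous_on O1 k" by (rule continuous_on_subset[OF kS])
    then have c1: "continuous_on O1 h"
      by (rule continuous_on_cong[THEN iffD1, OF refl, rotated]) (use \<open>O1 \<subseteq> S\<close> in \<open>auto simp: h_def\<close>)
    have "continuous_on O2 (\<lambda>_. 0 :: complex)" by simp
    then have c2: "continuous_on O2 h"
      by (rule continuous_on_cong[THEN iffD1, OF refl, rotated]) (auto simp: h_def S_def O2_def)
    have "p \<in> O1 \<or> p \<in> O2" using elim by (auto simp: O1_def O2_def)
    then show ?case using c1 c2 o1 o2 by (auto simp: continuous_on_eq_continuous_at)
  qed
  have "convergent (\<lambda>N. pair_sum coprime h N / of_nat (N * N))"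
    by (rule coprime_Riemann_sum[OF hb hm hc]) (auto simp: h_def S_def)
  moreover have "\<forall>\<^sub>F N in sequentially. pair_sum coprime h N / of_nat (N * N) =
    (\<Sum>(q, q')\<in>{x \<in> farey_pairs N. \<delta> * real N < real (fst x) \<and> \<delta> * real N < real (snd x)}.
    mean (real q / real N) (real q' / real N) / of_nat (q * q'))"
  proof (rule eventually_mono[OF eventually_gt_at_top[of 0]])
    fix N :: nat assume N: "0 < N"
    let ?T = "{x \<in> farey_pairs N. \<delta> * real N < real (fst x) \<and> \<delta> * real N < real (snd x)}"
    let ?f = "\<lambda>(q, q'). if coprime q q' then h (real q / real N, real q' / real N) else 0"
    have "pair_sum coprime h N = (\<Sum>x\<in>{1..N} \<times> {1..N}. ?f x)"
      by (simp add: sum.cartesian_product)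
    also have "\<dots> = (\<Sum>x\<in>?T. ?f x)"
    proof (rule sum.mono_neutral_right)
      show "?T \<subseteq> {1..N} \<times> {1..N}" by (auto simp: farey_pairs_def)
      show "\<forall>i\<in>{1..N} \<times> {1..N} - ?T. ?f i = 0"
      proof
        fix x assume x: "x \<in> {1..N} \<times> {1..N} - ?T"
        obtain q q' where xq: "x = (q, q')" by (cases x)
        have q: "q \<in> {1..N}" "q' \<in> {1..N}" and nT: "(q, q') \<notin> ?T" using x by (auto simp: xq)
        show "?f x = 0"
        proof (rule ccontr)
          assume "?f x \<noteq> 0"
          then have "?f (q, q') \<noteq> 0" by (simp add: xq)
          then have c: "coprime q q'" and "(real q / real N, real q' / real N) \<in> S"
            by (auto simp: h_def split: if_splits)
          then have "\<delta> < real q / real N" "\<delta> < real q' / real N" "1 < (real q + real q') / real N"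
            by (auto simp: S_def add_divide_distrib)
          then have "\<delta> * real N < real q" "\<delta> * real N < real q'" "real N < real (q + q')"
            using N by (simp_all add: pos_less_divide_eq)
          then have "(q, q') \<in> ?T" using q c by (auto simp: farey_pairs_def simp flip: of_nat_add)
          with nT show False by simp
        qed
      qed
    qed simp
    finally have "pair_sum coprime h N / of_nat (N * N) =
      (\<Sum>x\<in>?T. ?f x / of_nat (N * N))" by (simp add: sum_divide_distrib)
    also have "\<dots> = (\<Sum>(q, q')\<in>?T. mean (real q / real N) (real q' / real N) / of_nat (q * q'))"
    proof (rule sum.cong[OF refl])
      fix x assume x: "x \<in> ?T"
      obtain q q' where xq: "x = (q, q')" by (cases x)
      have q: "(q, q') \<in> farey_pairs N" "\<delta> * real N < real q" "\<delta> * real N < real q'" using x by (auto simp: xq)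
      then have qq: "0 < q" "q \<le> N" "0 < q'" "q' \<le> N" "N < q + q'" "coprime q q'" by (auto simp: farey_pairs_def)
      have "real N < real q + real q'" using qq by linarith
      then have "1 < real q / real N + real q' / real N" using N by (simp add: field_simps)
      then have "(real q / real N, real q' / real N) \<in> S"
        using q qq N by (auto simp: S_def pos_less_divide_eq)
      then have "h (real q / real N, real q' / real N) = mean (real q / real N) (real q' / real N) * of_nat (N * N) / of_nat (q * q')"
        by (simp add: h_def k_def)
      then show "?f x / of_nat (N * N) = (\<lambda>(q, q'). mean (real q / real N) (real q' / real N) / of_nat (q * q')) x"
        using qq N by (simp add: xq)
    qed
    finally show "pair_sum coprime h N / of_nat (N * N) =
      (\<Sum>(q, q')\<in>?T. mean (real q / real N) (real q' / real N) / of_nat (q * q'))" .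
  qed
  ultimately show ?thesis
    unfolding convergent_def by (blast intro: Lim_transform_eventually)
qed

text \<open>Arcs with q or q' at most \<delta> N have total length at most 4 \<delta>, and there
  \<open>seg\<close> is bounded by 1. On all others \<open>seg\<close> is eventually within
  \<epsilon> / 2 of \<open>mean\<close>, while the weights of all arcs add up to 1.\<close>

theorem grid_functional_convergent:
  "convergent (\<lambda>N. \<integral>\<alpha>. (\<integral>x. U (X N \<alpha> x) \<partial>haar1) \<partial>haar1)"
proof (rule convergent_approx)
  fix \<epsilon> :: real assume \<epsilon>: "0 < \<epsilon>"
  define \<delta> where "\<delta> = min (1 / 2) (\<epsilon> / 8)"
  have \<delta>: "0 < \<delta>" "\<delta> \<le> 1 / 2" "4 * \<delta> \<le> \<epsilon> / 2" using \<epsilon> by (auto simp: \<delta>_def)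
  define T where "T N = {x \<in> farey_pairs N. \<delta> * real N < real (fst x) \<and> \<delta> * real N < real (snd x)}" for N
  define u where "u N = (\<Sum>(q, q')\<in>T N. mean (real q / real N) (real q' / real N) / of_nat (q * q'))" for N
  have "convergent u" unfolding u_def T_def by (rule farey_main_part_convergent) (use \<delta> in auto)
  moreover have "\<forall>\<^sub>F N in sequentially. norm (EU N - u N) \<le> \<epsilon>"
    using seg_close_mean[OF \<delta>(1) half_gt_zero[OF \<epsilon>]] eventually_ge_at_top[of 1]
  proof eventually_elim
    case (elim N)
    let ?w = "\<lambda>(q, q'). 1 / real (q * q')"
    let ?E1 = "{x \<in> farey_pairs N. real (fst x) \<le> \<delta> * real N}" and ?E2 = "{x \<in> farey_pairs N. real (snd x) \<le> \<delta> * real N}"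
    have w0: "0 \<le> ?w x" for x by (auto simp: case_prod_unfold)
    have E2: "sum ?w ?E2 \<le> 2 * \<delta>"
    proof -
      have "sum ?w ?E2 = sum ?w ?E1"
        by (rule sum.reindex_bij_witness[where i = prod.swap and j = prod.swap]) (auto simp: farey_pairs_swap mult.commute)
      then show ?thesis using farey_pairs_small[OF \<delta>(1,2) elim(2)] by simp
    qed
    have T: "T N \<subseteq> farey_pairs N" by (auto simp: T_def)
    have rest: "farey_pairs N - T N \<subseteq> ?E1 \<union> ?E2" by (auto simp: T_def)
    have "EU N =
      (\<Sum>(q, q')\<in>farey_pairs N - T N. seg N q q' / of_nat (q * q')) + (\<Sum>(q, q')\<in>T N. seg N q q' / of_nat (q * q'))"
      unfolding farey_representation[OF elim(2)] by (rule sum.subset_diff[OF T]) simp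
    then have "EU N - u N =
      (\<Sum>(q, q')\<in>farey_pairs N - T N. seg N q q' / of_nat (q * q')) +
      (\<Sum>(q, q')\<in>T N. (seg N q q' - mean (real q / real N) (real q' / real N)) / of_nat (q * q'))"
      by (simp add: u_def case_prod_unfold diff_divide_distrib sum_subtractf)
    also have "norm \<dots> \<le> (\<Sum>x\<in>farey_pairs N - T N. ?w x) + (\<Sum>x\<in>T N. \<epsilon> / 2 * ?w x)"
    proof (rule norm_triangle_mono)
      show "norm (\<Sum>(q, q')\<in>farey_pairs N - T N. seg N q q' / of_nat (q * q')) \<le> (\<Sum>x\<in>farey_pairs N - T N. ?w x)"
        by (rule sum_norm_le) (auto simp: norm_divide norm_mult divide_right_mono seg_bound)
      show "norm (\<Sum>(q, q')\<in>T N. (seg N q q' - mean (real q / real N) (real q' / real N)) / of_nat (q * q')) \<le> (\<Sum>x\<in>T N. \<epsilon> / 2 * ?w x)"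
      proof (rule sum_norm_le, clarify)
        fix q q' assume "(q, q') \<in> T N"
        then have "norm (seg N q q' - mean (real q / real N) (real q' / real N)) \<le> \<epsilon> / 2"
          using elim(1) by (auto simp: T_def)
        then have "norm (seg N q q' - mean (real q / real N) (real q' / real N)) / real (q * q') \<le> \<epsilon> / 2 / real (q * q')"
          by (rule divide_right_mono) simp
        then show "norm ((seg N q q' - mean (real q / real N) (real q' / real N)) / of_nat (q * q')) \<le> \<epsilon> / 2 * (1 / real (q * q'))"
          by (simp add: norm_divide norm_mult)
      qed
    qed
    also have "(\<Sum>x\<in>farey_pairs N - T N. ?w x) \<le> sum ?w ?E1 + sum ?w ?E2"
    proof -
      have "(\<Sum>x\<in>farey_pairs N - T N. ?w x) \<le> sum ?w (?E1 \<union> ?E2)"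
        by (rule sum_mono2[OF _ rest]) (use w0 in auto)
      also have "\<dots> \<le> sum ?w ?E1 + sum ?w ?E2"
        using sum.union_inter[of ?E1 ?E2 ?w] sum_nonneg[of "?E1 \<inter> ?E2" ?w] w0 by simp
      finally show ?thesis .
    qed
    also have "sum ?w ?E1 + sum ?w ?E2 \<le> 2 * \<delta> + 2 * \<delta>"
      by (intro add_mono E2 farey_pairs_small[OF \<delta>(1,2) elim(2)])
    also have "(\<Sum>x\<in>T N. \<epsilon> / 2 * ?w x) \<le> \<epsilon> / 2 * (\<Sum>x\<in>farey_pairs N. ?w x)"
      unfolding sum_distrib_left[symmetric]
      by (intro mult_left_mono sum_mono2[OF _ T]) (use w0 \<epsilon> in auto)
    also have "(\<Sum>x\<in>farey_pairs N. ?w x) = 1" by (rule sum_farey_pairs[OF elim(2)])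
    finally show ?case using \<delta> by simp
  qed
  ultimately show "\<exists>u. convergent u \<and> (\<forall>\<^sub>F N in sequentially. norm (EU N - u N) \<le> \<epsilon>)"
    by blast
qed

end

section \<open>Tightness\<close>

lemma haar1_translate:
  assumes B: "B \<in> sets borel"
  shows "measure haar1 {x \<in> {0<..1}. circle_rep (x + c) \<in> B} = measure haar1 ({0<..1} \<inter> B)"
proof -
  interpret prob_space haar1 by (rule prob_space_haar1)
  define f :: "real \<Rightarrow> complex" where "f x = indicator B (circle_rep x)" for x
  have f: "f \<in> borel_measurable borel" unfolding f_def using B by measurable
  have "(\<integral>x. f (x + c) \<partial>haar1) = (\<integral>x. f x \<partial>haar1)"
    by (rule integral_haar1_shift[OF f, where K = 1]) (auto simp: f_def indicator_def)
  moreover have "(\<integral>x. f x \<partial>haar1) = of_real (measure haar1 ({0<..1} \<inter> B))"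
  proof -
    have "(\<integral>x. f x \<partial>haar1) = (\<integral>x. of_real (indicator ({0<..1} \<inter> B) x) \<partial>haar1)"
      by (rule Bochner_Integration.integral_cong) (auto simp: f_def circle_rep_eqI indicator_def)
    then show ?thesis using haar1_Int_in_sets[OF B] by (simp add: sets.Int_space_eq2 del: space_haar1)
  qed
  moreover have "(\<integral>x. f (x + c) \<partial>haar1) = of_real (measure haar1 {x \<in> {0<..1}. circle_rep (x + c) \<in> B})"
  proof -
    let ?C = "{0<..1} \<inter> {x. circle_rep (x + c) \<in> B}"
    have "{x. circle_rep (x + c) \<in> B} \<in> sets borel"
      using measurable_sets[of "\<lambda>x. circle_rep (x + c)" borel borel B] B by (simp add: vimage_def)
    then have C: "?C \<in> sets haar1" by (rule haar1_Int_in_sets)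
    have "(\<integral>x. f (x + c) \<partial>haar1) = (\<integral>x. of_real (indicator ?C x) \<partial>haar1)"
      by (rule Bochner_Integration.integral_cong) (auto simp: f_def indicator_def)
    also have "\<dots> = of_real (measure haar1 ?C)"
      using C by (simp add: sets.Int_space_eq2 del: space_haar1)
    also have "?C = {x \<in> {0<..1}. circle_rep (x + c) \<in> B}" by auto
    finally show ?thesis .
  qed
  ultimately show ?thesis by simp
qed

lemma fst_haar2 [measurable]: "fst \<in> borel_measurable haar2"
  and snd_haar2 [measurable]: "snd \<in> borel_measurable haar2"
  by (rule measurable_haar2_borel; simp add: borel_prod[symmetric])+

text \<open>For fixed \<alpha> the point x + j \<alpha> is uniform on the circle, so Fubini gives
  exactly \<open>w\<close>. Negative j occur among the times at the edge of the window.\<close>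

lemma haar2_visit:
  assumes w: "0 \<le> w" "w \<le> 1"
  shows "{p \<in> {0<..1} \<times> {0<..1}. circle_rep (snd p + of_int j * fst p) \<le> w} \<in> sets haar2"
    "measure haar2 {p \<in> {0<..1} \<times> {0<..1}. circle_rep (snd p + of_int j * fst p) \<le> w} = w"
proof -
  interpret H: prob_space haar1 by (rule prob_space_haar1)
  interpret H2: prob_space haar2 by (rule prob_space_haar2)
  interpret pair_prob_space haar1 haar1 ..
  let ?V = "{p \<in> {0<..1} \<times> {0<..1}. circle_rep (snd p + of_int j * fst p) \<le> w}"
  have "{p \<in> space haar2. circle_rep (snd p + of_int j * fst p) \<le> w} \<in> sets haar2"
    by measurable
  then show V: "?V \<in> sets haar2" by simp
  have V': "?V \<in> sets (haar1 \<Otimes>\<^sub>M haar1)" using V by (simp add: haar2_def)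
  have "emeasure haar2 ?V = (\<integral>\<^sup>+\<alpha>. emeasure haar1 (Pair \<alpha> -` ?V) \<partial>haar1)"
    unfolding haar2_def by (rule H.emeasure_pair_measure_alt[OF V'])
  also have "\<dots> = (\<integral>\<^sup>+\<alpha>. ennreal w \<partial>haar1)"
  proof (rule nn_integral_cong)
    fix \<alpha> assume \<alpha>: "\<alpha> \<in> space haar1"
    have "Pair \<alpha> -` ?V = {x \<in> {0<..1}. circle_rep (x + of_int j * \<alpha>) \<in> {..w}}" using \<alpha> by auto
    then have "measure haar1 (Pair \<alpha> -` ?V) = measure haar1 ({0<..1} \<inter> {..w})"
      using haar1_translate[of "{..w}"] by simp
    also have "{0<..1} \<inter> {..w} = {0<..w}" using w by auto
    also have "measure haar1 {0<..w} = w" using measure_haar1_Ioc[of 0 w] w by simp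
    finally show "emeasure haar1 (Pair \<alpha> -` ?V) = ennreal w" by (simp add: H.emeasure_eq_measure)
  qed
  also have "\<dots> = ennreal w" using H.emeasure_space_1 by simp
  finally show "measure haar2 ?V = w" using w by (simp add: measure_def)
qed

definition normalized_sum :: "real \<Rightarrow> nat \<Rightarrow> real \<times> real \<Rightarrow> real" where
  "normalized_sum a N p = birkhoff_sum a (fst p) (snd p) N / real N powr a"

abbreviation sum_law :: "real \<Rightarrow> nat \<Rightarrow> real measure" where
  "sum_law a N \<equiv> distr haar2 borel (normalized_sum a N)"

lemma normalized_sum_measurable [measurable]: "normalized_sum a N \<in> borel_measurable haar2"
  unfolding normalized_sum_def birkhoff_sum_def phi_def by measurable

lemma good_set:
  fixes a c :: real
  assumes a: "0 < a" "a < 1" and c: "0 < c" "c \<le> 1" and N: "0 < N"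
  obtains E where "E \<in> sets haar2" "measure haar2 E \<le> 4 * c * (2 + a) / a"
    "\<And>p. p \<in> {0<..1} \<times> {0<..1} - E \<Longrightarrow> diophantine c (a / (2 + a)) N (fst p)"
proof -
  have "0 < a / (2 + a)" "a / (2 + a) < 1" using a by auto
  from diophantine_measure[OF c this N] obtain E where E: "E \<in> sets haar1" "measure haar1 E \<le> 4 * c / (a / (2 + a))"
    "\<And>\<alpha>. \<alpha> \<in> {0<..1} - E \<Longrightarrow> diophantine c (a / (2 + a)) N \<alpha>" by metis
  interpret H: prob_space haar1 by (rule prob_space_haar1)
  have I: "{0<..1} \<in> sets haar1" using sets.top[of haar1] by simp
  show ?thesis
  proof (rule that[of "E \<times> {0<..1}"])
    show "E \<times> {0<..1} \<in> sets haar2" using E(1) I by (simp add: haar2_def)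
    show "measure haar2 (E \<times> {0<..1}) \<le> 4 * c * (2 + a) / a"
      using E(2) measure_haar2_Times[OF E(1) I] H.prob_space by simp
    show "diophantine c (a / (2 + a)) N (fst p)" if "p \<in> {0<..1} \<times> {0<..1} - E \<times> {0<..1}" for p
      using that by (intro E(3)) auto
  qed
qed

lemma trunc_pow_nonneg: "0 < a \<Longrightarrow> 0 \<le> trunc_pow a R t"
  by (auto simp: trunc_pow_def intro!: powr_mono2')

text \<open>Two events are discarded, each of probability at most \<epsilon> / 4: an exceptional
  angle, and a visit within d/N of the singularity. Otherwise the truncation at R = 1 leaves a sum
  with at most K + 1 nonzero terms, each in [0, d^(-a)].\<close>

lemma tight_normalized_sum:
  assumes a: "0 < a" "a < 1"
  shows "tight (sum_law a)"
  unfolding tight_def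
proof (intro conjI allI impI)
  interpret H2: prob_space haar2 by (rule prob_space_haar2)
  show "real_distribution (sum_law a N)" for N by simp
  fix \<epsilon> :: real assume \<epsilon>: "0 < \<epsilon>"
  define c where "c = min 1 (\<epsilon> * a / (16 * (2 + a)))"
  have c: "0 < c" "c \<le> 1" using \<epsilon> a by (auto simp: c_def)
  have c\<epsilon>: "4 * c * (2 + a) / a \<le> \<epsilon> / 4"
  proof -
    have "c \<le> \<epsilon> * a / (16 * (2 + a))" by (simp add: c_def)
    then show ?thesis using a by (simp add: field_simps)
  qed
  define K where "K = 3 * c powr (- 1 - a / 2) * (4 / (a * ln 2) + 1) + 1 / c + 1"
  have K: "0 \<le> K" unfolding K_def using a c by (intro add_nonneg_nonneg mult_nonneg_nonneg divide_nonneg_nonneg) auto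
  \<comment> \<open>The N visits have probability d/N each, so their union costs at most d.\<close>
  define d where "d = min 1 (\<epsilon> / 4)"
  have d: "0 < d" "d \<le> 1" "d \<le> \<epsilon> / 4" using \<epsilon> by (auto simp: d_def)
  \<comment> \<open>The truncation error 4K at R = 1, the centring constant a/(1-a), and the bound
    for the truncated sum.\<close>
  define M where "M = 4 * K + a / (1 - a) + d powr (- a) * (K + 1)"
  have M0: "0 \<le> M" unfolding M_def using K a by (intro add_nonneg_nonneg mult_nonneg_nonneg divide_nonneg_nonneg) auto
  show "\<exists>u v. u < v \<and> (\<forall>N. 1 - \<epsilon> < measure (sum_law a N) {u<..v})"
  proof (intro exI conjI allI)
    \<comment> \<open>The extra 1 is there because the interval is open on the left.\<close>
    show "- M - 1 < M" using M0 by simp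
    fix N :: nat
    have eq: "measure (sum_law a N) {- M - 1<..M} = measure haar2 (normalized_sum a N -` {- M - 1<..M} \<inter> space haar2)"
      by (rule measure_distr) auto
    show "1 - \<epsilon> < measure (sum_law a N) {- M - 1<..M}"
    proof (cases "N = 0")
      case True
      then have "normalized_sum a N -` {- M - 1<..M} \<inter> space haar2 = space haar2"
        using M0 by (auto simp: normalized_sum_def birkhoff_sum_def)
      then show ?thesis unfolding eq using \<epsilon> H2.prob_space by simp
    next
      case False
      then have N: "0 < N" by simp
      obtain E where E: "E \<in> sets haar2" "measure haar2 E \<le> 4 * c * (2 + a) / a"
        "\<And>p. p \<in> {0<..1} \<times> {0<..1} - E \<Longrightarrow> diophantine c (a / (2 + a)) N (fst p)"
        using good_set[OF a c N] by metis
      define w where "w = d / real N"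
      have w: "0 \<le> w" "w \<le> 1" using d N by (auto simp: w_def divide_le_eq)
      define V where "V n = {p \<in> {0<..1} \<times> {0<..1}. circle_rep (snd p + of_int (int n) * fst p) \<le> w}" for n
      note Vs = haar2_visit(1)[OF w, of "int _", folded V_def] and Vm = haar2_visit(2)[OF w, of "int _", folded V_def]
      define B where "B = E \<union> (\<Union>n<N. V n)"
      have B: "B \<in> sets haar2" unfolding B_def using E(1) Vs by auto
      have "measure haar2 B \<le> measure haar2 E + measure haar2 (\<Union>n<N. V n)"
        unfolding B_def by (rule measure_Un_le) (use E(1) Vs in auto)
      also have "measure haar2 (\<Union>n<N. V n) \<le> (\<Sum>n<N. measure haar2 (V n))"
        by (rule measure_UNION_le) (use Vs in auto)
      also have "\<dots> = d" using N by (simp add: Vm w_def)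
      finally have "measure haar2 B \<le> \<epsilon> / 2" using E(2) c\<epsilon> d by linarith
      moreover have "space haar2 - B \<subseteq> normalized_sum a N -` {- M - 1<..M} \<inter> space haar2"
      proof
        fix p assume p: "p \<in> space haar2 - B"
        define \<alpha> x where "\<alpha> = fst p" and "x = snd p"
        have p01: "p \<in> {0<..1} \<times> {0<..1} - E" using p by (auto simp: B_def)
        have disc: "\<bar>real (hits \<alpha> x (t / real N) N) - t\<bar> \<le> K * t powr (3 * a / 4)" if "1 \<le> t" "t \<le> real N" for t
          unfolding K_def by (rule hits_discrepancy[OF a c N that]) (use E(3)[OF p01] in \<open>simp add: \<alpha>_def\<close>)
        let ?S = "\<Sum>n<N. trunc_pow a 1 (real N * orbit \<alpha> x n)"
        have "\<bar>birkhoff_sum a \<alpha> x N / real N powr a - (?S - a * 1 powr (1 - a) / (1 - a))\<bar> \<le> 4 * K * 1 powr (- a / 4)"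
          by (rule birkhoff_sum_truncation[OF a _ _ disc]) (use N in auto)
        then have 1: "\<bar>normalized_sum a N p - (?S - a / (1 - a))\<bar> \<le> 4 * K"
          by (simp add: normalized_sum_def \<alpha>_def x_def)
        have "?S \<le> (\<Sum>n<N. if orbit \<alpha> x n \<le> 1 / real N then d powr (- a) else 0)"
        proof (rule sum_mono)
          fix n assume n: "n \<in> {..<N}"
          have "p \<notin> V n" using p n by (auto simp: B_def)
          then have "w < orbit \<alpha> x n" using p01 by (auto simp: V_def \<alpha>_def x_def)
          then have "d < real N * orbit \<alpha> x n" using N by (simp add: w_def divide_less_eq mult.commute)
          then have "(real N * orbit \<alpha> x n) powr (- a) \<le> d powr (- a)"
            using d a by (intro powr_mono2') auto
          moreover have "real N * orbit \<alpha> x n \<le> 1 \<longleftrightarrow> orbit \<alpha> x n \<le> 1 / real N"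
            using N by (simp add: le_divide_eq mult.commute)
          ultimately show "trunc_pow a 1 (real N * orbit \<alpha> x n) \<le> (if orbit \<alpha> x n \<le> 1 / real N then d powr (- a) else 0)"
            by (auto simp: trunc_pow_def)
        qed
        also have "\<dots> = d powr (- a) * real (hits \<alpha> x (1 / real N) N)"
          by (simp add: sum.If_cases Int_def hits_def)
        also have "\<dots> \<le> d powr (- a) * (K + 1)"
        proof (rule mult_left_mono)
          show "real (hits \<alpha> x (1 / real N) N) \<le> K + 1" using disc[of 1] N by simp
        qed simp
        finally have 2: "?S \<le> d powr (- a) * (K + 1)" .
        have 3: "0 \<le> ?S" by (intro sum_nonneg trunc_pow_nonneg a)
        have 4: "0 \<le> d powr (- a) * (K + 1)" "0 \<le> a / (1 - a)" using K a by auto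
        have "- M - 1 < normalized_sum a N p \<and> normalized_sum a N p \<le> M"
          using 1 2 3 4 unfolding M_def by linarith
        then show "p \<in> normalized_sum a N -` {- M - 1<..M} \<inter> space haar2" using p by auto
      qed
      then have "measure haar2 (space haar2 - B) \<le> measure haar2 (normalized_sum a N -` {- M - 1<..M} \<inter> space haar2)"
        by (rule H2.finite_measure_mono) (rule measurable_sets[OF normalized_sum_measurable], simp)
      moreover have "measure haar2 (space haar2 - B) = 1 - measure haar2 B" by (rule H2.prob_compl[OF B])
      ultimately show ?thesis unfolding eq using \<epsilon> by linarith
    qed
  qed
qed

section \<open>Convergence of characteristic functions\<close>

text \<open>Trapezoid in place of the indicator of [0,1], since the convergence theorem for grid
  sums asks for a continuous test function.\<close>

definition window :: "real \<Rightarrow> real \<Rightarrow> real" where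
  "window \<epsilon> s = max 0 (min 1 (min (1 + s / \<epsilon>) (1 + (1 - s) / \<epsilon>)))"

text \<open>Continuous replacement of \<open>trunc_pow\<close>: the first factor is a ramp rising
  between \<epsilon> and 2 \<epsilon> that removes the singularity, and
  \<open>max t \<epsilon>\<close> keeps the power bounded. From 2 \<epsilon> on the two functions
  agree.\<close>

definition soft_pow :: "real \<Rightarrow> real \<Rightarrow> real \<Rightarrow> real \<Rightarrow> real" where
  "soft_pow a R \<epsilon> t = max 0 (min 1 (t / \<epsilon> - 1)) * max 0 (max t \<epsilon> powr (- a) - R powr (- a))"

definition test_fun :: "real \<Rightarrow> real \<Rightarrow> real \<Rightarrow> real \<times> real \<Rightarrow> real" where
  "test_fun a R \<epsilon> p = window \<epsilon> (fst p) * soft_pow a R \<epsilon> (snd p)"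

lemma window_inside: "0 < \<epsilon> \<Longrightarrow> 0 \<le> s \<Longrightarrow> s \<le> 1 \<Longrightarrow> window \<epsilon> s = 1"
  by (simp add: window_def)

lemma window_outside:
  assumes "0 < \<epsilon>" "s \<le> - \<epsilon> \<or> 1 + \<epsilon> \<le> s"
  shows "window \<epsilon> s = 0"
  using assms(2)
proof
  assume "s \<le> - \<epsilon>"
  then have "1 + s / \<epsilon> \<le> 0" using assms(1) by (simp add: field_simps)
  then show ?thesis by (simp add: window_def)
next
  assume "1 + \<epsilon> \<le> s"
  then have "1 + (1 - s) / \<epsilon> \<le> 0" using assms(1) by (simp add: field_simps)
  then show ?thesis by (simp add: window_def)
qed

lemma soft_pow_outside:
  assumes "0 < \<epsilon>" "0 < a" "0 < R" "t \<le> 0 \<or> R \<le> t"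
  shows "soft_pow a R \<epsilon> t = 0"
  using assms(4)
proof
  assume "t \<le> 0"
  then have "t / \<epsilon> - 1 \<le> 0" using assms(1) by (simp add: field_simps)
  then show ?thesis by (simp add: soft_pow_def)
next
  assume "R \<le> t"
  then have "max t \<epsilon> powr (- a) \<le> R powr (- a)" using assms by (intro powr_mono2') auto
  then show ?thesis by (simp add: soft_pow_def)
qed

lemma soft_pow_eq_trunc_pow:
  assumes "0 < \<epsilon>" "0 < a" "0 < R" "2 * \<epsilon> \<le> t"
  shows "soft_pow a R \<epsilon> t = trunc_pow a R t"
proof (cases "R \<le> t")
  case True
  then show ?thesis using soft_pow_outside[of \<epsilon> a R t] assms by (auto simp: trunc_pow_def)
next
  case False
  have "1 \<le> t / \<epsilon> - 1" using assms by (simp add: field_simps)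
  moreover have "R powr (- a) \<le> t powr (- a)" using False assms by (intro powr_mono2') auto
  ultimately show ?thesis using False assms by (simp add: soft_pow_def trunc_pow_def max_def)
qed

lemma continuous_on_test_fun:
  assumes "0 < \<epsilon>"
  shows "continuous_on UNIV (test_fun a R \<epsilon>)"
  unfolding test_fun_def window_def soft_pow_def
  using assms by (intro continuous_intros) (auto simp: max_def)

lemma test_fun_support:
  assumes "0 < \<epsilon>" "\<epsilon> \<le> 1" "0 < a" "1 \<le> R" and "R + 2 < \<bar>u\<bar> \<or> R + 2 < \<bar>v\<bar>"
  shows "test_fun a R \<epsilon> (u, v) = 0"
  using assms(5)
proof
  assume "R + 2 < \<bar>u\<bar>"
  then have "window \<epsilon> u = 0" using assms by (intro window_outside) auto
  then show ?thesis by (simp add: test_fun_def)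
next
  assume "R + 2 < \<bar>v\<bar>"
  then have "soft_pow a R \<epsilon> v = 0" using assms by (intro soft_pow_outside) auto
  then show ?thesis by (simp add: test_fun_def)
qed

lemma grid_functional_test_fun:
  assumes "0 < \<epsilon>" "\<epsilon> \<le> 1" "0 < a" "1 \<le> R"
  shows "grid_functional (test_fun a R \<epsilon>) (R + 2) (\<lambda>v. iexp (\<xi> * v))"
proof
  show "continuous_on UNIV (\<lambda>v. iexp (\<xi> * v))" by (intro continuous_intros)
qed (use assms continuous_on_test_fun test_fun_support in auto)

text \<open>For each time j only a height N (x + j \<alpha> - k) in (0, R) counts, and R \<le> N
  leaves a single candidate k, the one that reduces x + j \<alpha> to (0,1]. Times beyond 2N fall
  outside the window because \<epsilon> \<le> 1.\<close>

lemma grid_sum_test_fun: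
  assumes \<epsilon>: "0 < \<epsilon>" "\<epsilon> \<le> 1" and a: "0 < a" and R: "1 \<le> R" "R \<le> real N"
  shows "grid_sum (test_fun a R \<epsilon>) (1 / real N) (real N * \<alpha>) 0 (- real N) 0 (- x) =
    (\<Sum>j=-2 * int N..2 * int N. window \<epsilon> (of_int j / real N) * soft_pow a R \<epsilon> (real N * circle_rep (x + of_int j * \<alpha>)))"
proof -
  have N: "0 < real N" using R by linarith
  define k0 where "k0 j = \<lceil>x + of_int j * \<alpha>\<rceil> - 1" for j
  let ?f = "\<lambda>(j, k). window \<epsilon> (of_int j / real N) * soft_pow a R \<epsilon> (real N * (x + of_int j * \<alpha> - of_int k))"
  have "grid_sum (test_fun a R \<epsilon>) (1 / real N) (real N * \<alpha>) 0 (- real N) 0 (- x) = (\<Sum>\<^sub>\<infinity>p\<in>UNIV. ?f p)"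
    unfolding grid_sum_def test_fun_def
    by (rule infsum_cong) (auto intro!: arg_cong[where f = "soft_pow a R \<epsilon>"] simp: algebra_simps)
  also have "\<dots> = (\<Sum>\<^sub>\<infinity>p\<in>(\<lambda>j. (j, k0 j)) ` {-2 * int N..2 * int N}. ?f p)"
  proof (rule infsum_cong_neutral)
    fix p assume p: "p \<in> UNIV - (\<lambda>j. (j, k0 j)) ` {-2 * int N..2 * int N}"
    obtain j k where jk: "p = (j, k)" by (cases p)
    show "?f p = 0"
    proof (cases "j \<in> {-2 * int N..2 * int N}")
      case False
      then have "real_of_int j < - 2 * real N \<or> 2 * real N < real_of_int j" by auto
      then have "of_int j / real N \<le> - \<epsilon> \<or> 1 + \<epsilon> \<le> of_int j / real N"
      proof
        assume "real_of_int j < - 2 * real N"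
        then have "of_int j / real N < - 2" using N by (simp add: pos_divide_less_eq)
        then show ?thesis using \<epsilon> by simp
      next
        assume "2 * real N < real_of_int j"
        then have "2 < of_int j / real N" using N by (simp add: pos_less_divide_eq)
        then show ?thesis using \<epsilon> by simp
      qed
      then have "window \<epsilon> (of_int j / real N) = 0" by (rule window_outside[OF \<epsilon>(1)])
      then show ?thesis by (simp add: jk)
    next
      case True
      then have "k \<noteq> k0 j" using p jk by auto
      then have "x + of_int j * \<alpha> - of_int k \<le> 0 \<or> 1 \<le> x + of_int j * \<alpha> - of_int k"
        unfolding k0_def by linarith
      then have "real N * (x + of_int j * \<alpha> - of_int k) \<le> 0 \<or> R \<le> real N * (x + of_int j * \<alpha> - of_int k)"
      proof
        assume "1 \<le> x + of_int j * \<alpha> - of_int k"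
        then have "real N * 1 \<le> real N * (x + of_int j * \<alpha> - of_int k)" using N by (intro mult_left_mono) auto
        then show ?thesis using R by linarith
      qed (use N in \<open>simp add: mult_le_0_iff\<close>)
      then have "soft_pow a R \<epsilon> (real N * (x + of_int j * \<alpha> - of_int k)) = 0"
        using \<epsilon> a R by (intro soft_pow_outside) auto
      then show ?thesis by (simp add: jk)
    qed
  qed auto
  also have "\<dots> = (\<Sum>p\<in>(\<lambda>j. (j, k0 j)) ` {-2 * int N..2 * int N}. ?f p)" by (rule infsum_finite) simp
  also have "\<dots> = (\<Sum>j=-2 * int N..2 * int N. ?f (j, k0 j))"
    by (rule sum.reindex_cong[where l = "\<lambda>j. (j, k0 j)"]) (auto simp: inj_on_def)
  also have "\<dots> = (\<Sum>j=-2 * int N..2 * int N. window \<epsilon> (of_int j / real N) * soft_pow a R \<epsilon> (real N * circle_rep (x + of_int j * \<alpha>)))"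
  proof (rule sum.cong[OF refl])
    fix j
    have "x + of_int j * \<alpha> - of_int (k0 j) = circle_rep (x + of_int j * \<alpha>)" by (simp add: k0_def circle_rep_def)
    then show "?f (j, k0 j) = window \<epsilon> (of_int j / real N) * soft_pow a R \<epsilon> (real N * circle_rep (x + of_int j * \<alpha>))"
      by simp
  qed
  finally show ?thesis .
qed

text \<open>The times seen by the window but not by the Birkhoff sum. Time N itself is among them:
  the window equals 1 at 1, whereas the sum stops at N - 1.\<close>

definition edge_times :: "real \<Rightarrow> nat \<Rightarrow> int set" where
  "edge_times \<epsilon> N = {j \<in> {-2 * int N..2 * int N}. (j < 0 \<or> int N \<le> j) \<and> window \<epsilon> (of_int j / real N) \<noteq> 0}"

lemma finite_edge_times [simp]: "finite (edge_times \<epsilon> N)"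
  by (rule finite_subset[of _ "{-2 * int N..2 * int N}"]) (auto simp: edge_times_def)

text \<open>Such times lie in an interval of length \<epsilon> N on the left or of length \<epsilon>
  N + 1 on the right, and rounding adds 1 to each count.\<close>

lemma card_edge_times:
  assumes \<epsilon>: "0 < \<epsilon>" and N: "0 < N"
  shows "real (card (edge_times \<epsilon> N)) \<le> 2 * \<epsilon> * real N + 3"
proof -
  let ?A = "{k::int. - \<epsilon> * real N < of_int k \<and> of_int k \<le> (0::real)}"
    and ?B = "{k::int. real N - 1 < of_int k \<and> of_int k \<le> real N + \<epsilon> * real N}"
  have le: "- \<epsilon> * real N \<le> 0" "real N - 1 \<le> real N + \<epsilon> * real N"
    using \<epsilon> mult_nonneg_nonneg[of \<epsilon> "real N"] by linarith+
  have "edge_times \<epsilon> N \<subseteq> ?A \<union> ?B"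
  proof
    fix j assume j: "j \<in> edge_times \<epsilon> N"
    then have "\<not> (of_int j / real N \<le> - \<epsilon> \<or> 1 + \<epsilon> \<le> of_int j / real N)"
      using window_outside[OF \<epsilon>, of "of_int j / real N"] by (auto simp: edge_times_def)
    then have "- \<epsilon> < of_int j / real N" "of_int j / real N < 1 + \<epsilon>" by auto
    then have "- \<epsilon> * real N < of_int j" "of_int j < (1 + \<epsilon>) * real N"
      using N by (auto simp: pos_less_divide_eq pos_divide_less_eq)
    moreover have "j < 0 \<or> int N \<le> j" using j by (simp add: edge_times_def)
    then have "real_of_int j \<le> 0 \<or> real N - 1 < of_int j" by linarith
    ultimately show "j \<in> ?A \<union> ?B" by (auto simp: algebra_simps)
  qed
  then have "card (edge_times \<epsilon> N) \<le> card (?A \<union> ?B)"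
    using card_int_Ioc_le(1)[OF le(1)] card_int_Ioc_le(1)[OF le(2)] by (intro card_mono) auto
  also have "\<dots> \<le> card ?A + card ?B" by (rule card_Un_le)
  finally have "real (card (edge_times \<epsilon> N)) \<le> real (card ?A) + real (card ?B)" by linarith
  then show ?thesis
    using card_int_Ioc_le(2)[OF le(1)] card_int_Ioc_le(2)[OF le(2)] by linarith
qed

text \<open>Under \<open>near\<close> and \<open>edge\<close> neither softening is visible: all
  points of the sum lie beyond the ramp, and the edge times do not reach the support of
  \<open>soft_pow\<close>.\<close>

lemma grid_sum_eq_trunc_sum:
  assumes \<epsilon>: "0 < \<epsilon>" "\<epsilon> \<le> 1" and a: "0 < a" and R: "1 \<le> R" "R \<le> real N"
    and near: "\<And>n. n < N \<Longrightarrow> 2 * \<epsilon> / real N < orbit \<alpha> x n"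
    and edge: "\<And>j. j \<in> edge_times \<epsilon> N \<Longrightarrow> R / real N < circle_rep (x + of_int j * \<alpha>)"
  shows "grid_sum (test_fun a R \<epsilon>) (1 / real N) (real N * \<alpha>) 0 (- real N) 0 (- x) =
    (\<Sum>n<N. trunc_pow a R (real N * orbit \<alpha> x n))"
proof -
  have N: "0 < real N" using R by linarith
  let ?g = "\<lambda>j. window \<epsilon> (of_int j / real N) * soft_pow a R \<epsilon> (real N * circle_rep (x + of_int j * \<alpha>))"
  have "(\<Sum>j=-2 * int N..2 * int N. ?g j) = (\<Sum>j\<in>int ` {..<N}. ?g j)"
  proof (rule sum.mono_neutral_right)
    show "int ` {..<N} \<subseteq> {-2 * int N..2 * int N}" by auto
    show "\<forall>j\<in>{-2 * int N..2 * int N} - int ` {..<N}. ?g j = 0"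
    proof
      fix j assume j: "j \<in> {-2 * int N..2 * int N} - int ` {..<N}"
      have "j < 0 \<or> int N \<le> j"
      proof (rule ccontr)
        assume "\<not> (j < 0 \<or> int N \<le> j)"
        then have "j = int (nat j)" "nat j < N" by auto
        then have "j \<in> int ` {..<N}" by blast
        with j show False by simp
      qed
      then consider "window \<epsilon> (of_int j / real N) = 0" | "j \<in> edge_times \<epsilon> N"
        using j by (auto simp: edge_times_def)
      then show "?g j = 0"
      proof cases
        case 2
        then have "R \<le> real N * circle_rep (x + of_int j * \<alpha>)"
          using edge[OF 2] N by (simp add: pos_divide_less_eq mult.commute)
        then have "soft_pow a R \<epsilon> (real N * circle_rep (x + of_int j * \<alpha>)) = 0"
          using \<epsilon> a R by (intro soft_pow_outside) auto
        then show ?thesis by simp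
      qed simp
    qed
  qed simp
  also have "\<dots> = (\<Sum>n<N. ?g (int n))" by (simp add: sum.reindex)
  also have "\<dots> = (\<Sum>n<N. trunc_pow a R (real N * orbit \<alpha> x n))"
  proof (rule sum.cong[OF refl])
    fix n assume "n \<in> {..<N}"
    then have n: "n < N" by simp
    have "window \<epsilon> (of_int (int n) / real N) = 1" using n N \<epsilon> by (intro window_inside) auto
    moreover have "2 * \<epsilon> \<le> real N * orbit \<alpha> x n"
      using near[OF n] N by (simp add: pos_divide_less_eq mult.commute)
    ultimately show "?g (int n) = trunc_pow a R (real N * orbit \<alpha> x n)"
      using soft_pow_eq_trunc_pow[of \<epsilon> a R] \<epsilon> a R by simp
  qed
  finally show ?thesis using grid_sum_test_fun[OF \<epsilon> a R, of \<alpha> x] by simp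
qed

text \<open>Union bound over N visits below 2 \<epsilon> / N and at most 2 \<epsilon> N + 3 edge
  visits below R/N. The product \<epsilon> R is the reason for choosing \<epsilon> after R.\<close>

lemma bad_set:
  assumes \<epsilon>: "0 < \<epsilon>" "2 * \<epsilon> \<le> real N" and R: "1 \<le> R" "R \<le> real N"
  obtains V where "V \<in> sets haar2" "measure haar2 V \<le> 2 * \<epsilon> + 2 * \<epsilon> * R + 3 * R / real N"
    "\<And>\<alpha> x n. (\<alpha>, x) \<in> {0<..1} \<times> {0<..1} - V \<Longrightarrow> n < N \<Longrightarrow> 2 * \<epsilon> / real N < orbit \<alpha> x n"
    "\<And>\<alpha> x j. (\<alpha>, x) \<in> {0<..1} \<times> {0<..1} - V \<Longrightarrow> j \<in> edge_times \<epsilon> N \<Longrightarrow> R / real N < circle_rep (x + of_int j * \<alpha>)"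
proof -
  interpret prob_space haar2 by (rule prob_space_haar2)
  have N: "0 < real N" using R by linarith
  have w: "0 \<le> 2 * \<epsilon> / real N" "2 * \<epsilon> / real N \<le> 1" "0 \<le> R / real N" "R / real N \<le> 1" using \<epsilon> R N by auto
  define S where "S w j = {p \<in> {0<..1} \<times> {0<..1}. circle_rep (snd p + of_int j * fst p) \<le> w}" for w and j :: int
  note S = haar2_visit[OF w(1,2), folded S_def] haar2_visit[OF w(3,4), folded S_def]
  define V where "V = (\<Union>n<N. S (2 * \<epsilon> / real N) (int n)) \<union> (\<Union>j\<in>edge_times \<epsilon> N. S (R / real N) j)"
  show ?thesis
  proof (rule that[of V])
    show "V \<in> sets haar2" unfolding V_def using S by auto
    have "measure haar2 V \<le> measure haar2 (\<Union>n<N. S (2 * \<epsilon> / real N) (int n)) + measure haar2 (\<Union>j\<in>edge_times \<epsilon> N. S (R / real N) j)"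
      unfolding V_def by (rule measure_Un_le) (use S in auto)
    also have "measure haar2 (\<Union>n<N. S (2 * \<epsilon> / real N) (int n)) \<le> (\<Sum>n<N. measure haar2 (S (2 * \<epsilon> / real N) (int n)))"
      by (rule measure_UNION_le) (use S in auto)
    also have "\<dots> = 2 * \<epsilon>" using N by (simp add: S)
    also have "measure haar2 (\<Union>j\<in>edge_times \<epsilon> N. S (R / real N) j) \<le> (\<Sum>j\<in>edge_times \<epsilon> N. measure haar2 (S (R / real N) j))"
      by (rule measure_UNION_le) (use S in auto)
    also have "\<dots> = real (card (edge_times \<epsilon> N)) * (R / real N)" by (simp add: S)
    also have "\<dots> \<le> (2 * \<epsilon> * real N + 3) * (R / real N)"
      using N w by (intro mult_right_mono card_edge_times \<epsilon>) auto
    also have "\<dots> = 2 * \<epsilon> * R + 3 * R / real N" using N by (simp add: field_simps)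
    finally show "measure haar2 V \<le> 2 * \<epsilon> + 2 * \<epsilon> * R + 3 * R / real N" by simp
    fix \<alpha> x assume p: "(\<alpha>, x) \<in> {0<..1} \<times> {0<..1} - V"
    show "2 * \<epsilon> / real N < orbit \<alpha> x n" if "n < N" for n
    proof -
      have "(\<alpha>, x) \<notin> S (2 * \<epsilon> / real N) (int n)" using p that by (auto simp: V_def)
      then show ?thesis using p by (auto simp: S_def)
    qed
    show "R / real N < circle_rep (x + of_int j * \<alpha>)" if "j \<in> edge_times \<epsilon> N" for j
    proof -
      have "(\<alpha>, x) \<notin> S (R / real N) j" using p that by (auto simp: V_def)
      then show ?thesis using p by (auto simp: S_def)
    qed
  qed
qed

section \<open>Comparison of the Birkhoff sum with the grid sum\<close>

lemma iexp_lipschitz: "norm (iexp s - iexp t) \<le> \<bar>s - t\<bar>" for s t :: real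
proof -
  have "iexp s - iexp t = iexp t * (iexp (s - t) - 1)"
    by (simp add: right_diff_distrib flip: exp_add)
  then have "norm (iexp s - iexp t) = norm (iexp (s - t) - 1)" by (simp add: norm_mult)
  also have "\<dots> \<le> \<bar>s - t\<bar>" using iexp_approx1[of "s - t" 0] by simp
  finally show ?thesis .
qed

text \<open>Outside a bad set \<open>B\<close> the normalised sum differs from
  \<open>gf.X N \<alpha> x - \<kappa>\<close> by an amount that is small for large R. The
  characteristic function of the grid sum converges by \<open>grid_functional_convergent\<close>,
  and the constant \<kappa> contributes only a fixed phase.\<close>

lemma char_normalized_sum_convergent:
  assumes a: "0 < a" "a < 1"
  shows "convergent (\<lambda>N. char (sum_law a N) \<xi>)"
proof (rule convergent_approx)
  interpret H1: prob_space haar1 by (rule prob_space_haar1)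
  interpret H2: prob_space haar2 by (rule prob_space_haar2)
  interpret pair_prob_space haar1 haar1 ..
  fix e :: real assume e: "0 < e"
  define c where "c = min 1 (e * a / (32 * (2 + a)))"
  have c: "0 < c" "c \<le> 1" using e a by (auto simp: c_def)
  \<comment> \<open>The factor 2 is the trivial bound on \<open>B\<close> for the difference of two
    numbers of modulus 1. Exceptional angles, softening and rounding get e/4 each, and the last
    quarter goes to the truncation at R.\<close>
  have ce: "2 * (4 * c * (2 + a) / a) \<le> e / 4"
  proof -
    have "c \<le> e * a / (32 * (2 + a))" by (simp add: c_def)
    then show ?thesis using a by (simp add: field_simps)
  qed
  define K where "K = 3 * c powr (- 1 - a / 2) * (4 / (a * ln 2) + 1) + 1 / c + 1"
  obtain R where R: "1 \<le> R" "\<bar>\<xi>\<bar> * (4 * K * R powr (- a / 4)) \<le> e / 4"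
  proof -
    have "((\<lambda>R. \<bar>\<xi>\<bar> * (4 * K * R powr (- a / 4))) \<longlongrightarrow> \<bar>\<xi>\<bar> * (4 * K * 0)) at_top"
      using a by (intro tendsto_intros tendsto_neg_powr filterlim_ident) auto
    then have "\<forall>\<^sub>F R in at_top. \<bar>\<xi>\<bar> * (4 * K * R powr (- a / 4)) < e / 4"
      using e by (intro order_tendstoD) auto
    then have "\<forall>\<^sub>F R in at_top. 1 \<le> R \<and> \<bar>\<xi>\<bar> * (4 * K * R powr (- a / 4)) < e / 4"
      using eventually_ge_at_top[of 1] by eventually_elim auto
    then obtain R where "1 \<le> R \<and> \<bar>\<xi>\<bar> * (4 * K * R powr (- a / 4)) < e / 4"
      unfolding eventually_at_top_linorder by blast
    then show ?thesis using that[of R] by simp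
  qed
  define \<epsilon> where "\<epsilon> = min (1 / 2) (e / (16 * (1 + R)))"
  have \<epsilon>: "0 < \<epsilon>" "\<epsilon> \<le> 1 / 2" unfolding \<epsilon>_def using e R by (simp, intro min.cobounded1)
  have \<epsilon>e: "2 * (2 * \<epsilon> + 2 * \<epsilon> * R) \<le> e / 4"
  proof -
    have "\<epsilon> \<le> e / (16 * (1 + R))" by (simp add: \<epsilon>_def)
    then show ?thesis using R by (simp add: field_simps)
  qed
  \<comment> \<open>Centring constant left by the truncation at R.\<close>
  define \<kappa> where "\<kappa> = a * R powr (1 - a) / (1 - a)"
  interpret gf: grid_functional "test_fun a R \<epsilon>" "R + 2" "\<lambda>v. iexp (\<xi> * v)"
    by (rule grid_functional_test_fun) (use \<epsilon> a R in auto)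
  define u where "u N = iexp (- \<xi> * \<kappa>) * (\<integral>\<alpha>. (\<integral>x. iexp (\<xi> * gf.X N \<alpha> x) \<partial>haar1) \<partial>haar1)" for N
  have "convergent u"
    using gf.grid_functional_convergent tendsto_mult[OF tendsto_const]
    unfolding u_def convergent_def by blast
  \<comment> \<open>\<open>24 * R / e\<close> makes the rounding term 3R/N of the bad set, doubled,
    at most e/4.\<close>
  moreover obtain N0 :: nat where N0: "max R (24 * R / e) \<le> real N0" using real_arch_simple by blast
  have "\<forall>\<^sub>F N in sequentially. norm (char (sum_law a N) \<xi> - u N) \<le> e"
  proof (rule eventually_mono[OF eventually_ge_at_top[of N0]])
    fix N assume "N0 \<le> N"
    then have "max R (24 * R / e) \<le> real N" using N0 by linarith
    then have RN: "R \<le> real N" "24 * R / e \<le> real N" by auto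
    then have N: "0 < N" using R by (cases N) auto
    have Ne: "2 * (3 * R / real N) \<le> e / 4" using RN(2) e N by (simp add: field_simps)
    obtain E where E: "E \<in> sets haar2" "measure haar2 E \<le> 4 * c * (2 + a) / a"
      "\<And>p. p \<in> {0<..1} \<times> {0<..1} - E \<Longrightarrow> diophantine c (a / (2 + a)) N (fst p)"
      using good_set[OF a c N] by metis
    have "2 * \<epsilon> \<le> real N" using \<epsilon> N by linarith
    from bad_set[OF \<epsilon>(1) this R(1) RN(1)] obtain V where
      V: "V \<in> sets haar2" "measure haar2 V \<le> 2 * \<epsilon> + 2 * \<epsilon> * R + 3 * R / real N"
      "\<And>\<alpha> x n. (\<alpha>, x) \<in> {0<..1} \<times> {0<..1} - V \<Longrightarrow> n < N \<Longrightarrow> 2 * \<epsilon> / real N < orbit \<alpha> x n"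
      "\<And>\<alpha> x j. (\<alpha>, x) \<in> {0<..1} \<times> {0<..1} - V \<Longrightarrow> j \<in> edge_times \<epsilon> N \<Longrightarrow> R / real N < circle_rep (x + of_int j * \<alpha>)"
      by blast
    define B where "B = E \<union> V"
    have B: "B \<in> sets haar2" using E V by (simp add: B_def)
    have "measure haar2 B \<le> measure haar2 E + measure haar2 V"
      unfolding B_def by (rule measure_Un_le) (use E V in auto)
    moreover have "2 * b \<le> 3 * k" if "b \<le> u + v" "u \<le> p" "v \<le> s + t" "2 * p \<le> k" "2 * s \<le> k" "2 * t \<le> k"
      for b u v p s t k :: real using that by linarith
    ultimately have Bm: "2 * measure haar2 B \<le> 3 * (e / 4)" using E(2) V(2) ce \<epsilon>e Ne by blast
    define f where "f p = iexp (\<xi> * normalized_sum a N p)" for p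
    define g where "g p = iexp (- \<xi> * \<kappa>) * iexp (\<xi> * gf.X N (fst p) (snd p))" for p
    have fm: "f \<in> borel_measurable haar2"
      unfolding f_def by measurable
    have gm: "g \<in> borel_measurable haar2"
      unfolding g_def haar2_def using gf.measurable_X[OF N] by measurable
    have fi: "integrable haar2 f"
      by (rule H2.integrable_const_bound[where B = 1]) (use fm in \<open>auto simp: f_def\<close>)
    have gi: "integrable haar2 g"
      by (rule H2.integrable_const_bound[where B = 1]) (use gm in \<open>auto simp: g_def norm_mult\<close>)
    have char_f: "char (sum_law a N) \<xi> = (\<integral>p. f p \<partial>haar2)"
      unfolding char_def f_def by (rule integral_distr) auto
    have "(\<integral>\<alpha>. (\<integral>x. iexp (\<xi> * gf.X N \<alpha> x) \<partial>haar1) \<partial>haar1) = (\<integral>p. iexp (\<xi> * gf.X N (fst p) (snd p)) \<partial>haar2)"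
    proof -
      have m: "(\<lambda>p. iexp (\<xi> * gf.X N (fst p) (snd p))) \<in> borel_measurable (haar1 \<Otimes>\<^sub>M haar1)"
        using gf.measurable_X[OF N] by measurable
      have "integrable (haar1 \<Otimes>\<^sub>M haar1) (\<lambda>p. iexp (\<xi> * gf.X N (fst p) (snd p)))"
        by (rule P.integrable_const_bound[where B = 1]) (use m in auto)
      from integral_fst'[OF this] show ?thesis by (simp add: haar2_def)
    qed
    then have u_g: "u N = (\<integral>p. g p \<partial>haar2)" by (simp add: u_def g_def)
    have pt: "norm (f p - g p) \<le> 2 * indicator B p + e / 4" if p: "p \<in> space haar2" for p
    proof (cases "p \<in> B")
      case True
      have "norm (f p - g p) \<le> norm (f p) + norm (g p)" by (rule norm_triangle_ineq4)
      also have "\<dots> = 2" by (simp add: f_def g_def norm_mult)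
      finally show ?thesis using True e by simp
    next
      case False
      define \<alpha> x where "\<alpha> = fst p" and "x = snd p"
      have pE: "p \<in> {0<..1} \<times> {0<..1} - E" and pV: "(\<alpha>, x) \<in> {0<..1} \<times> {0<..1} - V"
        using p False by (auto simp: B_def \<alpha>_def x_def)
      have disc: "\<bar>real (hits \<alpha> x (t / real N) N) - t\<bar> \<le> K * t powr (3 * a / 4)" if "1 \<le> t" "t \<le> real N" for t
        unfolding K_def by (rule hits_discrepancy[OF a c N that]) (use E(3)[OF pE] in \<open>simp add: \<alpha>_def\<close>)
      have "gf.X N \<alpha> x = (\<Sum>n<N. trunc_pow a R (real N * orbit \<alpha> x n))"
        unfolding gf.X_def by (rule grid_sum_eq_trunc_sum) (use \<epsilon> a R RN V(3,4)[OF pV] in auto)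
      then have "\<bar>normalized_sum a N p - (gf.X N \<alpha> x - \<kappa>)\<bar> \<le> 4 * K * R powr (- a / 4)"
        using birkhoff_sum_truncation[OF a R(1) RN(1) disc]
        by (simp add: normalized_sum_def \<alpha>_def x_def \<kappa>_def)
      then have "\<bar>\<xi>\<bar> * \<bar>normalized_sum a N p - (gf.X N \<alpha> x - \<kappa>)\<bar> \<le> e / 4"
        using R(2) mult_left_mono[of _ _ "\<bar>\<xi>\<bar>"] by (meson abs_ge_zero order_trans)
      moreover have "g p = iexp (\<xi> * (gf.X N \<alpha> x - \<kappa>))"
        unfolding g_def \<alpha>_def x_def by (simp flip: exp_add) (simp add: algebra_simps)
      then have "norm (f p - g p) \<le> \<bar>\<xi> * normalized_sum a N p - \<xi> * (gf.X N \<alpha> x - \<kappa>)\<bar>"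
        unfolding f_def using iexp_lipschitz by metis
      moreover have "\<xi> * normalized_sum a N p - \<xi> * (gf.X N \<alpha> x - \<kappa>) = \<xi> * (normalized_sum a N p - (gf.X N \<alpha> x - \<kappa>))"
        by (simp add: algebra_simps)
      ultimately show ?thesis using False by (simp add: abs_mult)
    qed
    have Bi: "integrable haar2 (\<lambda>p. 2 * indicator B p + e / 4 :: real)"
      using B by (intro Bochner_Integration.integrable_add integrable_mult_right) (auto simp: H2.emeasure_eq_measure)
    have "norm ((\<integral>p. f p \<partial>haar2) - (\<integral>p. g p \<partial>haar2)) = norm (\<integral>p. f p - g p \<partial>haar2)"
      using fi gi by simp
    also have "\<dots> \<le> (\<integral>p. norm (f p - g p) \<partial>haar2)" by (rule Bochner_Integration.integral_norm_bound)
    also have "\<dots> \<le> (\<integral>p. 2 * indicator B p + e / 4 \<partial>haar2)"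
      by (rule Bochner_Integration.integral_mono) (use fi gi Bi pt in auto)
    also have "\<dots> = 2 * measure haar2 B + e / 4"
      using B H2.prob_space by (subst Bochner_Integration.integral_add)
        (auto simp: H2.emeasure_eq_measure sets.Int_space_eq2 simp del: space_haar2)
    also have "\<dots> \<le> e" using Bm by linarith
    finally show "norm (char (sum_law a N) \<xi> - u N) \<le> e"
      by (simp add: char_f u_g)
  qed
  ultimately show "\<exists>u. convergent u \<and> (\<forall>\<^sub>F N in sequentially. norm (char (sum_law a N) \<xi> - u N) \<le> e)"
    by blast
qed

section \<open>The limit law\<close>

text \<open>Tightness gives a subsequence converging to a law \<open>M\<close>. Along it the
  characteristic functions tend both to that of \<open>M\<close> and to the limit of the full
  sequence, so the full sequence has limit \<open>char M\<close> and Levy's continuity theorem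
  applies to it.\<close>

lemma limit_law:
  assumes a: "0 < a" "a < 1"
  obtains M where "real_distribution M" "weak_conv_m (sum_law a) M"
proof -
  interpret H2: prob_space haar2 by (rule prob_space_haar2)
  define \<nu> where "\<nu> N = sum_law a N" for N
  have \<nu>: "real_distribution (\<nu> N)" for N by (simp add: \<nu>_def)
  have tight: "tight \<nu>" unfolding \<nu>_def by (rule tight_normalized_sum[OF a])
  obtain r M where r: "strict_mono (r :: nat \<Rightarrow> nat)" "real_distribution M" "weak_conv_m (\<nu> \<circ> id \<circ> r) M"
    using tight_imp_convergent_subsubsequence[OF tight strict_mono_id] by blast
  have "(\<lambda>N. char (\<nu> N) \<xi>) \<longlonglongrightarrow> char M \<xi>" for \<xi>
  proof -
    obtain l where l: "(\<lambda>N. char (\<nu> N) \<xi>) \<longlonglongrightarrow> l"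
      using char_normalized_sum_convergent[OF a, of \<xi>] unfolding \<nu>_def convergent_def by blast
    have "(\<lambda>n. char ((\<nu> \<circ> id \<circ> r) n) \<xi>) \<longlonglongrightarrow> char M \<xi>"
      by (rule levy_continuity1[OF _ r(2,3)]) (simp add: \<nu>)
    moreover have "(\<lambda>n. char ((\<nu> \<circ> id \<circ> r) n) \<xi>) \<longlonglongrightarrow> l"
      using LIMSEQ_subseq_LIMSEQ[OF l r(1)] by (simp add: o_def)
    ultimately show ?thesis using l LIMSEQ_unique by blast
  qed
  then have "weak_conv_m \<nu> M" by (rule levy_continuity[OF \<nu> r(2)])
  then show ?thesis using that r(2) unfolding \<nu>_def by blast
qed

text \<open>\<open>D\<close> is the quantile function of the limit law, evaluated at the first
  coordinate of the uniform point of the torus.\<close>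

theorem mainTheorem1:
  fixes a :: real
    and \<mu>' :: "(real^2) set measure"
    and \<mu> :: "((real^2) set \<times> (real \<times> real)) measure"
  assumes "0 < a" and "a < 1"
    and "SL2_invariant_prob \<mu>'"
    and "\<mu> = \<mu>' \<Otimes>\<^sub>M haar2"
  shows "\<exists>D :: (real^2) set \<times> (real \<times> real) \<Rightarrow> ereal.
    D \<in> borel_measurable \<mu> \<and>
    (AE p in \<mu>. \<bar>D p\<bar> \<noteq> \<infinity>) \<and>
    (AE z in lborel.
      (\<lambda>N. measure haar2 {(\<alpha>, x) \<in> space haar2. birkhoff_sum a \<alpha> x N / real N powr a \<le> z})
        \<longlonglongrightarrow> measure \<mu> {(L, \<gamma>) \<in> space \<mu>. D (L, \<gamma>) \<le> ereal z})"
proof -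
  obtain M where M: "real_distribution M" "weak_conv_m (sum_law a) M"
    by (rule limit_law[OF assms(1,2)])
  interpret M: cdf_distribution M using M(1) by (simp add: cdf_distribution_def)
  interpret L: prob_space \<mu>' using assms(3) by (simp add: SL2_invariant_prob_def)
  interpret H1: prob_space haar1 by (rule prob_space_haar1)
  interpret H2: prob_space haar2 by (rule prob_space_haar2)
  \<comment> \<open>\<open>M.I\<close> is the quantile function on (0,1). On the circle the default
    0 concerns only the null set u = 1, and it makes \<open>D\<close> finite everywhere.\<close>
  define d where "d u = (if u \<in> {0<..<1} then M.I u else 0)" for u
  have d: "d \<in> borel_measurable borel"
    unfolding d_def using M.measurable_CI
    by (subst measurable_restrict_space_iff[symmetric]) auto
  define D :: "(real^2) set \<times> (real \<times> real) \<Rightarrow> ereal" where "D p = ereal (d (fst (snd p)))" for p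
  have D: "D \<in> borel_measurable \<mu>"
    unfolding D_def assms(4)
    by (intro borel_measurable_ereal measurable_compose[OF measurable_compose[OF measurable_snd fst_haar2] d])
  have law: "measure \<mu> {(L, \<gamma>) \<in> space \<mu>. D (L, \<gamma>) \<le> ereal z} = cdf M z" for z
  proof -
    let ?A = "{u \<in> {0<..1}. d u \<le> z}"
    have "{u. d u \<le> z} \<in> sets borel" using measurable_sets[OF d, of "{..z}"] by (simp add: vimage_def)
    from haar1_Int_in_sets[OF this] have A: "?A \<in> sets haar1" by (simp add: Int_def)
    have I: "{0<..1} \<in> sets haar1" using sets.top[of haar1] by simp
    have AI: "?A \<times> {0<..1} \<in> sets haar2" using A I by (simp add: haar2_def)
    have "{(L, \<gamma>) \<in> space \<mu>. D (L, \<gamma>) \<le> ereal z} = space \<mu>' \<times> (?A \<times> {0<..1})"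
      by (auto simp: assms(4) space_pair_measure D_def)
    then have "emeasure \<mu> {(L, \<gamma>) \<in> space \<mu>. D (L, \<gamma>) \<le> ereal z} = emeasure haar2 (?A \<times> {0<..1})"
      by (simp only: assms(4) H2.emeasure_pair_measure_Times[OF sets.top AI] L.emeasure_space_1 mult_1_left)
    then have "measure \<mu> {(L, \<gamma>) \<in> space \<mu>. D (L, \<gamma>) \<le> ereal z} = measure haar2 (?A \<times> {0<..1})"
      by (simp add: measure_def)
    also have "\<dots> = measure haar1 ?A"
      using measure_haar2_Times[OF A I] H1.prob_space by simp
    also have "\<dots> = measure haar1 {0<..cdf M z}"
    proof (rule H1.finite_measure_eq_AE)
      show "AE u in haar1. u \<in> ?A \<longleftrightarrow> u \<in> {0<..cdf M z}"
        using AE_haar1_neq[of 1] AE_space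
      proof eventually_elim
        case (elim u)
        then have u: "0 < u" "u < 1" by auto
        then have "M.I u \<le> z \<longleftrightarrow> u \<le> cdf M z" using M.pseudoinverse[of u z] by simp
        then show ?case using u by (simp add: d_def)
      qed
      have "{0<..1} \<inter> {..cdf M z} \<in> sets haar1" by (rule haar1_Int_in_sets) simp
      moreover have "{0<..1} \<inter> {..cdf M z} = {0<..cdf M z}" using M.cdf_bounded_prob[of z] by auto
      ultimately show "{0<..cdf M z} \<in> sets haar1" by simp
    qed (rule A)
    also have "\<dots> = cdf M z"
      using measure_haar1_Ioc[of 0 "cdf M z"] M.cdf_nonneg M.cdf_bounded_prob by simp
    finally show ?thesis .
  qed
  have dist: "measure haar2 {(\<alpha>, x) \<in> space haar2. birkhoff_sum a \<alpha> x N / real N powr a \<le> z} =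
      cdf (sum_law a N) z" for N z
  proof -
    have "cdf (sum_law a N) z = measure haar2 (normalized_sum a N -` {..z} \<inter> space haar2)"
      unfolding cdf_def by (rule measure_distr) auto
    also have "normalized_sum a N -` {..z} \<inter> space haar2 = {(\<alpha>, x) \<in> space haar2. birkhoff_sum a \<alpha> x N / real N powr a \<le> z}"
      by (auto simp: normalized_sum_def)
    finally show ?thesis ..
  qed
  \<comment> \<open>Weak convergence is convergence of the distribution functions at the continuity
    points of the limit; the atoms of \<open>M\<close> are countable, so almost every z is
    covered.\<close>
  have "AE z in lborel. z \<notin> {z. 0 < measure M {z}}"
    by (rule AE_not_in) (rule countable_imp_null_set_lborel[OF M.countable_atoms])
  then have "AE z in lborel.
      (\<lambda>N. measure haar2 {(\<alpha>, x) \<in> space haar2. birkhoff_sum a \<alpha> x N / real N powr a \<le> z})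
        \<longlonglongrightarrow> measure \<mu> {(L, \<gamma>) \<in> space \<mu>. D (L, \<gamma>) \<le> ereal z}"
  proof eventually_elim
    case (elim z)
    then have "isCont (cdf M) z" using M.isCont_cdf by (simp add: zero_less_measure_iff)
    then show ?case using M(2) unfolding weak_conv_m_def weak_conv_def law dist by blast
  qed
  then show ?thesis using D by (intro exI[of _ D]) (auto simp: D_def)
qed

end
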